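(* Let $\mathcal{A}^{\mathbb{Z}}$ be any Abelian group shift, let $(\mathcal{A}^{\mathbb{Z}},F)$ be a nontrivial algebraic bipermutative cellular automaton, let $\Sigma$ be a closed $(F,\sigma)$-invariant subgroup of $\mathcal{A}^{\mathbb{Z}}$, let $k\in\mathbb{N}$ be such that every prime factor of $|\mathcal{A}|$ divides $k$, and let $\mu$ be an $(F,\sigma)$-invariant Borel probability measure on $\mathcal{A}^{\mathbb{Z}}$ with $\mathrm{supp}(\mu)\subset\Sigma$. Assume that: 1. $\mu$ is ergodic for the $\mathbb{N}\times\mathbb{Z}$-action $(F,\sigma)$; 2. $\mathcal{I}_\mu(\sigma)=\mathcal{I}_\mu(\sigma^{kp_1})$, where $p_1$ is the smallest common $\sigma$-period of all elements of $\mathrm{Ker}(F)$; 3. the measure entropy $h_\mu(F)$ is positive; 4. every $\sigma$-invariant infinite subgroup of $D^{\Sigma}_\infty(F)=\bigcup_{n\in\mathbb{N}}\mathrm{Ker}(F^n)\cap\Sigma$ is dense in $\Sigma$. Then $\mu=\lambda_\Sigma$, the Haar measure on $\Sigma$.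
   Context: $\mathcal{A}$ is a finite set, $\mathcal{A}^{\mathbb{Z}}$ has the product topology, and $\sigma(x)_i=x_{i+1}$ is the shift. A cellular automaton (CA) $(\mathcal{A}^{\mathbb{Z}},F)$ is a continuous map $F:\mathcal{A}^{\mathbb{Z}}\to\mathcal{A}^{\mathbb{Z}}$ commuting with $\sigma$; equivalently there are a finite interval $\mathbb{U}\subset\mathbb{Z}$ (a neighborhood) and a local rule $\overline{F}:\mathcal{A}^{\mathbb{U}}\to\mathcal{A}$ with $F(x)_m=\overline{F}((x_{m+u})_{u\in\mathbb{U}})$ for all $m$. The smallest such interval is the smallest neighborhood; $F$ is trivial if it is a single point, and nontrivial otherwise. If the smallest neighborhood is $[r,s]$, $F$ is left-permutative if for all $u\in\mathcal{A}^{s-r}$, $b\in\mathcal{A}$ there is a unique $a\in\mathcal{A}$ with $\overline{F}(au)=b$; right-permutative if for all such $u,b$ there is a unique $a$ with $\overline{F}(ua)=b$; bipermutative if both. $\mathcal{A}^{\mathbb{Z}}$ is an Abelian group shift if it is endowed with an Abelian topological group structure (for its product topology; not necessarily a product group structure) for which $\sigma$ is a continuous group endomorphism. A CA $F$ on an Abelian group shift is algebraic if $F$ is a group endomorphism. (For $F$ bipermutative and algebraic, $\mathrm{Ker}(F^n)$ is finite and consists of $\sigma$-periodic points for every $n$.) A subset or subgroup $\Gamma$ is $\sigma$-invariant if $\sigma(\Gamma)=\Gamma$, and $(F,\sigma)$-invariant if moreover $F(\Gamma)\subset\Gamma$. A measure $\mu$ is $(F,\sigma)$-invariant if $\mu(F^{-1}B)=\mu(\sigma^{-1}B)=\mu(B)$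 for all Borel $B$. For a power $\sigma^n$, $\mathcal{I}_\mu(\sigma^n)=\{B \text{ Borel}:\mu(\sigma^{-n}(B)\triangle B)=0\}$. The Haar measure $\lambda_\Sigma$ is viewed as a probability measure on $\mathcal{A}^{\mathbb{Z}}$ supported on $\Sigma$. $h_\mu(F)$ is the Kolmogorov–Sinai entropy of $F$ with respect to $\mu$. *)

theory Defs
  imports
    "HOL-Analysis.Analysis"
    "HOL-Probability.Probability_Measure"
    "HOL-Algebra.Coset"
    "HOL-Computational_Algebra.Primes"
begin

section \<open>Configurations and cellular automata\<close>

text \<open>
  The alphabet is a type of class \<open>{finite, discrete_topology}\<close>, so that the topology which the
  library puts on the function type \<open>int \<Rightarrow> 'a\<close> is the product of the discrete topologies.
\<close>

type_synonym 'a config = "int \<Rightarrow> 'a"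

definition shift :: "'a config \<Rightarrow> 'a config" where
  "shift x = (\<lambda>i. x (i + 1))"

text \<open>The power \<open>\<sigma>\<^sup>m\<close> for an arbitrary integer \<open>m\<close>; for natural \<open>m\<close> it is \<open>shift ^^ m\<close>.\<close>

definition shift_int :: "int \<Rightarrow> 'a config \<Rightarrow> 'a config" where
  "shift_int m x = (\<lambda>i. x (i + m))"

definition cellular_automaton ::
    "('a::{finite,discrete_topology} config \<Rightarrow> 'a config) \<Rightarrow> bool" where
  "cellular_automaton F \<longleftrightarrow> continuous_on UNIV F \<and> F \<circ> shift = shift \<circ> F"

text \<open>
  \<open>f\<close> is a local rule of \<open>F\<close> on the interval \<open>[r, s]\<close>. Words over the alphabet are lists; only the
  values of \<open>f\<close> on lists of length \<open>s - r + 1\<close> matter, and they are determined by \<open>F\<close>.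
\<close>

definition local_rule :: "('a config \<Rightarrow> 'a config) \<Rightarrow> int \<Rightarrow> int \<Rightarrow> ('a list \<Rightarrow> 'a) \<Rightarrow> bool" where
  "local_rule F r s f \<longleftrightarrow> (\<forall>x m. F x m = f (map (\<lambda>u. x (m + u)) [r..s]))"

definition neighborhood :: "('a config \<Rightarrow> 'a config) \<Rightarrow> int \<Rightarrow> int \<Rightarrow> bool" where
  "neighborhood F r s \<longleftrightarrow> r \<le> s \<and> (\<exists>f. local_rule F r s f)"

text \<open>
  Neighborhoods are nonempty intervals. A constant map has all singletons as neighborhoods and hence
  no smallest one; every other cellular automaton has a smallest neighborhood.
\<close>

definition smallest_neighborhood :: "('a config \<Rightarrow> 'a config) \<Rightarrow> int \<Rightarrow> int \<Rightarrow> bool" where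
  "smallest_neighborhood F r s \<longleftrightarrow>
     neighborhood F r s \<and> (\<forall>r' s'. neighborhood F r' s' \<longrightarrow> {r..s} \<subseteq> {r'..s'})"

definition trivial_ca :: "('a config \<Rightarrow> 'a config) \<Rightarrow> bool" where
  "trivial_ca F \<longleftrightarrow> (\<exists>r. smallest_neighborhood F r r)"

definition left_permutative :: "('a config \<Rightarrow> 'a config) \<Rightarrow> bool" where
  "left_permutative F \<longleftrightarrow>
     (\<exists>r s f. smallest_neighborhood F r s \<and> local_rule F r s f \<and>
        (\<forall>u b. int (length u) = s - r \<longrightarrow> (\<exists>!a. f (a # u) = b)))"

definition right_permutative :: "('a config \<Rightarrow> 'a config) \<Rightarrow> bool" where
  "right_permutative F \<longleftrightarrow>
     (\<exists>r s f. smallest_neighborhood F r s \<and> local_rule F r s f \<and>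
        (\<forall>u b. int (length u) = s - r \<longrightarrow> (\<exists>!a. f (u @ [a]) = b)))"

definition bipermutative :: "('a config \<Rightarrow> 'a config) \<Rightarrow> bool" where
  "bipermutative F \<longleftrightarrow> left_permutative F \<and> right_permutative F"


section \<open>Abelian group shifts\<close>

definition abelian_group_shift :: "('a::{finite,discrete_topology} config) monoid \<Rightarrow> bool" where
  "abelian_group_shift G \<longleftrightarrow>
     comm_group G \<and> carrier G = UNIV \<and>
     continuous_on UNIV (\<lambda>(x, y). x \<otimes>\<^bsub>G\<^esub> y) \<and>
     continuous_on UNIV (\<lambda>x. inv\<^bsub>G\<^esub> x) \<and>
     shift \<in> hom G G \<and> continuous_on UNIV (shift :: 'a config \<Rightarrow> 'a config)"

definition algebraic_ca ::
    "('a::{finite,discrete_topology} config) monoid \<Rightarrow> ('a config \<Rightarrow> 'a config) \<Rightarrow> bool" where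
  "algebraic_ca G F \<longleftrightarrow> cellular_automaton F \<and> F \<in> hom G G"

definition shift_invariant :: "'a config set \<Rightarrow> bool" where
  "shift_invariant X \<longleftrightarrow> shift ` X = X"

definition ca_shift_invariant :: "('a config \<Rightarrow> 'a config) \<Rightarrow> 'a config set \<Rightarrow> bool" where
  "ca_shift_invariant F X \<longleftrightarrow> shift_invariant X \<and> F ` X \<subseteq> X"

text \<open>
  The smallest common \<open>\<sigma>\<close>-period of the elements of \<open>X\<close>. It is used for the kernel of a bipermutative
  algebraic cellular automaton, a finite set of periodic points, so a common period exists.
\<close>

definition smallest_common_period :: "'a config set \<Rightarrow> nat" where
  "smallest_common_period X = (LEAST p. p > 0 \<and> (\<forall>x\<in>X. (shift ^^ p) x = x))"

definition D_infinity ::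
    "'a config monoid \<Rightarrow> ('a config \<Rightarrow> 'a config) \<Rightarrow> 'a config set \<Rightarrow> 'a config set" where
  "D_infinity G F \<Sigma> = (\<Union>n. kernel G G (F ^^ n) \<inter> \<Sigma>)"


section \<open>Measures\<close>

definition borel_prob :: "'b::topological_space measure \<Rightarrow> bool" where
  "borel_prob \<mu> \<longleftrightarrow> prob_space \<mu> \<and> sets \<mu> = sets borel"

definition invariant_measure :: "('b \<Rightarrow> 'b) \<Rightarrow> 'b::topological_space measure \<Rightarrow> bool" where
  "invariant_measure T \<mu> \<longleftrightarrow> (\<forall>B\<in>sets borel. emeasure \<mu> (T -` B) = emeasure \<mu> B)"

definition measure_support :: "'b::topological_space measure \<Rightarrow> 'b set" where
  "measure_support \<mu> = {x. \<forall>U. open U \<and> x \<in> U \<longrightarrow> emeasure \<mu> U > 0}"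

text \<open>The sets \<open>\<I>\<^sub>\<mu>(T)\<close> of Borel sets invariant under \<open>T\<close> up to a null set.\<close>

definition inv_sets :: "'b::topological_space measure \<Rightarrow> ('b \<Rightarrow> 'b) \<Rightarrow> 'b set set" where
  "inv_sets \<mu> T = {B \<in> sets borel. emeasure \<mu> (sym_diff (T -` B) B) = 0}"

text \<open>Ergodicity for the action \<open>(n, m) \<mapsto> F\<^sup>n \<circ> \<sigma>\<^sup>m\<close> with \<open>n\<close> natural and \<open>m\<close> an integer.\<close>

definition ergodic_action ::
    "('a config \<Rightarrow> 'a config) \<Rightarrow> 'a::topological_space config measure \<Rightarrow> bool" where
  "ergodic_action F \<mu> \<longleftrightarrow>
     (\<forall>B\<in>sets borel. (\<forall>n m. B \<in> inv_sets \<mu> ((F ^^ n) \<circ> shift_int m)) \<longrightarrow>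
        emeasure \<mu> B = 0 \<or> emeasure \<mu> B = 1)"

text \<open>
  The Haar measure of a compact subgroup \<open>\<Sigma>\<close> of \<open>G\<close> as a Borel probability on the whole of \<open>G\<close>: the
  unique one that is supported on \<open>\<Sigma>\<close> and invariant under the translations by elements of \<open>\<Sigma>\<close>.
\<close>

definition is_haar_measure ::
    "'b::topological_space monoid \<Rightarrow> 'b set \<Rightarrow> 'b measure \<Rightarrow> bool" where
  "is_haar_measure G \<Sigma> \<nu> \<longleftrightarrow>
     borel_prob \<nu> \<and> measure_support \<nu> \<subseteq> \<Sigma> \<and>
     (\<forall>g\<in>\<Sigma>. invariant_measure (\<lambda>x. g \<otimes>\<^bsub>G\<^esub> x) \<nu>)"

definition haar_measure :: "'b::topological_space monoid \<Rightarrow> 'b set \<Rightarrow> 'b measure" where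
  "haar_measure G \<Sigma> = (THE \<nu>. is_haar_measure G \<Sigma> \<nu>)"


section \<open>Kolmogorov-Sinai entropy\<close>

definition finite_partition :: "'b measure \<Rightarrow> 'b set set \<Rightarrow> bool" where
  "finite_partition M P \<longleftrightarrow> finite P \<and> P \<subseteq> sets M \<and> \<Union>P = space M \<and> disjoint P"

text \<open>
  Partitions are allowed to contain the empty set, which contributes \<open>0 * ln 0 = 0\<close>.
\<close>

definition partition_entropy :: "'b measure \<Rightarrow> 'b set set \<Rightarrow> real" where
  "partition_entropy M P = - (\<Sum>A\<in>P. measure M A * ln (measure M A))"

definition partition_join :: "'b set set \<Rightarrow> 'b set set \<Rightarrow> 'b set set" where
  "partition_join P Q = {A \<inter> B | A B. A \<in> P \<and> B \<in> Q}"

definition partition_vimage :: "'b measure \<Rightarrow> ('b \<Rightarrow> 'b) \<Rightarrow> 'b set set \<Rightarrow> 'b set set" where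
  "partition_vimage M T P = (\<lambda>A. T -` A \<inter> space M) ` P"

text \<open>The join of the partitions \<open>T\<^sup>-\<^sup>i P\<close> over \<open>i < n\<close>.\<close>

primrec iterated_join :: "'b measure \<Rightarrow> ('b \<Rightarrow> 'b) \<Rightarrow> 'b set set \<Rightarrow> nat \<Rightarrow> 'b set set" where
  "iterated_join M T P 0 = {space M}"
| "iterated_join M T P (Suc n) =
     partition_join (iterated_join M T P n) (partition_vimage M (T ^^ n) P)"

text \<open>The limit exists, by subadditivity, when \<open>T\<close> preserves the probability measure \<open>M\<close>.\<close>

definition entropy_wrt_partition :: "'b measure \<Rightarrow> ('b \<Rightarrow> 'b) \<Rightarrow> 'b set set \<Rightarrow> real" where
  "entropy_wrt_partition M T P =
     lim (\<lambda>n. partition_entropy M (iterated_join M T P n) / real n)"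

definition ks_entropy :: "'b measure \<Rightarrow> ('b \<Rightarrow> 'b) \<Rightarrow> ereal" where
  "ks_entropy M T = (SUP P\<in>{P. finite_partition M P}. ereal (entropy_wrt_partition M T P))"

end

theory Submission
  imports Defs "HOL-Real_Asymp.Real_Asymp" "HOL-Algebra.Multiplicative_Group"
begin

text \<open>
  Let \<open>D\<^sub>n\<close> be the kernel of \<open>F\<^sup>n\<close>. Averaging \<open>\<mu>\<close> over the translations by the finite group \<open>D\<^sub>n\<close> and
  taking the density \<open>\<rho>\<^sub>n\<close> of \<open>\<mu>\<close> with respect to the average describes the conditional measures of \<open>\<mu>\<close>
  on the fibres of \<open>F\<^sup>n\<close>, as functions on \<open>D\<^sub>n\<close>. The elements of \<open>D\<^sub>n\<close> have a \<open>\<sigma>\<close>-period all of whose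
  prime factors divide \<open>k p\<^sub>1\<close>, so by the hypothesis on the invariant sets these functions are
  \<open>\<sigma>\<close>-invariant. Comparing this at \<open>x\<close> and at \<open>d \<otimes> x\<close> shows that the conditional measure at \<open>x\<close> is
  invariant under translation by \<open>d - \<sigma> d\<close> for every \<open>d\<close> that it charges. Hence its stabiliser in \<open>D\<^sub>n\<close>
  is as large as its support, up to the factor \<open>|A|\<close>, and positive entropy makes the support grow
  exponentially in \<open>n\<close>.

  The elements that stabilise the conditional measures at \<open>x\<close> for all large \<open>n\<close> form a \<open>\<sigma>\<close>-invariant
  subgroup, infinite for almost every \<open>x\<close> by ergodicity and therefore dense in \<open>\<Sigma>\<close>. As the conditional
  measures are invariant under a dense subgroup of \<open>\<Sigma>\<close>, so is \<open>\<mu>\<close> under \<open>\<Sigma>\<close>.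
\<close>

section \<open>Configurations and clopen sets\<close>

text \<open>The obstacle behind the last step is that \<open>stab n x\<close> need not increase with
  \<open>n\<close>. Its elements inside a fixed \<open>D m\<close> can only disappear, since
  \<open>stab (Suc n) x \<inter> D n \<subseteq> stab n x\<close>, so a lower bound for the size of
  \<open>stab n x\<close> alone leaves open that all the growth sits in ever newer elements and
  nothing survives for all large \<open>n\<close>. This is excluded by the homomorphism
  \<open>F ^^ m\<close>, which maps \<open>stab (n + m) x\<close> into
  \<open>stab n ((F ^^ m) x)\<close> with kernel in \<open>D m\<close>. Iterating the resulting
  inequality for mean logarithms and comparing with the linear lower bound forces
  \<open>stab n x \<inter> D m\<close> to have mean logarithmic size at least
  \<open>m * (s - r) * h\<close> for every \<open>n \<ge> m\<close>, where \<open>h\<close> is the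
  entropy of the shift; the limit in \<open>n\<close> keeps this bound. The hypothesis on invariant
  sets concerns one power of the shift, whereas the periods of the kernels grow with
  \<open>n\<close>. Only the primes in the periods matter, and these stay the same; this is why the
  spectral section treats one prime at a time.\<close>

definition agree :: "nat \<Rightarrow> 'a config \<Rightarrow> 'a config \<Rightarrow> bool" where
  "agree M x y \<longleftrightarrow> (\<forall>i\<in>{-int M..int M}. x i = y i)"

abbreviation cylinder :: "nat \<Rightarrow> 'a config \<Rightarrow> 'a config set" where
  "cylinder M x \<equiv> {y. agree M x y}"

lemma agree_refl [simp]: "agree M x x"
  by (simp add: agree_def)

lemma agree_sym: "agree M x y \<Longrightarrow> agree M y x"
  by (simp add: agree_def)

lemma agree_trans: "agree M x y \<Longrightarrow> agree M y z \<Longrightarrow> agree M x z"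
  by (simp add: agree_def)

lemma agree_mono: "agree M x y \<Longrightarrow> m \<le> M \<Longrightarrow> agree m x y"
  by (auto simp: agree_def)

lemma open_cylinder:
  fixes x :: "'a::discrete_topology config"
  shows "open (cylinder M x)"
proof -
  have "open (PiE UNIV (\<lambda>i. if i \<in> {-int M..int M} then {x i} else UNIV))"
    by (rule open_PiE) (auto intro: finite_subset[of _ "{-int M..int M}"] simp: open_discrete)
  also have "PiE UNIV (\<lambda>i. if i \<in> {-int M..int M} then {x i} else UNIV) = cylinder M x"
    by (auto simp: agree_def PiE_iff split: if_splits)
  finally show ?thesis .
qed

lemma open_config_iff:
  fixes U :: "'a::discrete_topology config set"
  shows "open U \<longleftrightarrow> (\<forall>x\<in>U. \<exists>M. cylinder M x \<subseteq> U)"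
proof
  assume U: "open U"
  show "\<forall>x\<in>U. \<exists>M. cylinder M x \<subseteq> U"
  proof
    fix x assume "x \<in> U"
    with U obtain X where X: "x \<in> PiE UNIV X" "finite {i. X i \<noteq> UNIV}" "PiE UNIV X \<subseteq> U"
      using product_topology_open_contains_basis[of "\<lambda>_. euclidean" UNIV U x]
      unfolding open_fun_def by (auto simp: PiE_iff)
    obtain M where M: "\<forall>i\<in>{i. X i \<noteq> UNIV}. nat \<bar>i\<bar> \<le> M"
      using X(2) finite_nat_set_iff_bounded_le[of "(\<lambda>i. nat \<bar>i\<bar>) ` {i. X i \<noteq> UNIV}"] by auto
    have "cylinder M x \<subseteq> PiE UNIV X"
    proof
      fix y assume y: "y \<in> cylinder M x"
      have "y i \<in> X i" for i
      proof (cases "X i = UNIV")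
        case False
        with M have "i \<in> {-int M..int M}" by fastforce
        with y have "x i = y i" by (auto simp: agree_def)
        with X(1) show ?thesis by (metis PiE_mem UNIV_I)
      qed auto
      thus "y \<in> PiE UNIV X" by auto
    qed
    with X(3) show "\<exists>M. cylinder M x \<subseteq> U" by blast
  qed
next
  assume r: "\<forall>x\<in>U. \<exists>M. cylinder M x \<subseteq> U"
  show "open U"
  proof (subst open_subopen, rule ballI)
    fix x assume "x \<in> U"
    with r show "\<exists>T. open T \<and> x \<in> T \<and> T \<subseteq> U"
      using open_cylinder by (metis agree_refl mem_Collect_eq)
  qed
qed

lemma continuous_config_iff:
  fixes f :: "'a::discrete_topology config \<Rightarrow> 'b::discrete_topology config"
  shows "continuous_on UNIV f \<longleftrightarrow> (\<forall>x M. \<exists>m. \<forall>y. agree m x y \<longrightarrow> agree M (f x) (f y))"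
proof
  assume c: "continuous_on UNIV f"
  show "\<forall>x M. \<exists>m. \<forall>y. agree m x y \<longrightarrow> agree M (f x) (f y)"
  proof (intro allI)
    fix x M
    have "open (f -` cylinder M (f x))"
      using c open_cylinder by (metis continuous_on_open_vimage inf_top_right open_UNIV)
    then show "\<exists>m. \<forall>y. agree m x y \<longrightarrow> agree M (f x) (f y)"
      unfolding open_config_iff by (force simp: subset_iff)
  qed
next
  assume r: "\<forall>x M. \<exists>m. \<forall>y. agree m x y \<longrightarrow> agree M (f x) (f y)"
  show "continuous_on UNIV f"
  proof (subst continuous_on_open_vimage[OF open_UNIV], intro allI impI)
    fix B :: "'b config set" assume "open B"
    show "open (f -` B \<inter> UNIV)"
    proof (subst open_config_iff, intro ballI)
      fix x assume "x \<in> f -` B \<inter> UNIV"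
      then obtain M where "cylinder M (f x) \<subseteq> B"
        using \<open>open B\<close> open_config_iff[of B] by auto
      moreover obtain m where "\<forall>y. agree m x y \<longrightarrow> agree M (f x) (f y)" using r by blast
      ultimately show "\<exists>m. cylinder m x \<subseteq> f -` B \<inter> UNIV" by (intro exI[of _ m]) auto
    qed
  qed
qed

lemma compact_UNIV_config: "compact (UNIV :: 'a::{finite,discrete_topology} config set)"
proof -
  have "compactin (product_topology (\<lambda>_::int. euclidean :: 'a topology) UNIV) (PiE UNIV (\<lambda>_. UNIV))"
    by (subst compactin_PiE) (auto simp: finite_imp_compact)
  then show ?thesis
    by (simp add: euclidean_product_topology)
qed

text \<open>Uniform continuity on a compact space. For the group law it serves twice: translations
  by nearby elements become indistinguishable on a cylinder at all points simultaneously, and the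
  preimage of a cylinder under multiplication is cut into finitely many rectangles.\<close>

lemma uniform_agree_binary:
  fixes f :: "'a::{finite,discrete_topology} config \<times> 'a config \<Rightarrow> 'a config"
  assumes "continuous_on UNIV f"
  obtains m where "\<And>x y x' y'. agree m x x' \<Longrightarrow> agree m y y' \<Longrightarrow> agree M (f (x, y)) (f (x', y'))"
proof -
  define W where "W = (\<lambda>(m, x, y). cylinder m x \<times> cylinder m y :: ('a config \<times> 'a config) set)"
  define I where "I = {(m, x, y). \<forall>x' y'. agree m x x' \<longrightarrow> agree m y y' \<longrightarrow> agree M (f (x, y)) (f (x', y'))}"
  have cover: "\<exists>m. (m, x, y) \<in> I" for x y
  proof -
    have "open (f -` cylinder M (f (x, y)))"
      using assms open_cylinder by (metis continuous_on_open_vimage inf_top_right open_UNIV)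
    moreover have "(x, y) \<in> f -` cylinder M (f (x, y))" by simp
    ultimately obtain A B where AB: "open A" "open B" "(x, y) \<in> A \<times> B"
        "A \<times> B \<subseteq> f -` cylinder M (f (x, y))"
      by (rule open_prod_elim)
    obtain m1 m2 where "cylinder m1 x \<subseteq> A" "cylinder m2 y \<subseteq> B"
      using AB(3) open_config_iff[THEN iffD1, OF AB(1)] open_config_iff[THEN iffD1, OF AB(2)]
      by (meson mem_Sigma_iff)
    then have "cylinder (max m1 m2) x \<subseteq> A" "cylinder (max m1 m2) y \<subseteq> B"
      by (auto dest: agree_mono[of "max m1 m2" _ _ m1] agree_mono[of "max m1 m2" _ _ m2])
    with AB(4) have "(max m1 m2, x, y) \<in> I" unfolding I_def by fastforce
    then show ?thesis by blast
  qed
  have "compact (UNIV :: ('a config \<times> 'a config) set)"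
    using compact_Times[OF compact_UNIV_config compact_UNIV_config] by simp
  then obtain C where C: "C \<subseteq> W ` I" "finite C" "UNIV \<subseteq> \<Union>C"
  proof (rule compactE)
    show "UNIV \<subseteq> \<Union>(W ` I)"
    proof
      fix p :: "'a config \<times> 'a config"
      obtain x y m where "p = (x, y)" "(m, x, y) \<in> I" using cover by (cases p) blast
      moreover have "(x, y) \<in> W (m, x, y)" by (simp add: W_def)
      ultimately show "p \<in> \<Union>(W ` I)" by blast
    qed
    show "open B" if "B \<in> W ` I" for B
      using that by (auto simp: W_def intro!: open_Times open_cylinder)
  qed
  obtain J where J: "J \<subseteq> I" "finite J" "C = W ` J"
    using finite_subset_image[OF C(2,1)] by blast
  define m where "m = Max (insert 0 (fst ` J))"
  show thesis
  proof (rule that[of m])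
    fix x y x' y' :: "'a config" assume ag: "agree m x x'" "agree m y y'"
    have "(x, y) \<in> \<Union>(W ` J)" using C(3) J(3) by blast
    then obtain j u v where j: "(j, u, v) \<in> J" "agree j u x" "agree j v y"
      by (auto simp: W_def)
    have "j \<le> m" unfolding m_def using J(2) j(1) by (force intro: Max_ge)
    then have "agree j u x'" "agree j v y'"
      using ag j(2,3) agree_trans agree_mono by blast+
    then have "agree M (f (u, v)) (f (x, y))" "agree M (f (u, v)) (f (x', y'))"
      using j J(1) unfolding I_def by blast+
    then show "agree M (f (x, y)) (f (x', y'))" using agree_sym agree_trans by blast
  qed
qed

section \<open>Windows, cylinders and the Borel sets\<close>

definition window :: "int \<Rightarrow> int \<Rightarrow> 'a config \<Rightarrow> 'a config" where
  "window a b x = restrict x {a..<b}"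

text \<open>The fixed value that \<open>restrict\<close> puts outside the interval makes equality of
  windows mean agreement inside. Half-open intervals concatenate without overlap, as in
  \<open>window_split\<close>.\<close>

lemma window_eq_iff: "window a b x = window a b y \<longleftrightarrow> (\<forall>i\<in>{a..<b}. x i = y i)"
  by (auto simp: window_def restrict_def fun_eq_iff)

lemma finite_range_window: "finite (range (window a b :: 'a::finite config \<Rightarrow> 'a config))"
proof -
  have "range (window a b :: 'a config \<Rightarrow> 'a config) \<subseteq> PiE {a..<b} (\<lambda>_. UNIV)"
    by (auto simp: window_def)
  then show ?thesis by (rule finite_subset) (auto intro!: finite_PiE)
qed

lemma agree_iff_window: "agree M x y \<longleftrightarrow> window (-int M) (int M + 1) x = window (-int M) (int M + 1) y"
  by (auto simp: agree_def window_eq_iff)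

lemma cylinder_eq_window:
  "cylinder M x = window (-int M) (int M + 1) -` {window (-int M) (int M + 1) x}"
  by (auto simp: agree_iff_window)

lemma finite_cylinders: "finite (range (cylinder M :: 'a::finite config \<Rightarrow> 'a config set))"
proof -
  have "range (cylinder M :: 'a config \<Rightarrow> 'a config set) \<subseteq>
    (\<lambda>w. window (-int M) (int M + 1) -` {w}) ` range (window (-int M) (int M + 1))"
    by (subst cylinder_eq_window) blast
  then show ?thesis by (rule finite_subset) (intro finite_imageI finite_range_window)
qed

definition cylinders :: "'a config set set" where
  "cylinders = (\<Union>M. range (cylinder M))"

lemma countable_cylinders: "countable (cylinders :: 'a::finite config set set)"
  unfolding cylinders_def by (rule countable_UN) (simp_all add: countable_finite finite_cylinders)

lemma open_eq_Union_cylinders: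
  fixes U :: "'a::discrete_topology config set"
  assumes "open U"
  shows "U = \<Union>{C \<in> cylinders. C \<subseteq> U}"
proof -
  have "\<exists>C\<in>cylinders. C \<subseteq> U \<and> x \<in> C" if "x \<in> U" for x
    using that assms unfolding open_config_iff cylinders_def by fastforce
  then show ?thesis by blast
qed

text \<open>The alphabet being finite, there are only countably many cylinders, and every open set
  is a union of them. This gives a generator for induction over Borel sets and for uniqueness of
  measures.\<close>

lemma borel_config_eq_sigma:
  "sets (borel :: 'a::{finite,discrete_topology} config measure) = sigma_sets UNIV cylinders"
proof
  show "sets (borel :: 'a config measure) \<subseteq> sigma_sets UNIV cylinders"
    unfolding borel_def
  proof (subst sets_measure_of, simp, rule sigma_sets_mono, rule subsetI)
    interpret sigma_algebra UNIV "sigma_sets UNIV (cylinders :: 'a config set set)"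
      by (rule sigma_algebra_sigma_sets) simp
    fix U :: "'a config set" assume "U \<in> {S. open S}"
    then have U: "U = \<Union>{C \<in> cylinders. C \<subseteq> U}" by (simp add: open_eq_Union_cylinders)
    show "U \<in> sigma_sets UNIV cylinders"
      by (subst U, rule countable_Union) (auto intro: countable_subset[OF _ countable_cylinders])
  qed
next
  show "sigma_sets UNIV cylinders \<subseteq> sets (borel :: 'a config measure)"
    using sets.sigma_sets_subset[of cylinders "borel :: 'a config measure"]
    by (auto simp: cylinders_def intro: borel_open open_cylinder)
qed


section \<open>Entropy of finite-valued random variables\<close>

context prob_space
begin

definition fin_rv :: "('a \<Rightarrow> 'b) \<Rightarrow> bool" where
  "fin_rv X \<longleftrightarrow> X \<in> measurable M (count_space UNIV) \<and> finite (range X)"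

definition pr :: "('a \<Rightarrow> 'b) \<Rightarrow> 'b \<Rightarrow> real" where
  "pr X a = prob (X -` {a} \<inter> space M)"

text \<open>Shannon entropy with natural logarithms, as the mean of the information function:
  comparisons can then be made pointwise almost everywhere. The value \<open>ln 0 = 0\<close>
  matters only on a null set.\<close>

definition Ent :: "('a \<Rightarrow> 'b) \<Rightarrow> real" where
  "Ent X = expectation (\<lambda>\<omega>. - ln (pr X (X \<omega>)))"

lemma fin_rv_measurable: "fin_rv X \<Longrightarrow> X \<in> measurable M (count_space UNIV)"
  by (simp add: fin_rv_def)

lemma fin_rv_sets: "fin_rv X \<Longrightarrow> X -` A \<inter> space M \<in> sets M"
  by (rule measurable_sets[OF fin_rv_measurable]) simp_all

lemma fin_rvI:
  assumes "finite (range X)" and "\<And>A. X -` A \<inter> space M \<in> sets M"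
  shows "fin_rv X"
  unfolding fin_rv_def measurable_def using assms by simp

lemma fin_rv_comp: "fin_rv X \<Longrightarrow> fin_rv (\<lambda>\<omega>. g (X \<omega>))"
  unfolding fin_rv_def
  using finite_imageI[of "range X" g] measurable_compose[of X M "count_space UNIV" g "count_space UNIV"]
  by (simp add: image_image)

lemma fin_rv_determined:
  assumes "fin_rv X" and "\<And>\<omega> \<omega>'. X \<omega> = X \<omega>' \<Longrightarrow> Y \<omega> = Y \<omega>'"
  shows "fin_rv Y"
proof -
  have "Y = (\<lambda>\<omega>. Y (SOME \<omega>'. X \<omega>' = X \<omega>))"
    by (rule ext, rule assms(2)) (metis (mono_tags, lifting) someI)
  then show ?thesis using fin_rv_comp[OF assms(1), of "\<lambda>a. Y (SOME \<omega>'. X \<omega>' = a)"] by simp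
qed

lemma fin_rv_Pair:
  assumes "fin_rv X" "fin_rv Y"
  shows "fin_rv (\<lambda>\<omega>. (X \<omega>, Y \<omega>))"
proof -
  have sub: "range (\<lambda>\<omega>. (X \<omega>, Y \<omega>)) \<subseteq> range X \<times> range Y" by auto
  then have fin: "finite (range (\<lambda>\<omega>. (X \<omega>, Y \<omega>)))"
    using assms finite_subset unfolding fin_rv_def by blast
  have "(\<lambda>\<omega>. (X \<omega>, Y \<omega>)) -` A \<inter> space M \<in> sets M" for A
  proof -
    have "(\<lambda>\<omega>. (X \<omega>, Y \<omega>)) -` A \<inter> space M =
      (\<Union>c\<in>A \<inter> range X \<times> range Y. (X -` {fst c} \<inter> space M) \<inter> (Y -` {snd c} \<inter> space M))"
      by auto
    also have "\<dots> \<in> sets M"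
      using assms by (intro sets.finite_UN sets.Int fin_rv_sets) (auto simp: fin_rv_def)
    finally show ?thesis .
  qed
  with fin show ?thesis by (rule fin_rvI)
qed

lemma fin_rv_bool:
  assumes "A \<in> sets M"
  shows "fin_rv (\<lambda>\<omega>. \<omega> \<in> A)"
  using pred_sets2[OF assms measurable_ident_sets[OF refl]] by (simp add: fin_rv_def)

lemma pr_nonneg [simp]: "0 \<le> pr X a"
  by (simp add: pr_def)

lemma pr_le_1: "pr X a \<le> 1"
  by (simp add: pr_def)

lemma integrable_fin_rv:
  fixes g :: "'b \<Rightarrow> real"
  assumes "fin_rv X"
  shows "integrable M (\<lambda>\<omega>. g (X \<omega>))"
proof (rule integrable_const_bound)
  have "finite (range (\<lambda>\<omega>. \<bar>g (X \<omega>)\<bar>))"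
    using assms finite_imageI[of "range X" "\<lambda>a. \<bar>g a\<bar>"] by (simp add: fin_rv_def image_image)
  then show "AE \<omega> in M. norm (g (X \<omega>)) \<le> Max (range (\<lambda>\<omega>. \<bar>g (X \<omega>)\<bar>))"
    by (intro AE_I2) (auto intro: Max_ge)
  show "(\<lambda>\<omega>. g (X \<omega>)) \<in> borel_measurable M"
    by (rule measurable_compose[OF fin_rv_measurable[OF assms]]) simp
qed

lemma expectation_fin_rv:
  fixes g :: "'b \<Rightarrow> real"
  assumes "fin_rv X"
  shows "expectation (\<lambda>\<omega>. g (X \<omega>)) = (\<Sum>a\<in>range X. g a * pr X a)"
proof -
  have "expectation (\<lambda>\<omega>. g (X \<omega>)) =
    expectation (\<lambda>\<omega>. \<Sum>a\<in>range X. g a * indicator (X -` {a} \<inter> space M) \<omega>)"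
  proof (rule Bochner_Integration.integral_cong)
    fix \<omega> assume "\<omega> \<in> space M"
    then have "(\<Sum>a\<in>range X. g a * indicator (X -` {a} \<inter> space M) \<omega>) =
      (\<Sum>a\<in>range X. if a = X \<omega> then g a else 0)"
      by (intro sum.cong) (auto split: split_indicator)
    also have "\<dots> = g (X \<omega>)"
      using assms by (simp add: fin_rv_def)
    finally show "g (X \<omega>) = (\<Sum>a\<in>range X. g a * indicator (X -` {a} \<inter> space M) \<omega>)" by simp
  qed simp
  also have "\<dots> = (\<Sum>a\<in>range X. g a * pr X a)"
    using fin_rv_sets[OF assms]
    by (subst Bochner_Integration.integral_sum) (simp_all add: pr_def emeasure_eq_measure)
  finally show ?thesis .
qed

lemma sum_pr: "fin_rv X \<Longrightarrow> (\<Sum>a\<in>range X. pr X a) = 1"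
  using expectation_fin_rv[of X "\<lambda>_. 1"] by (simp add: prob_space)

lemma Ent_eq_sum: "fin_rv X \<Longrightarrow> Ent X = (\<Sum>a\<in>range X. - (pr X a * ln (pr X a)))"
  unfolding Ent_def by (subst expectation_fin_rv) (auto simp: mult.commute)

lemma AE_pr_pos:
  assumes "fin_rv X"
  shows "AE \<omega> in M. 0 < pr X (X \<omega>)"
proof -
  have "AE \<omega> in M. \<forall>a\<in>range X. pr X a = 0 \<longrightarrow> X \<omega> \<noteq> a"
  proof (rule AE_finite_allI)
    show "finite (range X)" using assms by (simp add: fin_rv_def)
    fix a assume "a \<in> range X"
    show "AE \<omega> in M. pr X a = 0 \<longrightarrow> X \<omega> \<noteq> a"
    proof (cases "pr X a = 0")
      case True
      then have "X -` {a} \<inter> space M \<in> null_sets M"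
        using fin_rv_sets[OF assms] by (auto simp: pr_def null_sets_def emeasure_eq_measure)
      then show ?thesis by (rule AE_I'[where N="X -` {a} \<inter> space M"]) auto
    qed simp
  qed
  then show ?thesis
    by eventually_elim (metis order_le_less pr_nonneg rangeI)
qed

lemma Ent_nonneg: "0 \<le> Ent X"
  unfolding Ent_def
proof (rule integral_nonneg_AE, rule AE_I2)
  fix \<omega>
  show "0 \<le> - ln (pr X (X \<omega>))"
    using pr_nonneg[of X "X \<omega>"] pr_le_1[of X "X \<omega>"] by (cases "pr X (X \<omega>) = 0") (auto simp: less_le)
qed

text \<open>From \<open>ln t \<le> t - 1\<close> at \<open>t = q / p\<close>. Two choices of the
  comparison weights \<open>q\<close> below yield submodularity and the bound by the logarithm of a
  cardinality.\<close>

lemma gibbs_inequality: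
  assumes X: "fin_rv X" and q: "\<And>a. 0 \<le> q a" "(\<Sum>a\<in>range X. q a) \<le> 1"
    and pos: "\<And>a. 0 < pr X a \<Longrightarrow> 0 < q a"
  shows "Ent X \<le> expectation (\<lambda>\<omega>. - ln (q (X \<omega>)))"
proof -
  have "Ent X \<le> expectation (\<lambda>\<omega>. - ln (q (X \<omega>)) + (q (X \<omega>) / pr X (X \<omega>) - 1))"
    unfolding Ent_def
  proof (rule integral_mono_AE)
    show "AE \<omega> in M. - ln (pr X (X \<omega>)) \<le> - ln (q (X \<omega>)) + (q (X \<omega>) / pr X (X \<omega>) - 1)"
      using AE_pr_pos[OF X]
    proof eventually_elim
      case (elim \<omega>)
      then have "ln (q (X \<omega>) / pr X (X \<omega>)) \<le> q (X \<omega>) / pr X (X \<omega>) - 1"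
        using pos by (intro ln_le_minus_one) auto
      then show ?case using elim pos[OF elim] by (simp add: ln_div)
    qed
    show "integrable M (\<lambda>\<omega>. - ln (q (X \<omega>)) + (q (X \<omega>) / pr X (X \<omega>) - 1))"
      by (rule integrable_fin_rv[OF X])
  qed (rule integrable_fin_rv[OF X])
  also have "\<dots> = expectation (\<lambda>\<omega>. - ln (q (X \<omega>))) + expectation (\<lambda>\<omega>. q (X \<omega>) / pr X (X \<omega>) - 1)"
    by (rule Bochner_Integration.integral_add) (rule integrable_fin_rv[OF X])+
  also have "expectation (\<lambda>\<omega>. q (X \<omega>) / pr X (X \<omega>) - 1) = (\<Sum>a\<in>range X. (q a / pr X a - 1) * pr X a)"
    by (rule expectation_fin_rv[OF X])
  also have "\<dots> \<le> (\<Sum>a\<in>range X. q a - pr X a)"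
  proof (rule sum_mono)
    fix a
    show "(q a / pr X a - 1) * pr X a \<le> q a - pr X a"
      using q(1)[of a] by (cases "pr X a = 0") (auto simp: field_simps)
  qed
  also have "\<dots> \<le> 0" using q(2) sum_pr[OF X] by (simp add: sum_subtractf)
  finally show ?thesis by simp
qed

lemma Ent_mono:
  assumes X: "fin_rv X" and det: "\<And>\<omega> \<omega>'. X \<omega> = X \<omega>' \<Longrightarrow> Y \<omega> = Y \<omega>'"
  shows "Ent Y \<le> Ent X"
  unfolding Ent_def
proof (rule integral_mono_AE)
  have Y: "fin_rv Y" by (rule fin_rv_determined[OF X det])
  show "AE \<omega> in M. - ln (pr Y (Y \<omega>)) \<le> - ln (pr X (X \<omega>))"
    using AE_pr_pos[OF X]
  proof eventually_elim
    case (elim \<omega>)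
    have "pr X (X \<omega>) \<le> pr Y (Y \<omega>)"
      unfolding pr_def by (rule finite_measure_mono) (auto intro: fin_rv_sets[OF Y] dest: det)
    with elim show ?case by simp
  qed
  show "integrable M (\<lambda>\<omega>. - ln (pr Y (Y \<omega>)))" "integrable M (\<lambda>\<omega>. - ln (pr X (X \<omega>)))"
    by (rule integrable_fin_rv[OF Y], rule integrable_fin_rv[OF X])
qed

text \<open>Entropy sees only the partition into fibres, so joint variables may be re-encoded
  freely.\<close>

lemma Ent_cong:
  assumes "fin_rv X" and "\<And>\<omega> \<omega>'. X \<omega> = X \<omega>' \<longleftrightarrow> Y \<omega> = Y \<omega>'"
  shows "Ent Y = Ent X"
proof (rule antisym)
  show "Ent Y \<le> Ent X" by (rule Ent_mono) (use assms in auto)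
  show "Ent X \<le> Ent Y"
    by (rule Ent_mono[OF fin_rv_determined[OF assms(1), of Y]]) (use assms in auto)
qed

lemma sum_pr_Pair:
  assumes "fin_rv X" "fin_rv Z"
  shows "(\<Sum>x\<in>range X. pr (\<lambda>\<omega>. (X \<omega>, Z \<omega>)) (x, z)) = pr Z z"
proof -
  have "pr Z z = prob (\<Union>x\<in>range X. (\<lambda>\<omega>. (X \<omega>, Z \<omega>)) -` {(x, z)} \<inter> space M)"
    unfolding pr_def by (rule arg_cong[of _ _ prob]) auto
  also have "\<dots> = (\<Sum>x\<in>range X. prob ((\<lambda>\<omega>. (X \<omega>, Z \<omega>)) -` {(x, z)} \<inter> space M))"
    using assms fin_rv_sets[OF fin_rv_Pair[OF assms]]
    by (intro finite_measure_finite_Union) (auto simp: fin_rv_def disjoint_family_on_def)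
  finally show ?thesis by (simp add: pr_def)
qed

lemma pr_mono_determined:
  assumes "fin_rv Y" "\<And>\<omega>'. X \<omega>' = a \<Longrightarrow> Y \<omega>' = b"
  shows "pr X a \<le> pr Y b"
  unfolding pr_def
proof (rule finite_measure_mono)
  show "X -` {a} \<inter> space M \<subseteq> Y -` {b} \<inter> space M" using assms(2) by blast
qed (rule fin_rv_sets[OF assms(1)])

text \<open>Nonnegativity of the conditional mutual information of \<open>X\<close> and
  \<open>Y\<close> given \<open>Z\<close>: Gibbs' inequality against the law under which
  \<open>X\<close> and \<open>Y\<close> are conditionally independent. Where
  \<open>pr Z z = 0\<close> the quotient defining \<open>q\<close> is 0.\<close>

lemma Ent_submodular:
  assumes X: "fin_rv X" and Y: "fin_rv Y" and Z: "fin_rv Z"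
  shows "Ent (\<lambda>\<omega>. (X \<omega>, Y \<omega>, Z \<omega>)) + Ent Z \<le> Ent (\<lambda>\<omega>. (X \<omega>, Z \<omega>)) + Ent (\<lambda>\<omega>. (Y \<omega>, Z \<omega>))"
proof -
  let ?T = "\<lambda>\<omega>. (X \<omega>, Y \<omega>, Z \<omega>)" and ?P = "\<lambda>\<omega>. (X \<omega>, Z \<omega>)" and ?Q = "\<lambda>\<omega>. (Y \<omega>, Z \<omega>)"
  have P: "fin_rv ?P" and Q: "fin_rv ?Q" and T: "fin_rv ?T"
    using assms by (auto intro: fin_rv_Pair)
  define q where "q = (\<lambda>(x, y, z). pr ?P (x, z) * pr ?Q (y, z) / pr Z z)"
  have q_pos: "0 < pr ?P (x, z)" "0 < pr ?Q (y, z)" "0 < pr Z z"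
    if "0 < pr ?T (x, y, z)" for x y z
    using that pr_mono_determined[OF P, of ?T "(x, y, z)" "(x, z)"]
      pr_mono_determined[OF Q, of ?T "(x, y, z)" "(y, z)"]
      pr_mono_determined[OF Z, of ?T "(x, y, z)" z] by auto
  have "Ent ?T \<le> expectation (\<lambda>\<omega>. - ln (q (?T \<omega>)))"
  proof (rule gibbs_inequality[OF T])
    show "0 \<le> q a" for a by (auto simp: q_def split: prod.split)
    show "0 < q a" if "0 < pr ?T a" for a
      using that q_pos by (cases a) (auto simp: q_def)
    have "sum q (range ?T) \<le> sum q (range X \<times> range Y \<times> range Z)"
      using assms by (intro sum_mono2) (auto simp: fin_rv_def q_def)
    also have "\<dots> = (\<Sum>x\<in>range X. \<Sum>y\<in>range Y. \<Sum>z\<in>range Z. q (x, y, z))"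
      by (simp add: sum.cartesian_product)
    also have "\<dots> = (\<Sum>x\<in>range X. \<Sum>z\<in>range Z. \<Sum>y\<in>range Y. q (x, y, z))"
      by (intro sum.cong refl sum.swap)
    also have "\<dots> = (\<Sum>z\<in>range Z. \<Sum>x\<in>range X. \<Sum>y\<in>range Y. q (x, y, z))"
      by (rule sum.swap)
    also have "\<dots> = (\<Sum>z\<in>range Z. (\<Sum>x\<in>range X. pr ?P (x, z)) * (\<Sum>y\<in>range Y. pr ?Q (y, z)) / pr Z z)"
      by (simp add: q_def sum_product sum_divide_distrib)
    also have "\<dots> = (\<Sum>z\<in>range Z. pr Z z)"
      by (rule sum.cong) (simp_all add: sum_pr_Pair X Y Z)
    finally show "sum q (range ?T) \<le> 1" by (simp add: sum_pr Z)
  qed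
  also have "\<dots> = expectation (\<lambda>\<omega>. - ln (pr ?P (?P \<omega>)) - ln (pr ?Q (?Q \<omega>)) + ln (pr Z (Z \<omega>)))"
  proof (rule integral_cong_AE)
    show "AE \<omega> in M. - ln (q (?T \<omega>)) = - ln (pr ?P (?P \<omega>)) - ln (pr ?Q (?Q \<omega>)) + ln (pr Z (Z \<omega>))"
      using AE_pr_pos[OF T]
    proof eventually_elim
      case (elim \<omega>)
      then show ?case using q_pos[OF elim] by (simp add: q_def ln_div ln_mult)
    qed
    show "(\<lambda>\<omega>. - ln (q (?T \<omega>))) \<in> borel_measurable M"
      by (rule borel_measurable_integrable[OF integrable_fin_rv[OF T, of "\<lambda>t. - ln (q t)"]])
    show "(\<lambda>\<omega>. - ln (pr ?P (?P \<omega>)) - ln (pr ?Q (?Q \<omega>)) + ln (pr Z (Z \<omega>))) \<in> borel_measurable M"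
      using borel_measurable_integrable[OF integrable_fin_rv[OF T,
          of "\<lambda>(x, y, z). - ln (pr ?P (x, z)) - ln (pr ?Q (y, z)) + ln (pr Z z)"]] by simp
  qed
  also have "\<dots> = Ent ?P + Ent ?Q - Ent Z"
    using integrable_fin_rv[OF P, of "\<lambda>a. ln (pr ?P a)"] integrable_fin_rv[OF Q, of "\<lambda>a. ln (pr ?Q a)"]
      integrable_fin_rv[OF Z, of "\<lambda>a. ln (pr Z a)"]
    by (simp add: Ent_def)
  finally show ?thesis by simp
qed

lemma Ent_Pair_le_add:
  assumes X: "fin_rv X" and Y: "fin_rv Y"
  shows "Ent (\<lambda>\<omega>. (X \<omega>, Y \<omega>)) \<le> Ent X + Ent Y"
proof -
  have Z: "fin_rv (\<lambda>_. ())" by (simp add: fin_rv_def)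
  have "pr (\<lambda>_. ()) () = 1" by (simp add: pr_def prob_space)
  then have "Ent (\<lambda>_. ()) = 0" by (simp add: Ent_def)
  moreover have "Ent (\<lambda>\<omega>. (X \<omega>, Y \<omega>)) = Ent (\<lambda>\<omega>. (X \<omega>, Y \<omega>, ()))"
    using X Y Z by (intro Ent_cong fin_rv_Pair) auto
  moreover have "Ent (\<lambda>\<omega>. (X \<omega>, ())) = Ent X" "Ent (\<lambda>\<omega>. (Y \<omega>, ())) = Ent Y"
    using X Y by (auto intro!: Ent_cong)
  ultimately show ?thesis using Ent_submodular[OF X Y Z] by simp
qed


text \<open>The conditional entropy of \<open>W\<close> given \<open>T\<close> is bounded by the
  mean logarithm of the number of admissible values; the comparison law is uniform on
  \<open>t\<close> given \<open>T = t\<close>.\<close>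

lemma Ent_Pair_le_card:
  assumes W: "fin_rv W" and T: "fin_rv T" and fin: "\<And>\<omega>. finite (T \<omega>)" and mem: "AE \<omega> in M. W \<omega> \<in> T \<omega>"
  shows "Ent (\<lambda>\<omega>. (W \<omega>, T \<omega>)) \<le> Ent T + expectation (\<lambda>\<omega>. ln (card (T \<omega>)))"
proof -
  let ?P = "\<lambda>\<omega>. (W \<omega>, T \<omega>)"
  have P: "fin_rv ?P" by (rule fin_rv_Pair[OF W T])
  define q where "q = (\<lambda>(w, t). if w \<in> t then pr T t / card t else 0)"
  have mem_pos: "w \<in> t \<and> finite t \<and> 0 < pr T t" if "0 < pr ?P (w, t)" for w t
  proof -
    have "t \<in> range T"
    proof (rule ccontr)
      assume "t \<notin> range T"
      then have "?P -` {(w, t)} = {}" by auto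
      then show False using that by (simp add: pr_def)
    qed
    moreover have "w \<in> t"
    proof (rule ccontr)
      assume "w \<notin> t"
      then have "AE \<omega> in M. W \<omega> \<in> T \<omega> \<longrightarrow> \<omega> \<notin> ?P -` {(w, t)} \<inter> space M" by auto
      from AE_mp[OF mem this] have "prob (?P -` {(w, t)} \<inter> space M) = 0"
        using prob_eq_0[OF fin_rv_sets[OF P]] by blast
      then show False using that by (simp add: pr_def)
    qed
    moreover have "pr ?P (w, t) \<le> pr T t" by (rule pr_mono_determined[OF T]) simp
    ultimately show ?thesis using that fin by fastforce
  qed
  have "Ent ?P \<le> expectation (\<lambda>\<omega>. - ln (q (?P \<omega>)))"
  proof (rule gibbs_inequality[OF P])
    show q0: "0 \<le> q a" for a by (simp add: q_def split: prod.split)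
    show "0 < q a" if "0 < pr ?P a" for a
    proof (cases a)
      case (Pair w t)
      then show ?thesis using mem_pos[of w t] that by (auto simp: q_def card_gt_0_iff intro!: divide_pos_pos)
    qed
    have "sum q (range ?P) \<le> sum q (range W \<times> range T)"
      using W T by (intro sum_mono2 q0) (auto simp: fin_rv_def)
    also have "\<dots> = (\<Sum>w\<in>range W. \<Sum>t\<in>range T. q (w, t))"
      by (simp add: sum.cartesian_product)
    also have "\<dots> = (\<Sum>t\<in>range T. \<Sum>w\<in>range W. q (w, t))"
      by (rule sum.swap)
    also have "\<dots> \<le> (\<Sum>t\<in>range T. pr T t)"
    proof (rule sum_mono)
      fix t assume "t \<in> range T"
      then have "finite t" using fin by auto
      have "(\<Sum>w\<in>range W. q (w, t)) = card (range W \<inter> t) * (pr T t / card t)"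
        using W by (simp add: q_def fin_rv_def sum.If_cases)
      also have "\<dots> \<le> card t * (pr T t / card t)"
        using \<open>finite t\<close> by (intro mult_right_mono) (auto intro: card_mono)
      also have "\<dots> \<le> pr T t" by simp
      finally show "(\<Sum>w\<in>range W. q (w, t)) \<le> pr T t" .
    qed
    finally show "sum q (range ?P) \<le> 1" by (simp add: sum_pr T)
  qed
  also have "\<dots> = expectation (\<lambda>\<omega>. - ln (pr T (T \<omega>)) + ln (card (T \<omega>)))"
  proof (rule integral_cong_AE)
    show "AE \<omega> in M. - ln (q (?P \<omega>)) = - ln (pr T (T \<omega>)) + ln (card (T \<omega>))"
      using AE_pr_pos[OF P]
    proof eventually_elim
      case (elim \<omega>)
      then show ?case using mem_pos[OF elim] by (auto simp: q_def ln_div card_gt_0_iff)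
    qed
    show "(\<lambda>\<omega>. - ln (q (?P \<omega>))) \<in> borel_measurable M"
      by (rule borel_measurable_integrable[OF integrable_fin_rv[OF P, of "\<lambda>t. - ln (q t)"]])
    show "(\<lambda>\<omega>. - ln (pr T (T \<omega>)) + ln (card (T \<omega>))) \<in> borel_measurable M"
      by (rule borel_measurable_integrable[OF integrable_fin_rv[OF T, of "\<lambda>t. - ln (pr T t) + ln (card t)"]])
  qed
  also have "\<dots> = Ent T + expectation (\<lambda>\<omega>. ln (card (T \<omega>)))"
    using integrable_fin_rv[OF T, of "\<lambda>t. ln (pr T t)"] integrable_fin_rv[OF T, of "\<lambda>t. ln (card t)"]
    by (simp add: Ent_def)
  finally show ?thesis .
qed

lemma Ent_comp_measure_preserving:
  assumes X: "fin_rv X" and T: "T \<in> measurable M M"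
    and inv: "\<And>A. A \<in> sets M \<Longrightarrow> emeasure M (T -` A \<inter> space M) = emeasure M A"
  shows "Ent (\<lambda>\<omega>. X (T \<omega>)) = Ent X"
proof -
  have d: "distr M M T = M"
    by (rule measure_eqI) (auto simp: emeasure_distr T inv)
  have "pr (\<lambda>\<omega>. X (T \<omega>)) a = pr X a" for a
  proof -
    have "(\<lambda>\<omega>. X (T \<omega>)) -` {a} \<inter> space M = T -` (X -` {a} \<inter> space M) \<inter> space M"
      using T by (auto simp: measurable_def)
    then show ?thesis
      using inv[OF fin_rv_sets[OF X, of "{a}"]] by (simp add: pr_def measure_def)
  qed
  then have "Ent (\<lambda>\<omega>. X (T \<omega>)) = expectation (\<lambda>\<omega>. - ln (pr X (X (T \<omega>))))"
    by (simp add: Ent_def)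
  also have "\<dots> = integral\<^sup>L (distr M M T) (\<lambda>\<omega>. - ln (pr X (X \<omega>)))"
    by (subst integral_distr[OF T]) (rule borel_measurable_integrable[OF integrable_fin_rv[OF X, of "\<lambda>a. - ln (pr X a)"]], simp)
  finally show ?thesis by (simp add: d Ent_def)
qed

text \<open>The binary entropy function tends to 0 at 0. This converts approximation in measure into
  a bound on entropy.\<close>

lemma Ent_indicator_small:
  assumes "0 < \<epsilon>"
  obtains \<delta> where "0 < \<delta>" "\<And>A. A \<in> sets M \<Longrightarrow> prob A < \<delta> \<Longrightarrow> Ent (\<lambda>\<omega>. \<omega> \<in> A) < \<epsilon>"
proof -
  have "((\<lambda>x::real. - (x * ln x) - (1 - x) * ln (1 - x)) \<longlongrightarrow> 0) (at_right 0)"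
    by real_asymp
  then have "eventually (\<lambda>x::real. - (x * ln x) - (1 - x) * ln (1 - x) < \<epsilon>) (at_right 0)"
    using assms by (rule order_tendstoD)
  then obtain \<delta> where \<delta>: "0 < \<delta>" "\<And>x::real. 0 < x \<Longrightarrow> x < \<delta> \<Longrightarrow> - (x * ln x) - (1 - x) * ln (1 - x) < \<epsilon>"
    unfolding eventually_at_right_field by auto
  show thesis
  proof (rule that[OF \<delta>(1)])
    fix A assume A: "A \<in> sets M" "prob A < \<delta>"
    let ?X = "\<lambda>\<omega>. \<omega> \<in> A"
    have X: "fin_rv ?X" by (rule fin_rv_bool[OF A(1)])
    have "Ent ?X = (\<Sum>a\<in>range ?X. - (pr ?X a * ln (pr ?X a)))" by (rule Ent_eq_sum[OF X])
    \<comment> \<open>A truth value that is never taken has probability 0 and contributes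
      \<open>0 * ln 0 = 0\<close>.\<close>
    also have "\<dots> = (\<Sum>a\<in>UNIV. - (pr ?X a * ln (pr ?X a)))"
    proof (rule sum.mono_neutral_left)
      show "\<forall>a\<in>UNIV - range ?X. - (pr ?X a * ln (pr ?X a)) = 0"
      proof
        fix a assume "a \<in> UNIV - range ?X"
        then have "?X -` {a} = {}" by auto
        then show "- (pr ?X a * ln (pr ?X a)) = 0" by (simp add: pr_def)
      qed
    qed auto
    also have "\<dots> = - (prob A * ln (prob A)) - (1 - prob A) * ln (1 - prob A)"
    proof -
      have "?X -` {True} \<inter> space M = A" "?X -` {False} \<inter> space M = space M - A"
        using sets.sets_into_space[OF A(1)] by auto
      then have "pr ?X True = prob A" "pr ?X False = 1 - prob A"
        by (simp_all only: pr_def prob_compl[OF A(1)])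
      then show ?thesis by (simp add: UNIV_bool)
    qed
    also have "\<dots> < \<epsilon>"
    proof (cases "prob A = 0")
      case False
      then have "0 < prob A" using measure_nonneg[of M A] by linarith
      then show ?thesis using \<delta>(2) A(2) by blast
    qed (simp add: assms)
    finally show "Ent ?X < \<epsilon>" .
  qed
qed

end


section \<open>Bipermutative cellular automata\<close>

definition biperm :: "int \<Rightarrow> int \<Rightarrow> ('a config \<Rightarrow> 'a config) \<Rightarrow> bool" where
  "biperm r s F \<longleftrightarrow> r \<le> s \<and> (\<forall>x y m.
     ((\<forall>i. m + r \<le> i \<longrightarrow> i \<le> m + s \<longrightarrow> x i = y i) \<longrightarrow> F x m = F y m) \<and>
     ((\<forall>i. m + r \<le> i \<longrightarrow> i < m + s \<longrightarrow> x i = y i) \<longrightarrow> F x m = F y m \<longrightarrow> x (m + s) = y (m + s)) \<and>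
     ((\<forall>i. m + r < i \<longrightarrow> i \<le> m + s \<longrightarrow> x i = y i) \<longrightarrow> F x m = F y m \<longrightarrow> x (m + r) = y (m + r)))"

lemma biperm_le: "biperm r s F \<Longrightarrow> r \<le> s"
  by (simp add: biperm_def)

lemmas bipermD = biperm_def[THEN iffD1, THEN conjunct2, THEN spec, THEN spec, THEN spec]

lemma biperm_local:
  assumes "biperm r s F" "\<And>i. m + r \<le> i \<Longrightarrow> i \<le> m + s \<Longrightarrow> x i = y i"
  shows "F x m = F y m"
  using bipermD[OF assms(1), of m x y] assms(2) by simp

lemma biperm_right:
  assumes "biperm r s F" "\<And>i. m + r \<le> i \<Longrightarrow> i < m + s \<Longrightarrow> x i = y i" "F x m = F y m"
  shows "x (m + s) = y (m + s)"
  using bipermD[OF assms(1), of m x y] assms(2,3) by simp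

lemma biperm_left:
  assumes "biperm r s F" "\<And>i. m + r < i \<Longrightarrow> i \<le> m + s \<Longrightarrow> x i = y i" "F x m = F y m"
  shows "x (m + r) = y (m + r)"
  using bipermD[OF assms(1), of m x y] assms(2,3) by simp

lemma bipermI:
  assumes "r \<le> s"
    and "\<And>x y m. (\<And>i. m + r \<le> i \<Longrightarrow> i \<le> m + s \<Longrightarrow> x i = y i) \<Longrightarrow> F x m = F y m"
    and "\<And>x y m. (\<And>i. m + r \<le> i \<Longrightarrow> i < m + s \<Longrightarrow> x i = y i) \<Longrightarrow> F x m = F y m \<Longrightarrow> x (m + s) = y (m + s)"
    and "\<And>x y m. (\<And>i. m + r < i \<Longrightarrow> i \<le> m + s \<Longrightarrow> x i = y i) \<Longrightarrow> F x m = F y m \<Longrightarrow> x (m + r) = y (m + r)"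
  shows "biperm r s F"
  unfolding biperm_def
  by (intro conjI allI impI, rule assms(1), rule assms(2), blast, rule assms(3), blast, assumption,
      rule assms(4), blast, assumption)

text \<open>Left and right permutativity each come with a smallest neighborhood of their own, and
  minimality makes the two equal. Nontriviality gives \<open>r < s\<close>, the source of the growth
  of the kernels.\<close>

lemma biperm_if_bipermutative:
  assumes "bipermutative F" "\<not> trivial_ca F"
  obtains r s where "r < s" "biperm r s F"
proof -
  obtain r s f where l: "smallest_neighborhood F r s" "local_rule F r s f"
      "\<And>u b. int (length u) = s - r \<Longrightarrow> \<exists>!a. f (a # u) = b"
    using assms(1) unfolding bipermutative_def left_permutative_def by blast
  obtain r' s' g where r: "smallest_neighborhood F r' s'" "local_rule F r' s' g"
      "\<And>u b. int (length u) = s' - r' \<Longrightarrow> \<exists>!a. g (u @ [a]) = b"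
    using assms(1) unfolding bipermutative_def right_permutative_def by blast
  have rs: "r \<le> s" "r' \<le> s'" using l(1) r(1) by (auto simp: smallest_neighborhood_def neighborhood_def)
  have "{r..s} \<subseteq> {r'..s'}" "{r'..s'} \<subseteq> {r..s}"
    using l(1) r(1) unfolding smallest_neighborhood_def by blast+
  then have eq: "r' = r" "s' = s" using rs by auto
  have "r \<noteq> s" using assms(2) l(1) unfolding trivial_ca_def by blast
  then have "r < s" using rs by simp
  have Ff: "F x m = f (map (\<lambda>u. x (m + u)) [r..s])" for x m using l(2) by (simp add: local_rule_def)
  have Fg: "F x m = g (map (\<lambda>u. x (m + u)) [r..s])" for x m using r(2) by (simp add: local_rule_def eq)
  have "biperm r s F"
  proof (rule bipermI[OF rs(1)])
    fix x y :: "'a config" and m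
    show "F x m = F y m" if "\<And>i. m + r \<le> i \<Longrightarrow> i \<le> m + s \<Longrightarrow> x i = y i"
      unfolding Ff using that by (intro arg_cong[of _ _ f] map_cong) auto
    show "x (m + s) = y (m + s)" if e: "\<And>i. m + r \<le> i \<Longrightarrow> i < m + s \<Longrightarrow> x i = y i" and F: "F x m = F y m"
    proof -
      let ?u = "map (\<lambda>u. x (m + u)) [r..s - 1]"
      have u: "?u = map (\<lambda>u. y (m + u)) [r..s - 1]" using e by (intro map_cong) auto
      have "g (?u @ [x (m + s)]) = g (map (\<lambda>u. y (m + u)) [r..s - 1] @ [y (m + s)])"
        using F rs(1) by (simp add: Fg upto_rec2)
      then have "g (?u @ [x (m + s)]) = g (?u @ [y (m + s)])" unfolding u .
      moreover have "int (length ?u) = s' - r'" using rs by (simp add: eq)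
      ultimately show ?thesis using r(3) by blast
    qed
    show "x (m + r) = y (m + r)" if e: "\<And>i. m + r < i \<Longrightarrow> i \<le> m + s \<Longrightarrow> x i = y i" and F: "F x m = F y m"
    proof -
      let ?u = "map (\<lambda>u. x (m + u)) [r + 1..s]"
      have u: "?u = map (\<lambda>u. y (m + u)) [r + 1..s]" using e by (intro map_cong) auto
      have "f (x (m + r) # ?u) = f (y (m + r) # map (\<lambda>u. y (m + u)) [r + 1..s])"
        using F rs(1) by (simp add: Ff upto_rec1)
      then have "f (x (m + r) # ?u) = f (y (m + r) # ?u)" unfolding u .
      moreover have "int (length ?u) = s - r" using rs by simp
      ultimately show ?thesis using l(3) by blast
    qed
  qed
  with \<open>r < s\<close> show thesis by (rule that)
qed

lemma biperm_id: "biperm 0 0 id"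
  by (rule bipermI) auto

text \<open>Neighborhoods add. An end coordinate is recovered in two stages: the outer map yields
  the end coordinate of the inner image, and the inner map then yields that of the
  configuration.\<close>

lemma biperm_comp:
  assumes F: "biperm r s F" and G: "biperm r' s' G"
  shows "biperm (r + r') (s + s') (F \<circ> G)"
proof (rule bipermI)
  show "r + r' \<le> s + s'" using biperm_le[OF F] biperm_le[OF G] by simp
  fix x y :: "'a config" and m
  show "(F \<circ> G) x m = (F \<circ> G) y m" if "\<And>i. m + (r + r') \<le> i \<Longrightarrow> i \<le> m + (s + s') \<Longrightarrow> x i = y i"
    unfolding comp_def
    by (rule biperm_local[OF F], rule biperm_local[OF G], rule that) auto
  show "x (m + (s + s')) = y (m + (s + s'))"
    if e: "\<And>i. m + (r + r') \<le> i \<Longrightarrow> i < m + (s + s') \<Longrightarrow> x i = y i" and F': "(F \<circ> G) x m = (F \<circ> G) y m"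
  proof -
    have "G x (m + s) = G y (m + s)"
    proof (rule biperm_right[OF F])
      show "F (G x) m = F (G y) m" using F' by simp
      show "G x i = G y i" if "m + r \<le> i" "i < m + s" for i
        by (rule biperm_local[OF G], rule e) (use that in auto)
    qed
    then have "x (m + s + s') = y (m + s + s')"
      using biperm_right[OF G, of "m + s" x y] e biperm_le[OF F] by simp
    then show ?thesis by (simp add: add.assoc)
  qed
  show "x (m + (r + r')) = y (m + (r + r'))"
    if e: "\<And>i. m + (r + r') < i \<Longrightarrow> i \<le> m + (s + s') \<Longrightarrow> x i = y i" and F': "(F \<circ> G) x m = (F \<circ> G) y m"
  proof -
    have "G x (m + r) = G y (m + r)"
    proof (rule biperm_left[OF F])
      show "F (G x) m = F (G y) m" using F' by simp
      show "G x i = G y i" if "m + r < i" "i \<le> m + s" for i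
        by (rule biperm_local[OF G], rule e) (use that in auto)
    qed
    then have "x (m + r + r') = y (m + r + r')"
      using biperm_left[OF G, of "m + r" x y] e biperm_le[OF F] by simp
    then show ?thesis by (simp add: add.assoc)
  qed
qed

lemma biperm_funpow: "biperm r s F \<Longrightarrow> biperm (int n * r) (int n * s) (F ^^ n)"
proof (induction n)
  case 0
  then show ?case using biperm_id by (simp add: id_def)
next
  case (Suc n)
  then show ?case using biperm_comp[of r s F "int n * r" "int n * s" "F ^^ n"]
    by (simp add: algebra_simps comp_def)
qed

text \<open>Each further coordinate of the image recovers one further coordinate to the right of a
  known word of length \<open>s - r\<close>.\<close>

lemma biperm_window_right:
  assumes F: "biperm r s F" and w: "\<And>i. r \<le> i \<Longrightarrow> i < s \<Longrightarrow> x i = y i"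
  shows "(\<And>i. 0 \<le> i \<Longrightarrow> i < int n \<Longrightarrow> F x i = F y i) \<Longrightarrow> r \<le> i \<Longrightarrow> i < int n + s \<Longrightarrow> x i = y i"
proof (induction n arbitrary: i)
  case 0
  then show ?case using w by simp
next
  case (Suc n)
  show ?case
  proof (cases "i < int n + s")
    case True
    then show ?thesis using Suc by simp
  next
    case False
    then have "i = int n + s" using Suc.prems by simp
    moreover have "x (int n + s) = y (int n + s)"
    proof (rule biperm_right[OF F])
      show "F x (int n) = F y (int n)" using Suc.prems(1) by simp
      show "x j = y j" if "int n + r \<le> j" "j < int n + s" for j
        by (rule Suc.IH) (use that Suc.prems(1) in auto)
    qed
    ultimately show ?thesis by simp
  qed
qed

lemma biperm_window_left:
  assumes F: "biperm r s F" and w: "\<And>i. r \<le> i \<Longrightarrow> i < s \<Longrightarrow> x i = y i"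
  shows "(\<And>i. - int n \<le> i \<Longrightarrow> i < 0 \<Longrightarrow> F x i = F y i) \<Longrightarrow> - int n + r \<le> i \<Longrightarrow> i < s \<Longrightarrow> x i = y i"
proof (induction n arbitrary: i)
  case 0
  then show ?case using w by simp
next
  case (Suc n)
  show ?case
  proof (cases "- int n + r \<le> i")
    case True
    then show ?thesis using Suc by simp
  next
    case False
    then have "i = - int (Suc n) + r" using Suc.prems by simp
    moreover have "x (- int (Suc n) + r) = y (- int (Suc n) + r)"
    proof (rule biperm_left[OF F])
      show "F x (- int (Suc n)) = F y (- int (Suc n))" using Suc.prems(1) by simp
      show "x j = y j" if "- int (Suc n) + r < j" "j \<le> - int (Suc n) + s" for j
        by (rule Suc.IH) (use that Suc.prems(1) in auto)
    qed
    ultimately show ?thesis by simp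
  qed
qed

text \<open>The window recovered is longer by \<open>s - r\<close> than the window of the image. For
  iterates this count drives the entropy bound; with arbitrarily long windows it gives injectivity
  on a fibre.\<close>

lemma biperm_window:
  assumes F: "biperm r s F" and w: "\<And>i. r \<le> i \<Longrightarrow> i < s \<Longrightarrow> x i = y i"
    and e: "\<And>i. - int n \<le> i \<Longrightarrow> i < int n' \<Longrightarrow> F x i = F y i" and i: "- int n + r \<le> i" "i < int n' + s"
  shows "x i = y i"
proof (cases "r \<le> i")
  case True
  show ?thesis
    by (rule biperm_window_right[OF F, where x = x and y = y and n = n']) (use w e i True in auto)
next
  case False
  show ?thesis
    by (rule biperm_window_left[OF F, where x = x and y = y and n = n])
      (use w e i False biperm_le[OF F] in auto)
qed

lemma biperm_inj:
  assumes F: "biperm r s F" and "window r s x = window r s y" and "F x = F y"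
  shows "x = y"
proof
  fix i
  show "x i = y i"
    by (rule biperm_window[OF F, of x y "nat \<bar>i\<bar> + nat \<bar>r\<bar>" "nat \<bar>i\<bar> + nat \<bar>s\<bar> + 1"])
      (use assms(2,3) in \<open>auto simp: window_eq_iff\<close>)
qed

section \<open>Existence of preimages and continuous sections\<close>

lemma biperm_ex_right:
  fixes F :: "'a::finite config \<Rightarrow> 'a config"
  assumes F: "biperm r s F"
  shows "\<exists>a. F (x(m + s := a)) m = b"
proof -
  have "inj (\<lambda>a. F (x(m + s := a)) m)"
  proof (rule injI)
    fix a a' assume "F (x(m + s := a)) m = F (x(m + s := a')) m"
    from biperm_right[OF F _ this] show "a = a'" by simp
  qed
  then have "surj (\<lambda>a. F (x(m + s := a)) m)" by (intro finite_UNIV_inj_surj) simp_all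
  from surjD[OF this, of b] obtain a where "b = F (x(m + s := a)) m" ..
  from this[symmetric] show ?thesis ..
qed

lemma biperm_ex_left:
  fixes F :: "'a::finite config \<Rightarrow> 'a config"
  assumes F: "biperm r s F"
  shows "\<exists>a. F (x(m + r := a)) m = b"
proof -
  have "inj (\<lambda>a. F (x(m + r := a)) m)"
  proof (rule injI)
    fix a a' assume "F (x(m + r := a)) m = F (x(m + r := a')) m"
    from biperm_left[OF F _ this] show "a = a'" by simp
  qed
  then have "surj (\<lambda>a. F (x(m + r := a)) m)" by (intro finite_UNIV_inj_surj) simp_all
  from surjD[OF this, of b] obtain a where "b = F (x(m + r := a)) m" ..
  from this[symmetric] show ?thesis ..
qed

lemma biperm_ex_finite:
  fixes F :: "'a::finite config \<Rightarrow> 'a config"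
  assumes F: "biperm r s F"
  shows "\<exists>x. (\<forall>i\<in>{r..<s}. x i = u i) \<and> (\<forall>i\<in>{- int n..<int n}. F x i = y i)"
proof (induction n)
  case (Suc n)
  then obtain x where x: "\<forall>i\<in>{r..<s}. x i = u i" "\<forall>i\<in>{- int n..<int n}. F x i = y i" by blast
  \<comment> \<open>Changing \<open>x\<close> at \<open>int n + s\<close> leaves the image before
    \<open>int n\<close> alone, and changing it at \<open>- int (Suc n) + r\<close> leaves the image
    after \<open>- int (Suc n)\<close> alone. Both places lie outside the prescribed word.\<close>
  obtain a where a: "F (x(int n + s := a)) (int n) = y (int n)" using biperm_ex_right[OF F] by blast
  let ?x = "x(int n + s := a)"
  obtain b where b: "F (?x(- int (Suc n) + r := b)) (- int (Suc n)) = y (- int (Suc n))"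
    using biperm_ex_left[OF F] by blast
  let ?z = "?x(- int (Suc n) + r := b)"
  have xa: "F ?x i = F x i" if "i < int n" for i
    by (rule biperm_local[OF F]) (use that in auto)
  have za: "F ?z i = F ?x i" if "- int (Suc n) < i" for i
    by (rule biperm_local[OF F]) (use that in auto)
  have "F ?z i = y i" if "i \<in> {- int (Suc n)..<int (Suc n)}" for i
  proof -
    have "i = - int (Suc n) \<or> - int n \<le> i \<and> i < int n \<or> i = int n" using that by auto
    then consider "i = - int (Suc n)" | "- int n \<le> i" "i < int n" | "i = int n" by blast
    then show ?thesis
    proof cases
      case 1
      then show ?thesis using b by simp
    next
      case 2
      then show ?thesis using za[of i] xa[of i] x(2) by simp
    next
      case 3
      then show ?thesis using za[of i] a by simp
    qed
  qed
  moreover have "\<forall>i\<in>{r..<s}. ?z i = u i" using x(1) by auto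
  ultimately show ?case by blast
qed auto

lemma biperm_surj:
  fixes F :: "'a::finite config \<Rightarrow> 'a config"
  assumes F: "biperm r s F"
  shows "\<exists>x. window r s x = window r s u \<and> F x = y"
proof -
  obtain X where X: "\<And>n. \<forall>i\<in>{r..<s}. X n i = u i" "\<And>n. \<forall>i\<in>{- int n..<int n}. F (X n) i = y i"
    using biperm_ex_finite[OF F, of u _ y] by metis
  \<comment> \<open>From \<open>K i\<close> on, coordinate \<open>i\<close> of \<open>X n\<close>
    lies in the part determined by the prescribed word and image, so it no longer depends on
    \<open>n\<close>; \<open>x\<close> is the coordinatewise limit.\<close>
  define K where "K i = nat \<bar>i\<bar> + nat \<bar>r\<bar> + nat \<bar>s\<bar> + 1" for i
  define x where "x i = X (K i) i" for i
  have eq: "x i = X n i" if "K i \<le> n" for i n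
    unfolding x_def
  proof (rule biperm_window[OF F, of "X (K i)" "X n" "K i" "K i" i])
    show "F (X (K i)) j = F (X n) j" if "- int (K i) \<le> j" "j < int (K i)" for j
      using X(2)[of "K i"] X(2)[of n] that \<open>K i \<le> n\<close> by simp
  qed (use X(1)[of "K i"] X(1)[of n] in \<open>auto simp: K_def\<close>)
  have "F x m = y m" for m
  proof -
    define n where "n = Max (K ` {m + r..m + s}) + nat \<bar>m\<bar> + 1"
    have "K i \<le> n" if "m + r \<le> i" "i \<le> m + s" for i
    proof -
      have "K i \<le> Max (K ` {m + r..m + s})" using that by (intro Max_ge) auto
      then show ?thesis by (simp add: n_def)
    qed
    then have "F x m = F (X n) m" by (intro biperm_local[OF F] eq) auto
    also have "\<dots> = y m"
    proof (rule bspec[OF X(2)])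
      have "nat \<bar>m\<bar> < n" by (simp add: n_def)
      then show "m \<in> {- int n..<int n}" unfolding atLeastLessThan_iff by linarith
    qed
    finally show ?thesis .
  qed
  moreover have "window r s x = window r s u" using X(1) by (simp add: window_eq_iff x_def)
  ultimately show ?thesis by blast
qed

text \<open>The chosen preimage is unique by \<open>biperm_inj\<close>, and it is continuous in
  \<open>y\<close>. Through it, a function that is constant on the fibres of \<open>F\<close>
  becomes a Borel function of the image, without quotient spaces.\<close>

definition fibre_section :: "int \<Rightarrow> int \<Rightarrow> ('a config \<Rightarrow> 'a config) \<Rightarrow> 'a config \<Rightarrow> 'a config \<Rightarrow> 'a config" where
  "fibre_section r s F u y = (SOME x. window r s x = window r s u \<and> F x = y)"

lemma
  fixes F :: "'a::finite config \<Rightarrow> 'a config"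
  assumes "biperm r s F"
  shows window_fibre_section: "window r s (fibre_section r s F u y) = window r s u"
    and image_fibre_section: "F (fibre_section r s F u y) = y"
  using someI_ex[OF biperm_surj[OF assms, of u y]] unfolding fibre_section_def by blast+

lemma continuous_fibre_section:
  fixes F :: "'a::{finite,discrete_topology} config \<Rightarrow> 'a config"
  assumes F: "biperm r s F"
  shows "continuous_on UNIV (fibre_section r s F u)"
  unfolding continuous_config_iff
proof (intro allI exI impI)
  fix y y' :: "'a config" and M
  define n where "n = M + nat \<bar>r\<bar> + nat \<bar>s\<bar> + 1"
  assume ag: "agree n y y'"
  let ?x = "fibre_section r s F u y" and ?x' = "fibre_section r s F u y'"
  have "?x i = ?x' i" if "- int M \<le> i" "i \<le> int M" for i
  proof (rule biperm_window[OF F, of _ _ n n])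
    show "?x j = ?x' j" if "r \<le> j" "j < s" for j
      using window_fibre_section[OF F, of u y] window_fibre_section[OF F, of u y'] that
      by (simp add: window_eq_iff)
    show "F ?x j = F ?x' j" if "- int n \<le> j" "j < int n" for j
      using ag that by (simp add: image_fibre_section[OF F] agree_def)
  qed (use that in \<open>auto simp: n_def\<close>)
  then show "agree M ?x ?x'" by (simp add: agree_def)
qed

text \<open>A point of a fibre is coded by its word on \<open>{r..<s}\<close>, and every word
  occurs.\<close>

lemma card_fibre:
  fixes F :: "'a::finite config \<Rightarrow> 'a config"
  assumes F: "biperm r s F"
  shows "finite {x. F x = y}" and "card {x. F x = y} = CARD('a) ^ nat (s - r)"
proof -
  have b: "bij_betw (window r s) {x. F x = y} (PiE {r..<s} (\<lambda>_. UNIV))"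
  proof (rule bij_betw_imageI)
    show "inj_on (window r s) {x. F x = y}" by (rule inj_onI) (auto intro: biperm_inj[OF F])
    show "window r s ` {x. F x = y} = PiE {r..<s} (\<lambda>_. UNIV)"
    proof
      show "window r s ` {x. F x = y} \<subseteq> PiE {r..<s} (\<lambda>_. UNIV)" by (auto simp: window_def)
      show "PiE {r..<s} (\<lambda>_. UNIV) \<subseteq> window r s ` {x. F x = y}"
      proof
        fix u :: "'a config" assume u: "u \<in> PiE {r..<s} (\<lambda>_. UNIV)"
        then have "window r s u = u" by (simp add: window_def PiE_restrict)
        then show "u \<in> window r s ` {x. F x = y}"
          using window_fibre_section[OF F, of u y] image_fibre_section[OF F, of u y] by force
      qed
    qed
  qed
  then show "finite {x. F x = y}" using bij_betw_finite[OF b] by (simp add: finite_PiE)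
  show "card {x. F x = y} = CARD('a) ^ nat (s - r)"
    unfolding bij_betw_same_card[OF b] by (subst card_PiE) simp_all
qed

lemma shift_funpow: "(shift ^^ n) x = (\<lambda>i. x (i + int n))"
  by (induction n arbitrary: x) (auto simp: shift_def algebra_simps)

lemma inj_shift: "inj (shift :: 'a config \<Rightarrow> 'a config)"
proof (rule injI)
  fix x y :: "'a config" assume "shift x = shift y"
  then have "x (i - 1 + 1) = y (i - 1 + 1)" for i unfolding shift_def fun_eq_iff by blast
  then show "x = y" by auto
qed

lemma surj_shift: "surj (shift :: 'a config \<Rightarrow> 'a config)"
proof (rule surjI)
  fix x :: "'a config"
  show "shift (shift_int (-1) x) = x" by (simp add: shift_def shift_int_def)
qed

lemma shift_fixed_const:
  assumes "shift x = x"
  shows "x i = x 0"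
proof (induction i rule: int_induct[of _ 0])
  case (step1 i)
  then show ?case using fun_cong[OF assms, of i] by (simp add: shift_def)
next
  case (step2 i)
  then show ?case using fun_cong[OF assms, of "i - 1"] by (simp add: shift_def)
qed simp

text \<open>Only constant sequences are fixed. They account for the factor \<open>CARD('a)\<close>
  between supports and stabilisers.\<close>

lemma shift_fixed_points:
  "finite {x :: 'a::finite config. shift x = x}" "card {x :: 'a config. shift x = x} \<le> CARD('a)"
proof -
  have inj: "inj_on (\<lambda>x. x 0) {x :: 'a config. shift x = x}"
  proof (rule inj_onI, rule ext)
    fix x y :: "'a config" and i
    assume "x \<in> {x. shift x = x}" "y \<in> {x. shift x = x}" "x 0 = y 0"
    then show "x i = y i" using shift_fixed_const[of x i] shift_fixed_const[of y i] by simp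
  qed
  show "finite {x :: 'a config. shift x = x}" 
    by (rule finite_imageD[OF _ inj]) simp
  show "card {x :: 'a config. shift x = x} \<le> CARD('a)"
    unfolding card_image[OF inj, symmetric] by (rule card_mono) simp_all
qed


section \<open>Roots of unity in the spectrum of a measure-preserving map\<close>

text \<open>
  If no set invariant under \<open>T\<^sup>p\<close> is moved by \<open>T\<close>, then \<open>T\<close> has no eigenvalue of order \<open>p\<close>, and hence
  none whose order is divisible by \<open>p\<close>. Instead of using eigenfunctions, we colour the
  periodic itineraries of a set by the position modulo \<open>p\<close> on their orbit.
\<close>

definition periodic_word :: "nat \<Rightarrow> (nat \<Rightarrow> bool) \<Rightarrow> bool" where
  "periodic_word m w \<longleftrightarrow> (\<forall>i. w (i + m) = w i)"

definition word_orbit :: "(nat \<Rightarrow> bool) \<Rightarrow> (nat \<Rightarrow> bool) set" where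
  "word_orbit w = range (\<lambda>j i. w (i + j))"

text \<open>The choice depends on the orbit only, so all shifts of a periodic word share one
  representative.\<close>

definition orbit_rep :: "(nat \<Rightarrow> bool) \<Rightarrow> nat \<Rightarrow> bool" where
  "orbit_rep w = (SOME v. v \<in> word_orbit w)"

text \<open>Excluding period \<open>q\<close> forces every period of the word to be a multiple of
  the prime \<open>p\<close>, so the position modulo \<open>p\<close> relative to the representative
  is well defined. It plays the part of the phase of an eigenfunction, and the class consists of the
  words of phase 0.\<close>

definition colour_class :: "nat \<Rightarrow> nat \<Rightarrow> (nat \<Rightarrow> bool) set" where
  "colour_class p q = {w. periodic_word (p * q) w \<and> \<not> periodic_word q w \<and>
     (\<exists>j. p dvd j \<and> w = (\<lambda>i. orbit_rep w (i + j)))}"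

lemma colour_classE:
  assumes "w \<in> colour_class p q"
  obtains j where "p dvd j" "w = (\<lambda>i. orbit_rep w (i + j))"
proof -
  from assms have "\<exists>j. p dvd j \<and> w = (\<lambda>i. orbit_rep w (i + j))"
    unfolding colour_class_def mem_Collect_eq by (elim conjE)
  then obtain j where j: "p dvd j \<and> w = (\<lambda>i. orbit_rep w (i + j))" ..
  show thesis by (rule that[OF conjunct1[OF j] conjunct2[OF j]])
qed

lemma periodic_word_mult: "periodic_word m w \<Longrightarrow> w (i + k * m) = w i"
  by (induction k) (simp_all add: periodic_word_def add.assoc[symmetric] add.commute[of m])

lemma periodic_word_dvd: "periodic_word m w \<Longrightarrow> m dvd n \<Longrightarrow> periodic_word n w"
  using periodic_word_mult[of m w] by (auto simp: periodic_word_def elim!: dvdE simp: mult.commute)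

lemma periodic_word_shift: "periodic_word m w \<Longrightarrow> periodic_word m (\<lambda>i. w (i + j))"
  by (simp add: periodic_word_def) (metis add.assoc add.commute)

lemma periodic_word_unshift:
  assumes m: "periodic_word m w" "0 < m" and q: "periodic_word q (\<lambda>i. w (i + j))"
  shows "periodic_word q w"
  unfolding periodic_word_def
proof
  fix i
  obtain m' where m': "m = Suc m'" using m(2) by (cases m) auto
  have e: "w k = w (k + j * m' + j)" for k
    using periodic_word_mult[OF m(1), of k j] by (simp add: m' algebra_simps)
  have "w (i + q) = w (i + j * m' + q + j)" using e[of "i + q"] by (simp add: algebra_simps)
  also have "\<dots> = w (i + j * m' + j)" using q by (simp add: periodic_word_def)
  also have "\<dots> = w i" using e[of i] by simp
  finally show "w (i + q) = w i" .
qed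

lemma word_orbit_shift:
  assumes "periodic_word m w" "0 < m"
  shows "word_orbit (\<lambda>i. w (i + n)) = word_orbit w"
proof
  show "word_orbit (\<lambda>i. w (i + n)) \<subseteq> word_orbit w"
    by (force simp: word_orbit_def add.assoc)
  obtain m' where m': "m = Suc m'" using assms(2) by (cases m) auto
  show "word_orbit w \<subseteq> word_orbit (\<lambda>i. w (i + n))"
  proof
    fix v assume "v \<in> word_orbit w"
    then obtain j where v: "v = (\<lambda>i. w (i + j))" by (auto simp: word_orbit_def)
    have "v = (\<lambda>i. w (i + (j + n * m') + n))"
      unfolding v
    proof
      fix i
      show "w (i + j) = w (i + (j + n * m') + n)"
        using periodic_word_mult[OF assms(1), of "i + j" n] by (simp add: m' algebra_simps)
    qed
    then show "v \<in> word_orbit (\<lambda>i. w (i + n))" by (auto simp: word_orbit_def)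
  qed
qed

lemma orbit_rep_shift:
  "periodic_word m w \<Longrightarrow> 0 < m \<Longrightarrow> orbit_rep (\<lambda>i. w (i + n)) = orbit_rep w"
  by (simp add: orbit_rep_def word_orbit_shift)

lemma orbit_rep_in: "\<exists>j. orbit_rep w = (\<lambda>i. w (i + j))"
proof -
  have "w \<in> word_orbit w" unfolding word_orbit_def by (rule image_eqI[of _ _ 0]) auto
  then have "orbit_rep w \<in> word_orbit w" unfolding orbit_rep_def by (rule someI[of "\<lambda>v. v \<in> word_orbit w"])
  then show ?thesis by (auto simp: word_orbit_def)
qed

lemma in_orbit_of_rep:
  assumes "periodic_word m w" "0 < m"
  obtains j where "w = (\<lambda>i. orbit_rep w (i + j))"
proof -
  obtain j where j: "orbit_rep w = (\<lambda>i. w (i + j))" using orbit_rep_in by blast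
  obtain m' where m': "m = Suc m'" using assms(2) by (cases m) auto
  have "w = (\<lambda>i. orbit_rep w (i + j * m'))"
  proof
    fix i
    show "w i = orbit_rep w (i + j * m')"
      unfolding j using periodic_word_mult[OF assms(1), of i j] by (simp add: m' algebra_simps)
  qed
  then show thesis by (rule that)
qed

lemma periodic_word_gcd:
  assumes "periodic_word c w" "periodic_word m w" "0 < c"
  shows "periodic_word (gcd c m) w"
  unfolding periodic_word_def
proof
  fix i
  obtain x y where xy: "c * x = m * y + gcd c m" using bezout_nat[of c m] assms(3) by auto
  have "w (i + gcd c m) = w (i + gcd c m + y * m)" using periodic_word_mult[OF assms(2)] by simp
  also have "\<dots> = w (i + x * c)" using xy by (simp add: algebra_simps)
  also have "\<dots> = w i" by (rule periodic_word_mult[OF assms(1)])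
  finally show "w (i + gcd c m) = w i" .
qed

context
  fixes p q :: nat
  assumes p: "prime p" and q: "0 < q"
begin

lemma pq_pos: "0 < p * q"
  using p q prime_gt_0_nat by simp

lemma colour_class_shift:
  assumes "w \<in> colour_class p q"
  shows "(\<lambda>i. w (i + p)) \<in> colour_class p q"
proof -
  let ?v = "\<lambda>i. w (i + p)"
  have w: "periodic_word (p * q) w" "\<not> periodic_word q w"
    using assms by (auto simp: colour_class_def)
  obtain j where j: "p dvd j" "w = (\<lambda>i. orbit_rep w (i + j))" using assms by (rule colour_classE)
  have rep: "orbit_rep ?v = orbit_rep w" by (rule orbit_rep_shift[OF w(1) pq_pos])
  have "?v = (\<lambda>i. orbit_rep ?v (i + (j + p)))"
    unfolding rep
  proof
    fix i show "w (i + p) = orbit_rep w (i + (j + p))"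
      using fun_cong[OF j(2), of "i + p"] by (simp add: algebra_simps)
  qed
  moreover have "p dvd j + p" using j(1) by simp
  moreover have "periodic_word (p * q) ?v" by (rule periodic_word_shift[OF w(1)])
  moreover have "\<not> periodic_word q ?v" using periodic_word_unshift[OF w(1) pq_pos] w(2) by blast
  ultimately show ?thesis unfolding colour_class_def mem_Collect_eq by (intro conjI exI)
qed

lemma colour_class_shift_mult:
  "w \<in> colour_class p q \<Longrightarrow> (\<lambda>i. w (i + n * p)) \<in> colour_class p q"
proof (induction n)
  case (Suc n)
  then show ?case using colour_class_shift[of "\<lambda>i. w (i + n * p)"] by (simp add: algebra_simps)
qed simp

lemma colour_class_shift_iff:
  assumes w: "periodic_word (p * q) w"
  shows "(\<lambda>i. w (i + p)) \<in> colour_class p q \<longleftrightarrow> w \<in> colour_class p q"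
proof
  assume "(\<lambda>i. w (i + p)) \<in> colour_class p q"
  then have "(\<lambda>i. w (i + (q - 1) * p + p)) \<in> colour_class p q"
    by (rule colour_class_shift_mult)
  moreover have "w (i + (q - 1) * p + p) = w i" for i
  proof -
    have "i + (q - 1) * p + p = i + p * q" using q by (cases q) (simp_all add: algebra_simps)
    then have "w (i + (q - 1) * p + p) = w (i + p * q)" by (rule arg_cong[of _ _ w])
    also have "\<dots> = w i" using w by (simp add: periodic_word_def)
    finally show ?thesis .
  qed
  ultimately show "w \<in> colour_class p q" by simp
qed (rule colour_class_shift)

text \<open>Otherwise the representative would have a period prime to \<open>p\<close>. The gcd of
  that period with \<open>p * q\<close> divides \<open>q\<close>, so the word would have period
  \<open>q\<close>.\<close>

lemma colour_class_disjoint_shift: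
  assumes "w \<in> colour_class p q"
  shows "(\<lambda>i. w (i + 1)) \<notin> colour_class p q"
proof
  let ?v = "\<lambda>i. w (i + 1)" and ?r = "orbit_rep w" and ?m = "p * q"
  assume "?v \<in> colour_class p q"
  have w: "periodic_word ?m w" "\<not> periodic_word q w" using assms by (auto simp: colour_class_def)
  have rep: "orbit_rep ?v = ?r" by (rule orbit_rep_shift[OF w(1) pq_pos])
  obtain j where j: "p dvd j" "w = (\<lambda>i. ?r (i + j))" using assms by (rule colour_classE)
  obtain j' where j': "p dvd j'" "?v = (\<lambda>i. ?r (i + j'))"
    using colour_classE[OF \<open>?v \<in> colour_class p q\<close>] unfolding rep .
  obtain k where k: "?r = (\<lambda>i. w (i + k))" using orbit_rep_in by blast
  have rm: "periodic_word ?m ?r" unfolding k by (rule periodic_word_shift[OF w(1)])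
  have e: "?r (i + (j + 1)) = ?r (i + j')" for i
    using fun_cong[OF j'(2), of i] fun_cong[OF j(2), of "i + 1"] by (simp add: algebra_simps)
  obtain m' where m': "?m = Suc m'" using pq_pos by (cases "p * q") auto
  \<comment> \<open>Modulo \<open>p * q\<close> this is \<open>j + 1 - j'\<close>: adding
    \<open>m' * j'\<close> undoes a shift by \<open>j'\<close> within the natural numbers. As
    \<open>p\<close> divides \<open>j\<close> and \<open>j'\<close>, it does not divide
    \<open>c\<close>.\<close>
  define c where "c = m' * j' + j + 1"
  have "?r (i + c) = ?r i" for i
  proof -
    have "?r (i + c) = ?r (i + m' * j' + (j + 1))" by (simp add: c_def algebra_simps)
    also have "\<dots> = ?r (i + m' * j' + j')" by (rule e)
    also have "\<dots> = ?r (i + j' * ?m)" unfolding m' by (simp add: algebra_simps)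
    also have "\<dots> = ?r i" by (rule periodic_word_mult[OF rm])
    finally show ?thesis .
  qed
  then have rc: "periodic_word c ?r" by (simp add: periodic_word_def)
  have "\<not> p dvd c"
  proof
    assume "p dvd c"
    moreover have "p dvd m' * j' + j" using j(1) j'(1) by simp
    ultimately have "p dvd c - (m' * j' + j)" by (rule dvd_diff_nat)
    then have "p dvd 1" by (simp add: c_def)
    then show False using p by (simp add: prime_nat_iff)
  qed
  then have cop: "coprime c p" using prime_imp_coprime[OF p] coprime_commute by blast
  have "gcd c ?m dvd q"
  proof -
    have "coprime (gcd c ?m) p" using cop by (meson coprime_divisors dvd_refl gcd_dvd1)
    moreover have "gcd c ?m dvd p * q" by simp
    ultimately show ?thesis using coprime_dvd_mult_right_iff by blast
  qed
  then have "periodic_word q ?r"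
    using periodic_word_dvd[OF periodic_word_gcd[OF rc rm]] by (simp add: c_def)
  then have "periodic_word q (\<lambda>i. ?r (i + j))" by (rule periodic_word_shift)
  then show False using w(2) j(2) by simp
qed

lemma colour_class_hit:
  assumes w: "periodic_word (p * q) w" "\<not> periodic_word q w"
  shows "\<exists>i<p. (\<lambda>k. w (k + i)) \<in> colour_class p q"
proof -
  obtain j where j: "w = (\<lambda>i. orbit_rep w (i + j))" by (rule in_orbit_of_rep[OF w(1) pq_pos])
  \<comment> \<open>The residue of \<open>- j\<close> modulo \<open>p\<close>; the outer
    \<open>mod\<close> covers the case \<open>j mod p = 0\<close>, where the difference is
    \<open>p\<close>.\<close>
  define i where "i = (p - j mod p) mod p"
  have "0 < p" using p prime_gt_0_nat by blast
  then have "i < p" by (simp add: i_def)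
  have "p dvd j + i"
  proof -
    have "(j + i) mod p = (j mod p + (p - j mod p)) mod p" by (simp add: i_def mod_simps)
    also have "\<dots> = 0" using \<open>0 < p\<close> by (simp add: less_imp_le)
    finally show ?thesis by (simp add: mod_eq_0_iff_dvd)
  qed
  let ?v = "\<lambda>k. w (k + i)"
  have rep: "orbit_rep ?v = orbit_rep w" by (rule orbit_rep_shift[OF w(1) pq_pos])
  have "?v = (\<lambda>k. orbit_rep ?v (k + (j + i)))"
    unfolding rep
  proof
    fix k show "w (k + i) = orbit_rep w (k + (j + i))"
      using fun_cong[OF j, of "k + i"] by (simp add: algebra_simps)
  qed
  moreover have "periodic_word (p * q) ?v" by (rule periodic_word_shift[OF w(1)])
  moreover have "\<not> periodic_word q ?v" using periodic_word_unshift[OF w(1) pq_pos] w(2) by blast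
  ultimately have "?v \<in> colour_class p q" using \<open>p dvd j + i\<close>
    unfolding colour_class_def mem_Collect_eq by (intro conjI exI)
  with \<open>i < p\<close> show ?thesis by blast
qed

lemma finite_colour_class: "finite (colour_class p q)"
proof (rule inj_on_finite)
  let ?m = "p * q"
  show "inj_on (\<lambda>w. {i. i < ?m \<and> w i}) (colour_class p q)"
  proof (rule inj_onI, rule ext)
    fix v w i assume vw: "v \<in> colour_class p q" "w \<in> colour_class p q"
      and e: "{i. i < ?m \<and> v i} = {i. i < ?m \<and> w i}"
    have "u i = u (i mod ?m)" if "u \<in> colour_class p q" for u
      using periodic_word_mult[of ?m u "i mod ?m" "i div ?m"] that
      by (simp add: colour_class_def mod_div_mult_eq)
    moreover have "i mod ?m < ?m" using pq_pos by simp
    ultimately show "v i = w i" using e vw by blast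
  qed
  show "(\<lambda>w. {i. i < ?m \<and> w i}) ` colour_class p q \<subseteq> Pow {..<?m}" by auto
qed simp

end

section \<open>Invariant sets of powers of a measure-preserving map\<close>

lemma AE_comp_preserving:
  assumes T: "T \<in> measurable M M"
    and inv: "\<And>A. A \<in> sets M \<Longrightarrow> emeasure M (T -` A \<inter> space M) = emeasure M A"
    and P: "AE x in M. P x"
  shows "AE x in M. P (T x)"
proof -
  obtain N where N: "{x \<in> space M. \<not> P x} \<subseteq> N" "emeasure M N = 0" "N \<in> sets M"
    using AE_E[OF P] by blast
  show ?thesis
  proof (rule AE_I)
    show "{x \<in> space M. \<not> P (T x)} \<subseteq> T -` N \<inter> space M"
      using N(1) measurable_space[OF T] by blast
    show "emeasure M (T -` N \<inter> space M) = 0" using inv[OF N(3)] N(2) by simp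
    show "T -` N \<inter> space M \<in> sets M" by (rule measurable_sets[OF T N(3)])
  qed
qed

context
  fixes \<mu> :: "'b::topological_space measure" and T :: "'b \<Rightarrow> 'b"
  assumes sets: "sets \<mu> = sets borel" and T: "T \<in> measurable borel borel"
    and inv: "invariant_measure T \<mu>"
begin

lemma space_UNIV: "space \<mu> = UNIV"
  using sets_eq_imp_space_eq[OF sets] by simp

lemma T_funpow_measurable: "T ^^ n \<in> measurable borel borel"
proof (induction n)
  case (Suc n)
  have "T \<circ> T ^^ n \<in> measurable borel borel" by (rule measurable_comp[OF Suc T])
  then show ?case by (simp add: comp_def)
qed (simp add: id_def)

lemma invariant_funpow: "B \<in> sets borel \<Longrightarrow> emeasure \<mu> ((T ^^ n) -` B) = emeasure \<mu> B"
proof (induction n arbitrary: B)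
  case (Suc n)
  have "T -` B \<in> sets borel" using measurable_sets[OF T Suc.prems] by simp
  moreover have "(T ^^ Suc n) -` B = (T ^^ n) -` (T -` B)" by auto
  ultimately show ?case using Suc inv by (simp add: invariant_measure_def comp_def)
qed simp

lemma AE_T_funpow:
  assumes "AE x in \<mu>. P x"
  shows "AE x in \<mu>. P ((T ^^ n) x)"
proof (rule AE_comp_preserving[OF _ _ assms])
  show "T ^^ n \<in> measurable \<mu> \<mu>" using T_funpow_measurable sets measurable_cong_sets by blast
qed (simp add: space_UNIV sets invariant_funpow)

lemma inv_sets_iff:
  assumes "S \<in> measurable borel borel"
  shows "B \<in> inv_sets \<mu> S \<longleftrightarrow> B \<in> sets borel \<and> (AE x in \<mu>. S x \<in> B \<longleftrightarrow> x \<in> B)"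
proof (cases "B \<in> sets borel")
  case True
  have SB: "S -` B \<in> sets borel" using measurable_sets[OF assms True] by simp
  have "sym_diff (S -` B) B = {x \<in> space \<mu>. \<not> (S x \<in> B \<longleftrightarrow> x \<in> B)}" by (auto simp: space_UNIV)
  moreover have "sym_diff (S -` B) B \<in> sets \<mu>" unfolding sets using True SB by (intro sets.Un sets.Diff)
  ultimately have "(AE x in \<mu>. S x \<in> B \<longleftrightarrow> x \<in> B) \<longleftrightarrow> emeasure \<mu> (sym_diff (S -` B) B) = 0"
    by (intro AE_iff_measurable) simp_all
  with True show ?thesis by (simp add: inv_sets_def)
qed (simp add: inv_sets_def)

lemma inv_sets_funpow_mult:
  assumes "B \<in> inv_sets \<mu> (T ^^ n)"
  shows "B \<in> inv_sets \<mu> (T ^^ (n * k))"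
proof -
  have B: "B \<in> sets borel" "AE x in \<mu>. (T ^^ n) x \<in> B \<longleftrightarrow> x \<in> B"
    using assms inv_sets_iff[OF T_funpow_measurable] by blast+
  have "AE x in \<mu>. (T ^^ (n * k)) x \<in> B \<longleftrightarrow> x \<in> B"
  proof (induction k)
    case (Suc k)
    have "AE x in \<mu>. (T ^^ n) ((T ^^ (n * k)) x) \<in> B \<longleftrightarrow> (T ^^ (n * k)) x \<in> B"
      by (rule AE_T_funpow[OF B(2)])
    with Suc show ?case by eventually_elim (simp add: funpow_add)
  qed simp
  with B show ?thesis using inv_sets_iff[OF T_funpow_measurable] by blast
qed

text \<open>Almost every itinerary of \<open>B\<close> has period \<open>p * q\<close>. The set
  \<open>C\<close> of points whose itinerary lies in the colour class is invariant under
  \<open>T ^^ p\<close> up to a null set, but disjoint from its preimage under \<open>T\<close>. By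
  hypothesis it is also \<open>T\<close>-invariant up to a null set, hence null. An orbit whose
  itinerary has period \<open>p * q\<close> but not \<open>q\<close> hits \<open>C\<close>, so
  almost every itinerary has period \<open>q\<close>.\<close>

lemma inv_sets_prime_step:
  assumes p: "prime p" and q: "0 < q" and ip: "inv_sets \<mu> (T ^^ p) \<subseteq> inv_sets \<mu> T"
    and B: "B \<in> inv_sets \<mu> (T ^^ (p * q))"
  shows "B \<in> inv_sets \<mu> (T ^^ q)"
proof -
  define N where "N x i = ((T ^^ i) x \<in> B)" for x and i :: nat
  have Bb: "B \<in> sets borel" and per0: "AE x in \<mu>. (T ^^ (p * q)) x \<in> B \<longleftrightarrow> x \<in> B"
    using B inv_sets_iff[OF T_funpow_measurable] by blast+
  have N_shift: "N ((T ^^ n) x) = (\<lambda>i. N x (i + n))" for n x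
    by (rule ext) (simp add: N_def funpow_add)
  have "AE x in \<mu>. \<forall>i. (T ^^ (p * q)) ((T ^^ i) x) \<in> B \<longleftrightarrow> (T ^^ i) x \<in> B"
    unfolding AE_all_countable using AE_T_funpow[OF per0] by blast
  then have per: "AE x in \<mu>. periodic_word (p * q) (N x)"
    by eventually_elim (simp add: periodic_word_def N_def funpow_add add.commute[of _ "p * q"])
  define C where "C = {x. N x \<in> colour_class p q}"
  have NB: "{x. N x = w} \<in> sets borel" for w
  proof -
    have "{x. N x = w} = (\<Inter>i. if w i then (T ^^ i) -` B else - ((T ^^ i) -` B))"
      by (auto simp: N_def fun_eq_iff split: if_splits)
    also have "\<dots> \<in> sets borel"
    proof (rule sets.countable_INT'')
      fix i
      have "(T ^^ i) -` B \<in> sets borel" using measurable_sets[OF T_funpow_measurable Bb] by simp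
      then show "(if w i then (T ^^ i) -` B else - ((T ^^ i) -` B)) \<in> sets borel"
        by (simp add: borel_comp)
    qed (simp, rule countableI_type)
    finally show ?thesis .
  qed
  have "C = (\<Union>w\<in>colour_class p q. {x. N x = w})" by (auto simp: C_def)
  also have "\<dots> \<in> sets borel" by (intro sets.finite_UN finite_colour_class[OF p q] NB)
  finally have Cb: "C \<in> sets borel" .
  have "AE x in \<mu>. (T ^^ p) x \<in> C \<longleftrightarrow> x \<in> C"
    using per by eventually_elim (simp add: C_def N_shift colour_class_shift_iff[OF p q])
  then have "C \<in> inv_sets \<mu> (T ^^ p)" using Cb inv_sets_iff[OF T_funpow_measurable] by blast
  then have "AE x in \<mu>. T x \<in> C \<longleftrightarrow> x \<in> C" using ip inv_sets_iff[OF T] by blast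
  then have "AE x in \<mu>. x \<notin> C"
  proof eventually_elim
    case (elim x)
    show ?case
    proof
      assume "x \<in> C"
      with elim have "T x \<in> C" by simp
      then have "(\<lambda>i. N x (i + 1)) \<in> colour_class p q" using N_shift[of 1 x] by (simp add: C_def)
      then show False using colour_class_disjoint_shift[OF p q] \<open>x \<in> C\<close> by (simp add: C_def)
    qed
  qed
  then have "AE x in \<mu>. \<forall>i. (T ^^ i) x \<notin> C"
    unfolding AE_all_countable using AE_T_funpow by blast
  with per have "AE x in \<mu>. (T ^^ q) x \<in> B \<longleftrightarrow> x \<in> B"
  proof eventually_elim
    case (elim x)
    have "periodic_word q (N x)"
    proof (rule ccontr)
      assume "\<not> periodic_word q (N x)"
      then obtain i where "(\<lambda>k. N x (k + i)) \<in> colour_class p q"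
        using colour_class_hit[OF p q elim(1)] by blast
      then have "(T ^^ i) x \<in> C" by (simp add: C_def N_shift)
      with elim(2) show False by blast
    qed
    then have "N x (0 + q) = N x 0" unfolding periodic_word_def by blast
    then show ?case by (simp add: N_def)
  qed
  with Bb show ?thesis using inv_sets_iff[OF T_funpow_measurable] by blast
qed

text \<open>The prime factors of \<open>q\<close> are removed one by one. For a prime
  \<open>p\<close> dividing \<open>K\<close>, invariance under \<open>T ^^ p\<close> implies
  invariance under \<open>T ^^ K\<close>, so the hypothesis on one power covers all numbers built
  from the primes of \<open>K\<close>.\<close>

lemma inv_sets_funpow_subset:
  assumes K: "inv_sets \<mu> T = inv_sets \<mu> (T ^^ K)"
  shows "0 < q \<Longrightarrow> (\<And>p. prime p \<Longrightarrow> p dvd q \<Longrightarrow> p dvd K) \<Longrightarrow> inv_sets \<mu> (T ^^ q) \<subseteq> inv_sets \<mu> T"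
proof (induction q rule: less_induct)
  case (less q)
  show ?case
  proof (cases "q = 1")
    case False
    then obtain p where p: "prime p" "p dvd q" using prime_factor_nat by blast
    then obtain r where r: "q = p * r" by (auto elim: dvdE)
    have "0 < r" using less.prems(1) r by (cases r) auto
    have "r < q" using r \<open>0 < r\<close> prime_gt_1_nat[OF p(1)] by simp
    have "p dvd K" using less.prems(2) p by blast
    then obtain c where c: "K = p * c" by (auto elim: dvdE)
    have ip: "inv_sets \<mu> (T ^^ p) \<subseteq> inv_sets \<mu> T"
      unfolding K c by (rule subsetI) (rule inv_sets_funpow_mult)
    have "inv_sets \<mu> (T ^^ q) \<subseteq> inv_sets \<mu> (T ^^ r)"
      unfolding r by (rule subsetI) (rule inv_sets_prime_step[OF p(1) \<open>0 < r\<close> ip])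
    also have "\<dots> \<subseteq> inv_sets \<mu> T"
      using less.IH[OF \<open>r < q\<close> \<open>0 < r\<close>] less.prems(2) r by simp
    finally show ?thesis .
  qed simp
qed

end


section \<open>Translation by a finite subgroup\<close>

locale config_group =
  fixes G :: "('a::{finite,discrete_topology} config) monoid" (structure)
  assumes abelian_group_shift: "abelian_group_shift G"
begin

sublocale comm_group G
  using abelian_group_shift by (simp add: abelian_group_shift_def)

lemma carrier_UNIV [simp]: "carrier G = UNIV"
  using abelian_group_shift by (simp add: abelian_group_shift_def)

lemma continuous_mult: "continuous_on UNIV (\<lambda>(x, y). x \<otimes> y)"
  using abelian_group_shift by (simp add: abelian_group_shift_def)

lemma shift_mult: "shift (x \<otimes> y) = shift x \<otimes> shift y"
  using abelian_group_shift by (simp add: abelian_group_shift_def hom_def)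

lemma continuous_shift: "continuous_on UNIV (shift :: 'a config \<Rightarrow> 'a config)"
  using abelian_group_shift by (simp add: abelian_group_shift_def)

lemma measurable_shift [measurable]: "(shift :: 'a config \<Rightarrow> 'a config) \<in> borel_measurable borel"
  by (rule borel_measurable_continuous_onI[OF continuous_shift])

lemma measurable_translate [measurable]: "(\<lambda>x. g \<otimes> x) \<in> borel_measurable borel"
proof (rule borel_measurable_continuous_onI)
  have "continuous_on UNIV ((\<lambda>(x, y). x \<otimes> y) \<circ> (\<lambda>x. (g, x)))"
    by (intro continuous_on_compose continuous_on_subset[OF continuous_mult] continuous_intros) simp
  then show "continuous_on UNIV (\<lambda>x. g \<otimes> x)" by (simp add: comp_def)
qed

lemma translate_vimage_sets: "B \<in> sets borel \<Longrightarrow> (\<lambda>x. g \<otimes> x) -` B \<in> sets borel"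
  using measurable_sets[OF measurable_translate, of B g] by simp

lemma funpow_shift_mult: "(shift ^^ n) (x \<otimes> y) = (shift ^^ n) x \<otimes> (shift ^^ n) y"
  by (induction n) (simp_all add: shift_mult)

lemma inv_cancel_left [simp]: "inv x \<otimes> (x \<otimes> y) = y" "x \<otimes> (inv x \<otimes> y) = y"
  using m_assoc[of "inv x" x y] m_assoc[of x "inv x" y] by simp_all

lemma shift_one: "shift \<one> = \<one>"
  using shift_mult[of \<one> \<one>] by (simp add: l_cancel_one)

lemma shift_inv: "shift (inv x) = inv (shift x)"
  using shift_mult[of "inv x" x] by (simp add: shift_one inv_equality)

end

locale finite_translations = config_group G for G :: "('a::{finite,discrete_topology} config) monoid" (structure) +
  fixes \<mu> :: "'a config measure" and D :: "'a config set"
  assumes borel_prob: "borel_prob \<mu>" and subgroup: "subgroup D G" and finite_D: "finite D"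
begin

sublocale prob_space \<mu>
  using borel_prob by (simp add: borel_prob_def)

lemma sets_mu [simp, measurable_cong]: "sets \<mu> = sets borel"
  using borel_prob by (simp add: borel_prob_def)

lemma space_mu [simp]: "space \<mu> = UNIV"
  using sets_eq_imp_space_eq[OF sets_mu] by simp

lemma one_D: "\<one> \<in> D" and mult_D: "x \<in> D \<Longrightarrow> y \<in> D \<Longrightarrow> x \<otimes> y \<in> D" and inv_D: "x \<in> D \<Longrightarrow> inv x \<in> D"
  using subgroup by (auto simp: subgroup_def)

lemma bij_betw_mult_D:
  assumes "d \<in> D"
  shows "bij_betw (\<lambda>e. d \<otimes> e) D D"
proof (rule bij_betw_byWitness[where f' = "\<lambda>e. inv d \<otimes> e"])
  show "(\<lambda>e. d \<otimes> e) ` D \<subseteq> D" "(\<lambda>e. inv d \<otimes> e) ` D \<subseteq> D"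
    using assms by (auto intro: mult_D inv_D)
qed simp_all

text \<open>The average of the translates up to the factor \<open>card D\<close>, which is left out.
  It is invariant under \<open>D\<close> and, the unit belonging to \<open>D\<close>, dominates
  \<open>\<mu>\<close>.\<close>

definition nu :: "'a config measure" where
  "nu = measure_of UNIV (sets borel) (\<lambda>B. \<Sum>d\<in>D. emeasure \<mu> ((\<lambda>x. d \<otimes> x) -` B))"

lemma sets_nu [simp, measurable_cong]: "sets nu = sets borel"
  unfolding nu_def using sets.sigma_sets_eq[of borel] by (subst sets_measure_of) simp_all

lemma space_nu [simp]: "space nu = UNIV"
  unfolding nu_def by (rule space_measure_of) simp

lemma emeasure_nu:
  assumes "B \<in> sets borel"
  shows "emeasure nu B = (\<Sum>d\<in>D. emeasure \<mu> ((\<lambda>x. d \<otimes> x) -` B))"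
proof (rule emeasure_measure_of[OF nu_def])
  show "countably_additive (sets nu) (\<lambda>B. \<Sum>d\<in>D. emeasure \<mu> ((\<lambda>x. d \<otimes> x) -` B))"
  proof (rule countably_additiveI)
    fix A :: "nat \<Rightarrow> 'a config set"
    assume A: "range A \<subseteq> sets nu" "disjoint_family A"
    have "(\<Sum>i. emeasure \<mu> ((\<lambda>x. d \<otimes> x) -` A i)) = emeasure \<mu> ((\<lambda>x. d \<otimes> x) -` (\<Union>i. A i))" for d
    proof -
      have "range (\<lambda>i. (\<lambda>x. d \<otimes> x) -` A i) \<subseteq> sets \<mu>"
        using A(1) translate_vimage_sets by auto
      moreover have "disjoint_family (\<lambda>i. (\<lambda>x. d \<otimes> x) -` A i)"
        using A(2) by (auto simp: disjoint_family_on_def)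
      ultimately show ?thesis by (simp add: suminf_emeasure vimage_UN)
    qed
    then show "(\<Sum>i. \<Sum>d\<in>D. emeasure \<mu> ((\<lambda>x. d \<otimes> x) -` A i)) =
        (\<Sum>d\<in>D. emeasure \<mu> ((\<lambda>x. d \<otimes> x) -` (\<Union>i. A i)))"
      by (subst suminf_sum) simp_all
  qed
qed (use assms in \<open>auto simp: positive_def\<close>)

lemma finite_measure_nu: "finite_measure nu"
  by (rule finite_measureI) (simp add: emeasure_nu emeasure_eq_measure ennreal_mult_eq_top_iff)

lemma nu_translate:
  assumes d: "d \<in> D" and B: "B \<in> sets borel"
  shows "emeasure nu ((\<lambda>x. d \<otimes> x) -` B) = emeasure nu B"
proof -
  have "emeasure nu ((\<lambda>x. d \<otimes> x) -` B) = (\<Sum>e\<in>D. emeasure \<mu> ((\<lambda>x. (d \<otimes> e) \<otimes> x) -` B))"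
    using B by (simp add: emeasure_nu translate_vimage_sets vimage_def m_assoc)
  also have "\<dots> = (\<Sum>e\<in>D. emeasure \<mu> ((\<lambda>x. e \<otimes> x) -` B))"
    by (rule sum.reindex_bij_betw[OF bij_betw_mult_D[OF d]])
  finally show ?thesis using B by (simp add: emeasure_nu)
qed

lemma distr_nu_translate: "d \<in> D \<Longrightarrow> distr nu nu (\<lambda>x. d \<otimes> x) = nu"
  by (rule measure_eqI) (simp_all add: emeasure_distr nu_translate)

lemma nn_integral_nu_translate:
  assumes "d \<in> D" "f \<in> borel_measurable borel"
  shows "(\<integral>\<^sup>+x. f (d \<otimes> x) \<partial>nu) = (\<integral>\<^sup>+x. f x \<partial>nu)"
proof -
  have "(\<integral>\<^sup>+x. f x \<partial>nu) = (\<integral>\<^sup>+x. f x \<partial>distr nu nu (\<lambda>x. d \<otimes> x))"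
    by (simp add: distr_nu_translate assms(1))
  also have "\<dots> = (\<integral>\<^sup>+x. f (d \<otimes> x) \<partial>nu)"
    using assms(2) by (intro nn_integral_distr) simp_all
  finally show ?thesis by simp
qed

lemma AE_nu_translate:
  assumes "d \<in> D" "AE x in nu. P x"
  shows "AE x in nu. P (d \<otimes> x)"
  by (rule AE_comp_preserving[OF _ _ assms(2)]) (simp_all add: nu_translate assms(1))

lemma AE_nu_translate_all:
  assumes "AE x in nu. P x"
  shows "AE x in nu. \<forall>d\<in>D. P (d \<otimes> x)"
  by (rule AE_finite_allI[OF finite_D]) (rule AE_nu_translate[OF _ assms])

lemma mu_le_nu:
  assumes "B \<in> sets borel"
  shows "emeasure \<mu> B \<le> emeasure nu B"
proof -
  have "emeasure \<mu> ((\<lambda>x. \<one> \<otimes> x) -` B) \<le> (\<Sum>d\<in>D. emeasure \<mu> ((\<lambda>x. d \<otimes> x) -` B))"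
    by (rule member_le_sum[OF one_D]) (simp_all add: finite_D)
  then show ?thesis using assms by (simp add: emeasure_nu)
qed

lemma absolutely_continuous_nu: "absolutely_continuous nu \<mu>"
proof -
  have "B \<in> null_sets \<mu>" if "B \<in> null_sets nu" for B
    using mu_le_nu[of B] that by (simp add: null_sets_def)
  then show ?thesis by (auto simp: absolutely_continuous_def)
qed

lemma AE_nu_imp_AE: "AE x in nu. P x \<Longrightarrow> AE x in \<mu>. P x"
  by (rule absolutely_continuous_AE[OF _ absolutely_continuous_nu]) simp

text \<open>Up to null sets, \<open>rho (d \<otimes> x)\<close> is the conditional probability of
  the point \<open>d \<otimes> x\<close> within the coset of \<open>x\<close>. The density thus
  stands in for a disintegration: on each coset it takes finitely many values, each measurable in
  \<open>x\<close>.\<close>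

definition rho :: "'a config \<Rightarrow> ennreal" where
  "rho = RN_deriv nu \<mu>"

lemma rho_measurable [measurable]: "rho \<in> borel_measurable borel"
  using borel_measurable_RN_deriv[of nu \<mu>] by (simp add: rho_def cong: measurable_cong_sets)

lemma density_rho: "density nu rho = \<mu>"
proof -
  interpret n: finite_measure nu by (rule finite_measure_nu)
  show ?thesis unfolding rho_def
    by (rule n.density_RN_deriv[OF absolutely_continuous_nu]) simp
qed

lemma emeasure_mu_rho: "B \<in> sets borel \<Longrightarrow> emeasure \<mu> B = (\<integral>\<^sup>+x. rho x * indicator B x \<partial>nu)"
  using emeasure_density[of rho nu B] by (simp add: density_rho)

text \<open>Translations by \<open>D\<close> preserve the null sets of \<open>nu\<close>, but
  possibly not those of \<open>\<mu>\<close>. Statements are therefore moved to \<open>nu\<close>,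
  guarded by \<open>0 < rho x\<close>, translated there and moved back.\<close>

lemma AE_mu_iff: "(AE x in \<mu>. P x) \<longleftrightarrow> (AE x in nu. 0 < rho x \<longrightarrow> P x)"
  using AE_density[of rho nu P] unfolding density_rho by simp

lemma AE_rho_pos: "AE x in \<mu>. 0 < rho x"
  by (simp add: AE_mu_iff)

definition supp :: "'a config \<Rightarrow> 'a config set" where
  "supp x = {d \<in> D. 0 < rho (d \<otimes> x)}"

text \<open>Demanding equality along the whole coset makes this a subgroup, constant on the coset,
  at every point and not just almost everywhere.\<close>

definition stab :: "'a config \<Rightarrow> 'a config set" where
  "stab x = {h \<in> D. \<forall>d\<in>D. rho (h \<otimes> (d \<otimes> x)) = rho (d \<otimes> x)}"

lemma supp_subset: "supp x \<subseteq> D" and stab_subset: "stab x \<subseteq> D"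
  by (auto simp: supp_def stab_def)

lemma finite_supp: "finite (supp x)" and finite_stab: "finite (stab x)"
  using finite_subset[OF supp_subset finite_D] finite_subset[OF stab_subset finite_D] by auto

lemma AE_on_supp:
  assumes "AE x in \<mu>. P x"
  shows "AE x in \<mu>. \<forall>d\<in>supp x. P (d \<otimes> x)"
proof -
  have "AE x in nu. \<forall>d\<in>D. 0 < rho (d \<otimes> x) \<longrightarrow> P (d \<otimes> x)"
    using assms by (intro AE_nu_translate_all) (simp add: AE_mu_iff)
  from AE_nu_imp_AE[OF this] show ?thesis by eventually_elim (simp add: supp_def)
qed

lemma subgroup_stab: "subgroup (stab x) G"
proof (rule subgroupI)
  show "stab x \<noteq> {}" using one_D by (auto simp: stab_def)
  show "inv h \<in> stab x" if "h \<in> stab x" for h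
  proof -
    have "rho (inv h \<otimes> (d \<otimes> x)) = rho (d \<otimes> x)" if "d \<in> D" for d
    proof -
      have "inv h \<otimes> d \<in> D" using \<open>h \<in> stab x\<close> that by (auto simp: stab_def intro: mult_D inv_D)
      then have "rho (h \<otimes> ((inv h \<otimes> d) \<otimes> x)) = rho ((inv h \<otimes> d) \<otimes> x)"
        using \<open>h \<in> stab x\<close> unfolding stab_def by blast
      then show ?thesis by (simp add: m_assoc)
    qed
    then show ?thesis using that by (simp add: stab_def inv_D)
  qed
  show "h \<otimes> k \<in> stab x" if "h \<in> stab x" "k \<in> stab x" for h k
  proof -
    have hk: "h \<in> D" "k \<in> D" using that by (auto simp: stab_def)
    have "rho (h \<otimes> k \<otimes> (d \<otimes> x)) = rho (d \<otimes> x)" if "d \<in> D" for d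
    proof -
      have "k \<otimes> d \<in> D" using that hk by (auto intro: mult_D)
      then have "rho (h \<otimes> ((k \<otimes> d) \<otimes> x)) = rho ((k \<otimes> d) \<otimes> x)"
        using \<open>h \<in> stab x\<close> unfolding stab_def by blast
      also have "\<dots> = rho (d \<otimes> x)"
        using \<open>k \<in> stab x\<close> that unfolding stab_def by (simp add: m_assoc)
      finally show ?thesis by (simp add: m_assoc)
    qed
    then show ?thesis using hk by (simp add: stab_def mult_D)
  qed
qed simp

lemma stab_translate:
  assumes "e \<in> D"
  shows "stab (e \<otimes> x) = stab x"
proof -
  have "(\<forall>d\<in>D. rho (h \<otimes> (d \<otimes> (e \<otimes> x))) = rho (d \<otimes> (e \<otimes> x))) \<longleftrightarrow>
      (\<forall>d\<in>D. rho (h \<otimes> (d \<otimes> x)) = rho (d \<otimes> x))" for h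
  proof
    assume r: "\<forall>d\<in>D. rho (h \<otimes> (d \<otimes> (e \<otimes> x))) = rho (d \<otimes> (e \<otimes> x))"
    show "\<forall>d\<in>D. rho (h \<otimes> (d \<otimes> x)) = rho (d \<otimes> x)"
    proof
      fix d assume "d \<in> D"
      then have "d \<otimes> inv e \<in> D" using assms by (intro mult_D inv_D)
      from r[rule_format, OF this] show "rho (h \<otimes> (d \<otimes> x)) = rho (d \<otimes> x)" by (simp add: m_assoc)
    qed
  next
    assume r: "\<forall>d\<in>D. rho (h \<otimes> (d \<otimes> x)) = rho (d \<otimes> x)"
    show "\<forall>d\<in>D. rho (h \<otimes> (d \<otimes> (e \<otimes> x))) = rho (d \<otimes> (e \<otimes> x))"
    proof
      fix d assume "d \<in> D"
      then have "d \<otimes> e \<in> D" using assms by (intro mult_D)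
      from r[rule_format, OF this] show "rho (h \<otimes> (d \<otimes> (e \<otimes> x))) = rho (d \<otimes> (e \<otimes> x))"
        by (simp add: m_assoc)
    qed
  qed
  then show ?thesis by (simp add: stab_def)
qed

lemma stab_subset_supp: "0 < rho x \<Longrightarrow> stab x \<subseteq> supp x"
proof
  fix h assume "0 < rho x" "h \<in> stab x"
  then have "rho (h \<otimes> (\<one> \<otimes> x)) = rho (\<one> \<otimes> x)" "h \<in> D" using one_D unfolding stab_def by blast+
  with \<open>0 < rho x\<close> show "h \<in> supp x" by (simp add: supp_def)
qed

lemma supp_measurable: "{x. d \<in> supp x} \<in> sets borel"
proof (cases "d \<in> D")
  case True
  have "{x \<in> space borel. 0 < rho (d \<otimes> x)} \<in> sets borel" by measurable
  with True show ?thesis by (simp add: supp_def)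
qed (simp add: supp_def)

lemma stab_measurable: "{x. h \<in> stab x} \<in> sets borel"
proof (cases "h \<in> D")
  case True
  have "{x. h \<in> stab x} = (\<Inter>d\<in>D. {x \<in> space borel. rho (h \<otimes> (d \<otimes> x)) = rho (d \<otimes> x)})"
    using True by (auto simp: stab_def)
  also have "\<dots> \<in> sets borel"
  proof (rule sets.finite_INT[OF finite_D])
    show "D \<noteq> {}" using one_D by auto
    show "{x \<in> space borel. rho (h \<otimes> (d \<otimes> x)) = rho (d \<otimes> x)} \<in> sets borel" for d by measurable
  qed
  finally show ?thesis .
qed (simp add: stab_def)

text \<open>Together with the converse \<open>stab_if_mu_invariant_on\<close>, this expresses
  membership in \<open>stab\<close> by invariance of \<open>\<mu>\<close> restricted to a saturated
  set. That form does not mention the density, so it can be compared for different kernels and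
  transported by \<open>F\<close>.\<close>

lemma mu_invariant_on:
  assumes h: "h \<in> D" and C: "C \<in> sets borel" "\<And>x. h \<otimes> x \<in> C \<longleftrightarrow> x \<in> C"
    and st: "AE x in \<mu>. x \<in> C \<longrightarrow> h \<in> stab x" and B: "B \<in> sets borel"
  shows "emeasure \<mu> (C \<inter> (\<lambda>x. h \<otimes> x) -` B) = emeasure \<mu> (C \<inter> B)"
proof -
  note [measurable] = C(1) B
  have st': "AE x in nu. 0 < rho x \<longrightarrow> x \<in> C \<longrightarrow> h \<in> stab x" using st by (simp add: AE_mu_iff)
  have eq: "AE x in nu. x \<in> C \<longrightarrow> rho (h \<otimes> x) = rho x"
    using st' AE_nu_translate[OF h st']
  proof eventually_elim
    case (elim x)
    show ?case
    proof
      assume x: "x \<in> C"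
      \<comment> \<open>The hypothesis speaks only of points charged by \<open>\<mu>\<close>. If
        only \<open>h \<otimes> x\<close> is charged, it is used there, \<open>stab\<close> being
        constant on cosets.\<close>
      consider "0 < rho x" | "0 < rho (h \<otimes> x)" | "rho x = 0 \<and> rho (h \<otimes> x) = 0"
        using not_gr_zero by blast
      then show "rho (h \<otimes> x) = rho x"
      proof cases
        case 1
        then have "h \<in> stab x" using elim(1) x by blast
        then have "rho (h \<otimes> (\<one> \<otimes> x)) = rho (\<one> \<otimes> x)" using one_D unfolding stab_def by blast
        then show ?thesis by simp
      next
        case 2
        then have "h \<in> stab (h \<otimes> x)" using elim(2) x C(2) by blast
        then have "h \<in> stab x" by (simp add: stab_translate[OF h])
        then have "rho (h \<otimes> (\<one> \<otimes> x)) = rho (\<one> \<otimes> x)" using one_D unfolding stab_def by blast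
        then show ?thesis by simp
      qed simp
    qed
  qed
  have hB: "(\<lambda>x. h \<otimes> x) -` B \<in> sets borel" by (rule translate_vimage_sets[OF B])
  have "emeasure \<mu> (C \<inter> (\<lambda>x. h \<otimes> x) -` B) = (\<integral>\<^sup>+x. rho x * indicator (C \<inter> (\<lambda>x. h \<otimes> x) -` B) x \<partial>nu)"
    using C(1) hB by (intro emeasure_mu_rho sets.Int)
  also have "\<dots> = (\<integral>\<^sup>+x. rho (h \<otimes> x) * indicator (C \<inter> B) (h \<otimes> x) \<partial>nu)"
    using eq by (intro nn_integral_cong_AE, eventually_elim) (simp split: split_indicator add: C(2))
  also have "\<dots> = (\<integral>\<^sup>+x. rho x * indicator (C \<inter> B) x \<partial>nu)"
    by (rule nn_integral_nu_translate[OF h]) measurable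
  also have "\<dots> = emeasure \<mu> (C \<inter> B)"
    using C(1) B by (intro emeasure_mu_rho[symmetric] sets.Int)
  finally show ?thesis .
qed

lemma nu_density_unique:
  assumes [measurable]: "f \<in> borel_measurable borel" "g \<in> borel_measurable borel"
    and fin: "(\<integral>\<^sup>+x. f x \<partial>nu) \<noteq> \<infinity>"
    and eq: "\<And>B. B \<in> sets borel \<Longrightarrow> (\<integral>\<^sup>+x. f x * indicator B x \<partial>nu) = (\<integral>\<^sup>+x. g x * indicator B x \<partial>nu)"
  shows "AE x in nu. f x = g x"
proof (rule finite_density_unique[THEN iffD1, OF _ _ _ _ fin])
  show "density nu f = density nu g"
    by (rule measure_eqI) (simp_all add: emeasure_density eq)
qed (use assms in simp_all)

lemma stab_if_mu_invariant_on:
  assumes h: "h \<in> D" and C: "C \<in> sets borel" "\<And>d x. d \<in> D \<Longrightarrow> d \<otimes> x \<in> C \<longleftrightarrow> x \<in> C"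
    and inv: "\<And>B. B \<in> sets borel \<Longrightarrow> emeasure \<mu> (C \<inter> (\<lambda>x. h \<otimes> x) -` B) = emeasure \<mu> (C \<inter> B)"
  shows "AE x in \<mu>. x \<in> C \<longrightarrow> h \<in> stab x"
proof -
  note [measurable] = C(1)
  have "AE x in nu. rho x * indicator C x = rho (h \<otimes> x) * indicator C x"
  proof (rule nu_density_unique)
    have "(\<integral>\<^sup>+x. rho x * indicator C x \<partial>nu) = emeasure \<mu> C" using emeasure_mu_rho[OF C(1)] by simp
    then show "(\<integral>\<^sup>+x. rho x * indicator C x \<partial>nu) \<noteq> \<infinity>" by (simp add: emeasure_eq_measure)
    fix B :: "'a config set" assume B[measurable]: "B \<in> sets borel"
    \<comment> \<open>Pulled back by the inverse: the given invariance replaces \<open>B\<close> by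
      \<open>?B\<close>, and the substitution \<open>x \<mapsto> h \<otimes> x\<close> restores
      \<open>B\<close> while moving the argument of the density.\<close>
    let ?B = "(\<lambda>x. inv h \<otimes> x) -` B"
    have hB[measurable]: "?B \<in> sets borel" by (rule translate_vimage_sets[OF B])
    have "(\<integral>\<^sup>+x. rho x * indicator C x * indicator B x \<partial>nu) = emeasure \<mu> (C \<inter> B)"
      using emeasure_mu_rho[of "C \<inter> B"] C(1) B
      by (simp add: indicator_inter_arith mult.assoc)
    also have "C \<inter> B = C \<inter> (\<lambda>x. h \<otimes> x) -` ?B" by auto
    also have "emeasure \<mu> \<dots> = emeasure \<mu> (C \<inter> ?B)" by (rule inv[OF hB])
    also have "\<dots> = (\<integral>\<^sup>+x. rho x * indicator (C \<inter> ?B) x \<partial>nu)"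
      by (intro emeasure_mu_rho sets.Int C(1) hB)
    also have "\<dots> = (\<integral>\<^sup>+x. rho (h \<otimes> x) * indicator (C \<inter> ?B) (h \<otimes> x) \<partial>nu)"
      by (rule nn_integral_nu_translate[OF h, symmetric]) measurable
    also have "\<dots> = (\<integral>\<^sup>+x. rho (h \<otimes> x) * indicator C x * indicator B x \<partial>nu)"
      by (intro nn_integral_cong) (simp split: split_indicator add: C(2)[OF h])
    finally show "(\<integral>\<^sup>+x. rho x * indicator C x * indicator B x \<partial>nu) =
      (\<integral>\<^sup>+x. rho (h \<otimes> x) * indicator C x * indicator B x \<partial>nu)" .
  qed measurable
  then have "AE x in nu. x \<in> C \<longrightarrow> rho (h \<otimes> x) = rho x"
    by eventually_elim (simp split: split_indicator_asm)
  from AE_nu_imp_AE[OF AE_nu_translate_all[OF this]] show ?thesis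
    by eventually_elim (simp add: stab_def h C(2))
qed

section \<open>Shift invariance of the conditional measures\<close>

context
  assumes shift_D: "shift ` D = D" and shift_mu: "invariant_measure shift \<mu>"
begin

lemma shift_in_D: "d \<in> D \<Longrightarrow> shift d \<in> D"
  using imageI[of d D shift] by (simp only: shift_D)

lemma shift_preimage_D:
  assumes "d \<in> D"
  obtains e where "e \<in> D" "d = shift e"
proof -
  from assms have "d \<in> shift ` D" by (simp only: shift_D)
  then show thesis by (rule imageE) (rule that)
qed

lemma bij_betw_shift_D: "bij_betw shift D D"
  using shift_D inj_shift by (auto simp: bij_betw_def intro: inj_on_subset)

lemma nu_shift:
  assumes B: "B \<in> sets borel"
  shows "emeasure nu (shift -` B) = emeasure nu B"
proof -
  have sB: "shift -` B \<in> sets borel" using measurable_sets[OF measurable_shift B] by simp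
  have "emeasure nu (shift -` B) = (\<Sum>d\<in>D. emeasure \<mu> (shift -` ((\<lambda>x. shift d \<otimes> x) -` B)))"
    using sB by (simp add: emeasure_nu vimage_def shift_mult)
  also have "\<dots> = (\<Sum>d\<in>D. emeasure \<mu> ((\<lambda>x. shift d \<otimes> x) -` B))"
    using shift_mu translate_vimage_sets[OF B] by (simp add: invariant_measure_def)
  also have "\<dots> = (\<Sum>d\<in>D. emeasure \<mu> ((\<lambda>x. d \<otimes> x) -` B))"
    by (rule sum.reindex_bij_betw[OF bij_betw_shift_D])
  finally show ?thesis using B by (simp add: emeasure_nu)
qed

text \<open>The shift permutes \<open>D\<close>, so it preserves \<open>nu\<close> as well as
  \<open>\<mu>\<close>, and the density is unique.\<close>

lemma AE_nu_rho_shift: "AE x in nu. rho (shift x) = rho x"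
proof -
  have d: "distr nu nu shift = nu"
    by (rule measure_eqI) (simp_all add: emeasure_distr nu_shift)
  have [measurable]: "(shift_int (- 1) :: 'a config \<Rightarrow> 'a config) \<in> borel_measurable borel"
  proof (rule borel_measurable_continuous_onI, subst continuous_config_iff, intro allI exI impI)
    fix x y :: "'a config" and M assume "agree (M + 1) x y"
    then show "agree M (shift_int (- 1) x) (shift_int (- 1) y)" by (auto simp: agree_def shift_int_def)
  qed
  have sh: "shift_int (- 1) (shift x) = x" "shift (shift_int (- 1) x) = x" for x :: "'a config"
    by (simp_all add: shift_def shift_int_def)
  have tr: "(\<integral>\<^sup>+x. f (shift x) \<partial>nu) = (\<integral>\<^sup>+x. f x \<partial>nu)" if "f \<in> borel_measurable borel" for f :: "'a config \<Rightarrow> ennreal"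
  proof -
    have "(\<integral>\<^sup>+x. f x \<partial>nu) = (\<integral>\<^sup>+x. f x \<partial>distr nu nu shift)" by (simp add: d)
    also have "\<dots> = (\<integral>\<^sup>+x. f (shift x) \<partial>nu)" using that by (intro nn_integral_distr) simp_all
    finally show ?thesis by simp
  qed
  show ?thesis
  proof (rule nu_density_unique)
    have "(\<integral>\<^sup>+x. rho x \<partial>nu) = emeasure \<mu> UNIV" using emeasure_mu_rho[of UNIV] by simp
    then show "(\<integral>\<^sup>+x. rho (shift x) \<partial>nu) \<noteq> \<infinity>" by (simp add: tr emeasure_eq_measure)
    fix B :: "'a config set" assume B[measurable]: "B \<in> sets borel"
    let ?B = "shift_int (- 1) -` B"
    have sB[measurable]: "?B \<in> sets borel" using measurable_sets[of "shift_int (- 1)" borel borel B] by simp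
    have "(\<integral>\<^sup>+x. rho (shift x) * indicator B x \<partial>nu) = (\<integral>\<^sup>+x. rho (shift x) * indicator ?B (shift x) \<partial>nu)"
      by (intro nn_integral_cong) (simp split: split_indicator add: sh)
    also have "\<dots> = (\<integral>\<^sup>+x. rho x * indicator ?B x \<partial>nu)" by (rule tr) measurable
    also have "\<dots> = emeasure \<mu> ?B" by (rule emeasure_mu_rho[OF sB, symmetric])
    also have "\<dots> = emeasure \<mu> (shift -` ?B)" using shift_mu sB by (simp add: invariant_measure_def)
    also have "shift -` ?B = B" by (auto simp: sh)
    also have "emeasure \<mu> B = (\<integral>\<^sup>+x. rho x * indicator B x \<partial>nu)" by (rule emeasure_mu_rho[OF B])
    finally show "(\<integral>\<^sup>+x. rho (shift x) * indicator B x \<partial>nu) = (\<integral>\<^sup>+x. rho x * indicator B x \<partial>nu)" .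
  qed measurable
qed

lemma AE_nu_shift: "AE x in nu. P x \<Longrightarrow> AE x in nu. P (shift x)"
  by (rule AE_comp_preserving) (simp_all add: nu_shift)

lemma AE_nu_rho_shift_funpow: "AE x in nu. rho ((shift ^^ n) x) = rho x"
proof (induction n)
  case (Suc n)
  from AE_nu_shift[OF Suc] AE_nu_rho_shift show ?case
    by eventually_elim (simp add: funpow_swap1)
qed simp

context
  fixes q :: nat
  assumes period: "\<And>d. d \<in> D \<Longrightarrow> (shift ^^ q) d = d"
    and inv_q: "inv_sets \<mu> (shift ^^ q) \<subseteq> inv_sets \<mu> shift"
begin

text \<open>As \<open>d\<close> has period \<open>q\<close>, replacing \<open>x\<close> by
  \<open>(shift ^^ q) x\<close> shifts the whole product \<open>d \<otimes> x\<close> and leaves the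
  density unchanged. The sublevel sets of \<open>rho (d \<otimes> x)\<close> are thus invariant
  under \<open>shift ^^ q\<close>, and by hypothesis under \<open>shift\<close>.\<close>

lemma AE_rho_translate_shift: "AE x in \<mu>. \<forall>d\<in>D. rho (d \<otimes> shift x) = rho (d \<otimes> x)"
proof (rule AE_finite_allI[OF finite_D])
  fix d assume d: "d \<in> D"
  note shift_q = T_funpow_measurable[OF sets_mu measurable_shift shift_mu, of q]
  have "AE x in nu. rho ((shift ^^ q) (d \<otimes> x)) = rho (d \<otimes> x)"
    by (rule AE_nu_translate[OF d AE_nu_rho_shift_funpow])
  then have q: "AE x in \<mu>. rho (d \<otimes> (shift ^^ q) x) = rho (d \<otimes> x)"
    by (rule AE_nu_imp_AE[OF eventually_mono]) (simp add: funpow_shift_mult period[OF d])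
  \<comment> \<open>Rational levels separate extended nonnegative reals, and there are only
    countably many of them.\<close>
  have "AE x in \<mu>. rho (d \<otimes> shift x) < ennreal (real_of_rat t) \<longleftrightarrow> rho (d \<otimes> x) < ennreal (real_of_rat t)" for t
  proof -
    let ?B = "{x \<in> space borel. rho (d \<otimes> x) < ennreal (real_of_rat t)}"
    have B: "?B \<in> sets borel" by measurable
    have "AE x in \<mu>. (shift ^^ q) x \<in> ?B \<longleftrightarrow> x \<in> ?B" using q by eventually_elim simp
    then have "?B \<in> inv_sets \<mu> (shift ^^ q)"
      using B inv_sets_iff[OF sets_mu measurable_shift shift_mu shift_q] by blast
    then have "?B \<in> inv_sets \<mu> shift" using inv_q by blast
    then have "AE x in \<mu>. shift x \<in> ?B \<longleftrightarrow> x \<in> ?B"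
      using inv_sets_iff[OF sets_mu measurable_shift shift_mu measurable_shift] by blast
    then show ?thesis by simp
  qed
  then have "AE x in \<mu>. \<forall>t. rho (d \<otimes> shift x) < ennreal (real_of_rat t) \<longleftrightarrow> rho (d \<otimes> x) < ennreal (real_of_rat t)"
    by (simp add: AE_all_countable)
  then show "AE x in \<mu>. rho (d \<otimes> shift x) = rho (d \<otimes> x)"
  proof eventually_elim
    case (elim x)
    have "\<not> a < b" if "\<And>t. a < ennreal (real_of_rat t) \<longleftrightarrow> b < ennreal (real_of_rat t)" for a b
    proof
      assume "a < b"
      then obtain t where "a < ennreal (real_of_rat t)" "ennreal (real_of_rat t) < b"
        using ennreal_rat_dense by blast
      with that[of t] show False by (meson less_asym)
    qed
    from this[of "rho (d \<otimes> shift x)" "rho (d \<otimes> x)"] this[of "rho (d \<otimes> x)" "rho (d \<otimes> shift x)"] elim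
    show ?case by (metis linorder_cases)
  qed
qed

lemma AE_stab_shift: "AE x in \<mu>. stab (shift x) = stab x"
  using AE_rho_translate_shift
proof eventually_elim
  case (elim x)
  have "rho (h \<otimes> (d \<otimes> shift x)) = rho (h \<otimes> (d \<otimes> x))" if "h \<in> D" "d \<in> D" for h d
    using bspec[OF elim mult_D[OF that]] by (simp add: m_assoc)
  with elim show ?case by (auto simp: stab_def)
qed

text \<open>Replacing \<open>x\<close> by \<open>shift x\<close> turns
  \<open>shift d \<otimes> x\<close> into the shift of \<open>d \<otimes> x\<close>; neither this
  change nor removing the outer shift affects the density. The conditional measure, viewed on
  \<open>D\<close>, is therefore shift-invariant.\<close>

lemma AE_rho_shift_translate: "AE x in \<mu>. \<forall>d\<in>D. rho (shift d \<otimes> x) = rho (d \<otimes> x)"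
  using AE_rho_translate_shift AE_nu_imp_AE[OF AE_nu_translate_all[OF AE_nu_rho_shift]]
proof eventually_elim
  case (elim x)
  show ?case
  proof
    fix d assume d: "d \<in> D"
    then have "shift d \<in> D" by (rule shift_in_D)
    then have "rho (shift d \<otimes> x) = rho (shift d \<otimes> shift x)" using elim(1) by simp
    also have "\<dots> = rho (d \<otimes> x)" using elim(2) d by (simp add: shift_mult)
    finally show "rho (shift d \<otimes> x) = rho (d \<otimes> x)" .
  qed
qed

lemma AE_shift_stab: "AE x in \<mu>. shift ` stab x \<subseteq> stab x"
  using AE_rho_shift_translate
proof eventually_elim
  case (elim x)
  show ?case
  proof (rule image_subsetI)
    fix h assume h: "h \<in> stab x"
    then have hD: "h \<in> D" by (simp add: stab_def)
    have "rho (shift h \<otimes> (d \<otimes> x)) = rho (d \<otimes> x)" if "d \<in> D" for d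
    proof -
      obtain e where e: "e \<in> D" "d = shift e" by (rule shift_preimage_D[OF \<open>d \<in> D\<close>])
      have "rho (shift h \<otimes> (d \<otimes> x)) = rho (shift (h \<otimes> e) \<otimes> x)" by (simp add: e shift_mult m_assoc)
      also have "\<dots> = rho (h \<otimes> (e \<otimes> x))" using elim mult_D[OF hD e(1)] by (simp add: m_assoc)
      also have "\<dots> = rho (e \<otimes> x)" using h e(1) by (simp add: stab_def)
      also have "\<dots> = rho (d \<otimes> x)" using elim e by simp
      finally show ?thesis .
    qed
    moreover have "shift h \<in> D" by (rule shift_in_D[OF hD])
    ultimately show "shift h \<in> stab x" by (simp add: stab_def)
  qed
qed

text \<open>
  The fibre measure is invariant under \<open>\<sigma>\<close> seen from \<open>x\<close> and also seen from \<open>d \<otimes> x\<close>; the two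
  conjugates of \<open>\<sigma>\<close> differ by a translation.
\<close>

lemma AE_stab_diff: "AE x in \<mu>. \<forall>d\<in>supp x. inv (shift d) \<otimes> d \<in> stab x"
  using AE_rho_shift_translate AE_on_supp[OF AE_rho_shift_translate]
proof eventually_elim
  case (elim x)
  show ?case
  proof
    fix d assume d: "d \<in> supp x"
    then have dD: "d \<in> D" using supp_subset by blast
    then have sd: "shift d \<in> D" by (rule shift_in_D)
    let ?h = "inv (shift d) \<otimes> d"
    have hD: "?h \<in> D" using dD sd by (intro mult_D inv_D)
    have "rho (?h \<otimes> (f \<otimes> x)) = rho (f \<otimes> x)" if f: "f \<in> D" for f
    proof -
      obtain e where e: "e \<in> D" "f = shift e" using f by (rule shift_preimage_D)
      have ie: "inv d \<otimes> e \<in> D" using dD e(1) by (intro mult_D inv_D)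
      have "?h \<otimes> (f \<otimes> x) = shift (inv d \<otimes> e) \<otimes> (d \<otimes> x)"
        by (simp add: e shift_mult shift_inv m_ac)
      then have "rho (?h \<otimes> (f \<otimes> x)) = rho (shift (inv d \<otimes> e) \<otimes> (d \<otimes> x))" by simp
      also have "\<dots> = rho ((inv d \<otimes> e) \<otimes> (d \<otimes> x))" using elim(2) d ie by blast
      also have "(inv d \<otimes> e) \<otimes> (d \<otimes> x) = e \<otimes> x" 
        using m_lcomm[of d "inv d" "e \<otimes> x"] by (simp add: m_ac)
      also have "rho (e \<otimes> x) = rho (f \<otimes> x)" using elim(1) e by simp
      finally show ?thesis .
    qed
    with hD show "?h \<in> stab x" by (simp add: stab_def)
  qed
qed

text \<open>The map of \<open>AE_stab_diff\<close> sends the support into the stabiliser, and two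
  elements with the same image differ by a shift-fixed configuration.\<close>

lemma AE_card_supp_le: "AE x in \<mu>. card (supp x) \<le> CARD('a) * card (stab x)"
  using AE_stab_diff
proof eventually_elim
  case (elim x)
  let ?g = "\<lambda>d. inv (shift d) \<otimes> d"
  have fib: "card {d \<in> supp x. ?g d = b} \<le> CARD('a)" for b
  proof (cases "{d \<in> supp x. ?g d = b} = {}")
    case False
    then obtain d0 where d0: "?g d0 = b" by blast
    let ?F = "{z :: 'a config. shift z = z}"
    have "{d \<in> supp x. ?g d = b} \<subseteq> (\<lambda>z. d0 \<otimes> z) ` ?F"
    proof
      fix d assume "d \<in> {d \<in> supp x. ?g d = b}"
      then have e: "inv (shift d) \<otimes> d = inv (shift d0) \<otimes> d0" using d0 by simp
      have "shift (inv d0 \<otimes> d) = inv d0 \<otimes> d"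
      proof -
        have "shift (inv d0 \<otimes> d) = inv (shift d0) \<otimes> (d0 \<otimes> inv d0) \<otimes> shift d" by (simp add: shift_mult shift_inv)
        also have "\<dots> = (inv (shift d0) \<otimes> d0) \<otimes> (inv d0 \<otimes> shift d)" by (simp only: m_ac carrier_UNIV UNIV_I)
        also have "\<dots> = (inv (shift d) \<otimes> d) \<otimes> (inv d0 \<otimes> shift d)" by (simp only: e)
        also have "\<dots> = (inv (shift d) \<otimes> shift d) \<otimes> (inv d0 \<otimes> d)" by (simp only: m_ac carrier_UNIV UNIV_I)
        finally show ?thesis by simp
      qed
      moreover have "d = d0 \<otimes> (inv d0 \<otimes> d)" by simp
      ultimately show "d \<in> (\<lambda>z. d0 \<otimes> z) ` ?F" by blast
    qed
    then have "card {d \<in> supp x. ?g d = b} \<le> card ((\<lambda>z. d0 \<otimes> z) ` ?F)"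
      using shift_fixed_points(1) by (intro card_mono) auto
    also have "\<dots> \<le> card ?F" by (rule card_image_le[OF shift_fixed_points(1)])
    also have "\<dots> \<le> CARD('a)" by (rule shift_fixed_points(2))
    finally show ?thesis .
  next
    case True
    then show ?thesis by (simp only: card.empty)
  qed
  have "supp x = (\<Union>b\<in>stab x. {d \<in> supp x. ?g d = b})" using elim by blast
  then have "card (supp x) = card (\<Union>b\<in>stab x. {d \<in> supp x. ?g d = b})" by (rule arg_cong)
  also have "\<dots> \<le> (\<Sum>b\<in>stab x. card {d \<in> supp x. ?g d = b})"
    by (rule card_UN_le[OF finite_stab])
  also have "\<dots> \<le> (\<Sum>b\<in>stab x. CARD('a))" by (rule sum_mono) (rule fib)
  finally show ?case by (simp add: mult.commute)
qed

end

end

end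


section \<open>The kernels of the iterates\<close>

lemma common_period_exists:
  assumes fin: "finite X" and inj: "inj f" and sub: "f ` X \<subseteq> X"
  shows "\<exists>p>0. \<forall>x\<in>X. (f ^^ p) x = x"
proof -
  have ex: "\<exists>p>0. (f ^^ p) x = x" if x: "x \<in> X" for x
  proof -
    have "(f ^^ i) x \<in> X" for i using sub x by (induction i) auto
    then have "finite (range (\<lambda>i. (f ^^ i) x))" using finite_subset[OF _ fin] by (meson image_subsetI)
    then have "\<not> inj (\<lambda>i::nat. (f ^^ i) x)" using finite_imageD infinite_UNIV_nat by blast
    then obtain i j where ij: "(f ^^ i) x = (f ^^ j) x" "i < j"
      using linorder_injI[of "\<lambda>i. (f ^^ i) x"] by blast
    have "(f ^^ (i + (j - i))) x = (f ^^ i) x" using ij by simp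
    then have "(f ^^ i) ((f ^^ (j - i)) x) = (f ^^ i) x" unfolding funpow_add comp_def .
    then have "(f ^^ (j - i)) x = x" by (rule injD[OF inj_fn[OF inj]])
    then show ?thesis using ij(2) by (intro exI[of _ "j - i"]) simp
  qed
  then obtain P where P: "\<And>x. x \<in> X \<Longrightarrow> 0 < P x \<and> (f ^^ P x) x = x" by metis
  have mult: "(f ^^ (c * k)) x = x" if "(f ^^ k) x = x" for c k x
    using that by (induction c) (simp_all add: funpow_add)
  have "(f ^^ (\<Prod>x\<in>X. P x)) x = x" if "x \<in> X" for x
  proof -
    have "(\<Prod>x\<in>X. P x) = (\<Prod>y\<in>X - {x}. P y) * P x"
      using prod.remove[OF fin that, of P] by (simp add: mult.commute)
    then show ?thesis using mult P[OF that] by simp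
  qed
  moreover have "0 < (\<Prod>x\<in>X. P x)" using P by (intro prod_pos) auto
  ultimately show ?thesis by blast
qed

lemma (in config_group) pow_card_subgroup:
  assumes D: "subgroup D G" and fin: "finite D" and e: "e \<in> D"
  shows "e [^] card D = \<one>"
proof -
  interpret S: group "G\<lparr>carrier := D\<rparr>" by (rule subgroup.subgroup_is_group[OF D is_group])
  have "e [^]\<^bsub>G\<lparr>carrier := D\<rparr>\<^esub> order (G\<lparr>carrier := D\<rparr>) = \<one>\<^bsub>G\<lparr>carrier := D\<rparr>\<^esub>"
    by (rule S.pow_order_eq_1) (use fin e in simp_all)
  then show ?thesis by (simp add: order_def nat_pow_consistent[symmetric])
qed

lemma shift_int_of_nat: "shift_int (int n) = shift ^^ n"
  by (rule ext) (simp add: shift_funpow shift_int_def)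

lemma shift_int_minus: "shift_int m (shift_int (- m) x) = x" "shift_int (- m) (shift_int m x) = x"
  by (simp_all add: shift_int_def)

locale rigid_system = config_group G for G :: "('a::{finite,discrete_topology} config) monoid" (structure) +
  fixes F :: "'a config \<Rightarrow> 'a config" and \<Sigma> :: "'a config set" and \<mu> :: "'a config measure"
    and k :: nat and r s :: int
  assumes F_mult: "F (x \<otimes> y) = F x \<otimes> F y"
    and continuous_F: "continuous_on UNIV F"
    and F_shift: "F (shift x) = shift (F x)"
    and biperm_F: "biperm r s F" and r_less_s: "r < s"
    and subgroup_Sigma: "subgroup \<Sigma> G"
    and k: "\<And>p. p \<in> prime_factors (CARD('a)) \<Longrightarrow> p dvd k"
    and borel_prob: "borel_prob \<mu>"
    and F_invariant: "invariant_measure F \<mu>" and shift_invariant: "invariant_measure shift \<mu>"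
    and AE_Sigma: "AE x in \<mu>. x \<in> \<Sigma>"
    and inv_sets_eq: "inv_sets \<mu> shift = inv_sets \<mu> (shift ^^ (k * smallest_common_period {x. F x = \<one>}))"
begin

sublocale prob_space \<mu>
  using borel_prob by (simp add: borel_prob_def)

lemma sets_mu [simp, measurable_cong]: "sets \<mu> = sets borel"
  using borel_prob by (simp add: borel_prob_def)

lemma space_mu [simp]: "space \<mu> = UNIV"
  using sets_eq_imp_space_eq[OF sets_mu] by simp

lemma measurable_F [measurable]: "F \<in> borel_measurable borel"
  by (rule borel_measurable_continuous_onI[OF continuous_F])

lemma AE_invariant:
  assumes "T \<in> borel_measurable borel" "invariant_measure T \<mu>" "AE x in \<mu>. P x"
  shows "AE x in \<mu>. P (T x)"
  by (rule AE_comp_preserving[OF _ _ assms(3)]) (use assms(1,2) in \<open>simp_all add: invariant_measure_def\<close>)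

lemmas AE_F = AE_invariant[OF measurable_F F_invariant]
lemmas AE_shift = AE_invariant[OF measurable_shift shift_invariant]

lemma F_one: "F \<one> = \<one>"
  using F_mult[of \<one> \<one>] by (simp add: l_cancel_one)

lemma F_inv: "F (inv x) = inv (F x)"
  using F_mult[of "inv x" x] by (simp add: F_one inv_equality)

lemma funpow_F_mult: "(F ^^ n) (x \<otimes> y) = (F ^^ n) x \<otimes> (F ^^ n) y"
  by (induction n) (simp_all add: F_mult)

lemma funpow_F_one: "(F ^^ n) \<one> = \<one>"
  by (induction n) (simp_all add: F_one)

lemma funpow_F_inv: "(F ^^ n) (inv x) = inv ((F ^^ n) x)"
  by (induction n) (simp_all add: F_inv)

lemma funpow_F_shift: "(F ^^ n) (shift x) = shift ((F ^^ n) x)"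
  by (induction n) (simp_all add: F_shift)

lemma F_funpow_shift: "F ((shift ^^ n) x) = (shift ^^ n) (F x)"
  by (induction n) (simp_all add: F_shift)

definition D :: "nat \<Rightarrow> 'a config set" where
  "D n = {x. (F ^^ n) x = \<one>}"

lemma finite_D: "finite (D n)" and card_D: "card (D n) = CARD('a) ^ nat (int n * s - int n * r)"
  unfolding D_def using card_fibre[OF biperm_funpow[OF biperm_F, of n], of \<one>] by blast+

lemma subgroup_D: "subgroup (D n) G"
  by (rule subgroupI) (auto simp: D_def funpow_F_mult funpow_F_inv funpow_F_one intro!: exI[of _ \<one>])

sublocale ft: finite_translations G \<mu> "D n" for n
  by (intro finite_translations.intro finite_translations_axioms.intro config_group_axioms borel_prob
      subgroup_D finite_D)

abbreviation "rho n \<equiv> finite_translations.rho G \<mu> (D n)"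
abbreviation "supp n \<equiv> finite_translations.supp G \<mu> (D n)"
abbreviation "stab n \<equiv> finite_translations.stab G \<mu> (D n)"

lemma D_Suc_subset: "D n \<subseteq> D (Suc n)"
  by (auto simp: D_def F_one)

lemma D_mono: "m \<le> n \<Longrightarrow> D m \<subseteq> D n"
  by (rule lift_Suc_mono_le[of D]) (rule D_Suc_subset)

lemma D_0: "D 0 = {\<one>}" and D_1: "D (Suc 0) = {x. F x = \<one>}"
  by (auto simp: D_def)

lemma F_D: "d \<in> D (Suc n) \<Longrightarrow> F d \<in> D n"
  by (simp add: D_def funpow_swap1)

lemma shift_image_D: "shift ` D n = D n"
proof (rule endo_inj_surj[OF finite_D])
  show "shift ` D n \<subseteq> D n" by (auto simp: D_def funpow_F_shift shift_one)
  show "inj_on shift (D n)" using inj_shift by (rule inj_on_subset) simp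
qed

definition p1 :: nat where
  "p1 = smallest_common_period {x. F x = \<one>}"

lemma p1_pos: "0 < p1" and p1_period: "d \<in> D (Suc 0) \<Longrightarrow> (shift ^^ p1) d = d"
proof -
  have "\<exists>p>0. \<forall>x\<in>D (Suc 0). (shift ^^ p) x = x"
    by (rule common_period_exists[OF finite_D inj_shift]) (simp add: shift_image_D)
  from LeastI_ex[OF this] have "0 < p1 \<and> (\<forall>x\<in>D (Suc 0). (shift ^^ p1) x = x)"
    unfolding p1_def smallest_common_period_def D_1 .
  then show "0 < p1" "d \<in> D (Suc 0) \<Longrightarrow> (shift ^^ p1) d = d" by blast+
qed

text \<open>A common period of \<open>D n\<close>, not the least one. What matters is that its
  primes come from \<open>p1\<close> and from \<open>CARD('a)\<close>, of which the order of the
  first kernel is a power.\<close>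

definition kernel_period :: "nat \<Rightarrow> nat" where
  "kernel_period n = p1 * card (D (Suc 0)) ^ n"

text \<open>Since \<open>F d\<close> lies in \<open>D n\<close>, the period found for
  \<open>D n\<close> moves \<open>d\<close> by an element \<open>e\<close> of the first kernel. That
  power of the shift fixes \<open>e\<close>, its exponent being a multiple of \<open>p1\<close>.
  Repetition multiplies \<open>d\<close> by powers of \<open>e\<close>, which return to the unit
  after as many steps as the first kernel has elements.\<close>

lemma shift_kernel_period: "d \<in> D n \<Longrightarrow> (shift ^^ kernel_period n) d = d"
proof (induction n arbitrary: d)
  case 0
  then have "d = \<one>" by (simp add: D_0)
  moreover have "(shift ^^ m) \<one> = \<one>" for m by (induction m) (simp_all add: shift_one)
  ultimately show ?case by simp
next
  case (Suc n)
  let ?S = "shift ^^ kernel_period n" and ?m = "card (D (Suc 0))"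
  define e where "e = ?S d \<otimes> inv d"
  have "F e = ?S (F d) \<otimes> inv (F d)" by (simp add: e_def F_mult F_inv F_funpow_shift)
  then have e1: "e \<in> D (Suc 0)" using Suc.IH[OF F_D[OF Suc.prems]] by (simp add: D_1)
  have Se: "?S e = e"
  proof -
    have "(shift ^^ (c * p1)) e = e" for c
      by (induction c) (simp_all add: funpow_add p1_period[OF e1])
    then show ?thesis by (simp add: kernel_period_def mult.commute[of p1])
  qed
  have Sd: "?S d = e \<otimes> d" by (simp add: e_def m_assoc)
  have "(?S ^^ j) d = e [^] j \<otimes> d" for j :: nat
  proof (induction j)
    case (Suc j)
    have Sp: "?S (e [^] j) = e [^] j" for j :: nat
    proof (induction j)
      case 0
      have "(shift ^^ m) \<one> = \<one>" for m by (induction m) (simp_all add: shift_one)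
      then show ?case by simp
    qed (simp add: funpow_shift_mult Se)
    show ?case using Suc by (simp add: funpow_shift_mult Sp Sd m_assoc)
  qed simp
  from this[of ?m] have "(?S ^^ ?m) d = d"
    using pow_card_subgroup[OF subgroup_D finite_D e1] by simp
  then show ?case by (simp add: funpow_mult kernel_period_def mult.assoc mult.commute[of "?m"])
qed

lemma inv_sets_kernel_period: "inv_sets \<mu> (shift ^^ kernel_period n) \<subseteq> inv_sets \<mu> shift"
proof (rule inv_sets_funpow_subset[OF sets_mu measurable_shift shift_invariant, of "k * p1"])
  show "inv_sets \<mu> shift = inv_sets \<mu> (shift ^^ (k * p1))" unfolding p1_def by (rule inv_sets_eq)
  show "0 < kernel_period n" using p1_pos finite_D[of "Suc 0"] by (auto simp: kernel_period_def card_gt_0_iff D_1 intro: F_one)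
  show "p dvd k * p1" if p: "prime p" "p dvd kernel_period n" for p
  proof (cases "p dvd p1")
    case False
    then have "p dvd card (D (Suc 0)) ^ n" using p by (simp add: kernel_period_def prime_dvd_mult_iff)
    then have "p dvd CARD('a)" using p(1) unfolding card_D by (meson prime_dvd_power)
    then have "p \<in> prime_factors CARD('a)" using p(1) by (simp add: in_prime_factors_iff)
    then show ?thesis using k by simp
  qed simp
qed

lemma AE_stab_shift: "AE x in \<mu>. stab n (shift x) = stab n x"
  by (rule ft.AE_stab_shift[OF shift_image_D shift_invariant shift_kernel_period inv_sets_kernel_period])

lemma AE_shift_stab: "AE x in \<mu>. shift ` stab n x \<subseteq> stab n x"
  by (rule ft.AE_shift_stab[OF shift_image_D shift_invariant shift_kernel_period inv_sets_kernel_period])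

lemma AE_card_supp_le: "AE x in \<mu>. card (supp n x) \<le> CARD('a) * card (stab n x)"
  by (rule ft.AE_card_supp_le[OF shift_image_D shift_invariant shift_kernel_period inv_sets_kernel_period])

text \<open>The points with \<open>h\<close> in \<open>stab (Suc n)\<close> form a set saturated
  under \<open>D (Suc n)\<close>, hence under \<open>D n\<close>. Invariance of \<open>\<mu>\<close>
  on it is obtained from the larger kernel and read back through the smaller one.\<close>

lemma AE_stab_Suc: "AE x in \<mu>. stab (Suc n) x \<inter> D n \<subseteq> stab n x"
proof -
  have "AE x in \<mu>. \<forall>h\<in>D n. h \<in> stab (Suc n) x \<longrightarrow> h \<in> stab n x"
  proof (rule AE_finite_allI[OF finite_D])
    fix h assume h: "h \<in> D n"
    then have h': "h \<in> D (Suc n)" using D_Suc_subset by blast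
    let ?C = "{x. h \<in> stab (Suc n) x}"
    have "AE x in \<mu>. x \<in> ?C \<longrightarrow> h \<in> stab n x"
    proof (rule ft.stab_if_mu_invariant_on[OF h ft.stab_measurable])
      have C: "d \<otimes> x \<in> ?C \<longleftrightarrow> x \<in> ?C" if "d \<in> D (Suc n)" for d x
        by (simp add: ft.stab_translate[OF that])
      then show "d \<otimes> x \<in> ?C \<longleftrightarrow> x \<in> ?C" if "d \<in> D n" for d x
        using that D_Suc_subset by blast
      show "emeasure \<mu> (?C \<inter> (\<lambda>x. h \<otimes> x) -` B) = emeasure \<mu> (?C \<inter> B)" if "B \<in> sets borel" for B
        by (rule ft.mu_invariant_on[OF h' ft.stab_measurable C[OF h'] _ that]) simp
    qed
    then show "AE x in \<mu>. h \<in> stab (Suc n) x \<longrightarrow> h \<in> stab n x" by simp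
  qed
  then show ?thesis by eventually_elim blast
qed

text \<open>\<open>F\<close> carries cosets of \<open>D (Suc n)\<close> to cosets of
  \<open>D n\<close> and preserves \<open>\<mu>\<close>, so invariance under \<open>h\<close> pushes
  forward to invariance under \<open>F h\<close>.\<close>

lemma AE_F_stab: "AE x in \<mu>. F ` stab (Suc n) x \<subseteq> stab n (F x)"
proof -
  have "AE x in \<mu>. \<forall>h\<in>D (Suc n). h \<in> stab (Suc n) x \<longrightarrow> F h \<in> stab n (F x)"
  proof (rule AE_finite_allI[OF finite_D])
    fix h assume h: "h \<in> D (Suc n)"
    let ?U = "{x. h \<in> stab (Suc n) x}"
    let ?g = "fibre_section r s F \<one>"
    \<comment> \<open>\<open>?U\<close> is saturated under the kernel of \<open>F\<close>, so it is
      the preimage under \<open>F\<close> of a Borel set; a continuous section exhibits that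
      set.\<close>
    define C where "C = ?g -` ?U"
    have U: "?U \<in> sets borel" by (rule ft.stab_measurable)
    have g: "?g \<in> borel_measurable borel"
      by (rule borel_measurable_continuous_onI[OF continuous_fibre_section[OF biperm_F]])
    have C[measurable]: "C \<in> sets borel" unfolding C_def using measurable_sets[OF g U] by simp
    have UD: "d \<otimes> x \<in> ?U \<longleftrightarrow> x \<in> ?U" if "d \<in> D (Suc n)" for d x
      by (simp add: ft.stab_translate[OF that])
    have UC: "F x \<in> C \<longleftrightarrow> x \<in> ?U" for x
    proof -
      let ?e = "?g (F x) \<otimes> inv x"
      have "F ?e = \<one>" by (simp add: F_mult F_inv image_fibre_section[OF biperm_F])
      then have "?e \<in> D (Suc n)" using D_mono[of "Suc 0" "Suc n"] by (auto simp: D_1)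
      from UD[OF this, of x] show ?thesis by (simp add: C_def m_assoc)
    qed
    have CD: "d \<otimes> y \<in> C \<longleftrightarrow> y \<in> C" if d: "d \<in> D n" for d y
    proof -
      let ?x = "?g y" and ?e = "?g d"
      have F: "F ?x = y" "F ?e = d" by (simp_all add: image_fibre_section[OF biperm_F])
      have "?e \<in> D (Suc n)" using d F(2) by (simp add: D_def funpow_swap1)
      from UD[OF this, of ?x] show ?thesis
        using UC[of ?x] UC[of "?e \<otimes> ?x"] by (simp add: F F_mult)
    qed
    have Finv: "emeasure \<mu> (F -` B) = emeasure \<mu> B" if "B \<in> sets borel" for B
      using F_invariant that by (simp add: invariant_measure_def)
    have "AE y in \<mu>. y \<in> C \<longrightarrow> F h \<in> stab n y"
    proof (rule ft.stab_if_mu_invariant_on[OF F_D[OF h] C CD])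
      fix B :: "'a config set" assume B[measurable]: "B \<in> sets borel"
      have FB: "F -` B \<in> sets borel" using measurable_sets[OF measurable_F B] by simp
      have hB: "(\<lambda>x. F h \<otimes> x) -` B \<in> sets borel" by (rule translate_vimage_sets[OF B])
      have "emeasure \<mu> (C \<inter> (\<lambda>x. F h \<otimes> x) -` B) = emeasure \<mu> (F -` (C \<inter> (\<lambda>x. F h \<otimes> x) -` B))"
        by (rule Finv[symmetric, OF sets.Int[OF C hB]])
      also have "F -` (C \<inter> (\<lambda>x. F h \<otimes> x) -` B) = ?U \<inter> (\<lambda>x. h \<otimes> x) -` (F -` B)"
        using UC by (auto simp: F_mult)
      also have "emeasure \<mu> \<dots> = emeasure \<mu> (?U \<inter> F -` B)"
        by (rule ft.mu_invariant_on[OF h U UD[OF h] _ FB]) simp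
      also have "?U \<inter> F -` B = F -` (C \<inter> B)" using UC by auto
      also have "emeasure \<mu> \<dots> = emeasure \<mu> (C \<inter> B)" by (rule Finv[OF sets.Int[OF C B]])
      finally show "emeasure \<mu> (C \<inter> (\<lambda>x. F h \<otimes> x) -` B) = emeasure \<mu> (C \<inter> B)" .
    qed
    from AE_F[OF this] show "AE x in \<mu>. h \<in> stab (Suc n) x \<longrightarrow> F h \<in> stab n (F x)"
      by eventually_elim (use UC in simp)
  qed
  then show ?thesis
  proof eventually_elim
    case (elim x)
    then show ?case using ft.stab_subset[of "Suc n" x] by blast
  qed
qed

lemma AE_stab_Sigma: "AE x in \<mu>. stab n x \<subseteq> \<Sigma>"
  using AE_Sigma ft.AE_on_supp[OF AE_Sigma, of n] ft.AE_rho_pos[of n]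
proof eventually_elim
  case (elim x)
  show ?case
  proof
    fix h assume "h \<in> stab n x"
    then have "h \<otimes> x \<in> \<Sigma>" using ft.stab_subset_supp[OF elim(3)] elim(2) by blast
    then have "(h \<otimes> x) \<otimes> inv x \<in> \<Sigma>"
      using elim(1) subgroup.m_closed[OF subgroup_Sigma] subgroup.m_inv_closed[OF subgroup_Sigma] by blast
    then show "h \<in> \<Sigma>" by (simp add: m_assoc)
  qed
qed

text \<open>Collects countably many almost sure relations on one set of full measure; from here on
  the stabilisers are handled pointwise.\<close>

definition good :: "'a config \<Rightarrow> bool" where
  "good x \<longleftrightarrow> (\<forall>n. stab (Suc n) x \<inter> D n \<subseteq> stab n x \<and> F ` stab (Suc n) x \<subseteq> stab n (F x) \<and>
     shift ` stab n x \<subseteq> stab n x \<and> stab n (shift x) = stab n x \<and> stab n x \<subseteq> \<Sigma>)"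

lemma AE_good: "AE x in \<mu>. good x"
proof -
  have "AE x in \<mu>. stab (Suc n) x \<inter> D n \<subseteq> stab n x \<and> F ` stab (Suc n) x \<subseteq> stab n (F x) \<and>
     shift ` stab n x \<subseteq> stab n x \<and> stab n (shift x) = stab n x \<and> stab n x \<subseteq> \<Sigma>" for n
    using AE_stab_Suc[of n] AE_F_stab[of n] AE_shift_stab[of n] AE_stab_shift[of n] AE_stab_Sigma[of n]
    by eventually_elim blast
  then show ?thesis unfolding good_def AE_all_countable by blast
qed

lemma good_stab_antimono:
  assumes x: "good x" and mn: "m \<le> n" and h: "h \<in> stab n x" "h \<in> D m"
  shows "h \<in> stab m x"
  using mn h(1)
proof (induction n rule: dec_induct)
  case (step n)
  have "h \<in> D n" using D_mono[OF step.hyps(1)] h(2) by blast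
  then have "h \<in> stab n x" using step.prems x unfolding good_def by blast
  then show ?case by (rule step.IH)
qed

text \<open>The lower limit of the groups \<open>stab n x\<close>. At good points its part inside
  \<open>D m\<close> is the intersection over all \<open>n \<ge> m\<close>, by
  \<open>good_asym_stab_iff\<close>. The form with a lower limit is a subgroup at every
  point.\<close>

definition asym_stab :: "'a config \<Rightarrow> 'a config set" where
  "asym_stab x = {h. \<exists>M. \<forall>n\<ge>M. h \<in> stab n x}"

lemma subgroup_asym_stab: "subgroup (asym_stab x) G"
proof (rule subgroupI)
  have "\<one> \<in> stab n x" for n using subgroup.one_closed[OF ft.subgroup_stab] .
  then show "asym_stab x \<noteq> {}" unfolding asym_stab_def by blast
  show "inv h \<in> asym_stab x" if "h \<in> asym_stab x" for h
    using that subgroup.m_inv_closed[OF ft.subgroup_stab] unfolding asym_stab_def by blast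
  show "h \<otimes> h' \<in> asym_stab x" if hh: "h \<in> asym_stab x" "h' \<in> asym_stab x" for h h'
  proof -
    obtain M M' where "\<forall>n\<ge>M. h \<in> stab n x" "\<forall>n\<ge>M'. h' \<in> stab n x"
      using hh unfolding asym_stab_def by blast
    then have "\<forall>n\<ge>max M M'. h \<otimes> h' \<in> stab n x"
      using subgroup.m_closed[OF ft.subgroup_stab] by simp
    then show ?thesis unfolding asym_stab_def by blast
  qed
qed simp

lemma asym_stab_subset_D: "asym_stab x \<subseteq> (\<Union>n. D n)"
  unfolding asym_stab_def using ft.stab_subset by blast

lemma good_asym_stab_iff:
  assumes "good x" "h \<in> D m"
  shows "h \<in> asym_stab x \<longleftrightarrow> (\<forall>n\<ge>m. h \<in> stab n x)"
proof
  assume "h \<in> asym_stab x"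
  then obtain M where M: "\<forall>n\<ge>M. h \<in> stab n x" unfolding asym_stab_def by blast
  show "\<forall>n\<ge>m. h \<in> stab n x"
  proof (intro allI impI)
    fix n assume "m \<le> n"
    have "h \<in> stab (max M n) x" using M by simp
    moreover have "h \<in> D n" using D_mono[OF \<open>m \<le> n\<close>] assms(2) by blast
    ultimately show "h \<in> stab n x" using good_stab_antimono[OF assms(1), of n "max M n" h] by simp
  qed
qed (auto simp: asym_stab_def)

lemma good_asym_stab_Sigma: "good x \<Longrightarrow> asym_stab x \<subseteq> \<Sigma>"
  unfolding good_def asym_stab_def by blast

text \<open>The shift maps the finite group \<open>stab n x\<close> injectively into itself, hence
  onto. By injectivity the preimage of an element is the same for all \<open>n\<close>.\<close>

lemma good_asym_stab_shift:
  assumes x: "good x"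
  shows "shift ` asym_stab x = asym_stab x" and "asym_stab (shift x) = asym_stab x"
proof -
  have st: "shift h \<in> stab n x" if "h \<in> stab n x" for h n using x that unfolding good_def by blast
  show "asym_stab (shift x) = asym_stab x" using x unfolding good_def asym_stab_def by simp
  have "stab n x \<subseteq> shift ` stab n x" for n
  proof -
    have "shift ` stab n x = stab n x"
      by (rule endo_inj_surj[OF ft.finite_stab]) (use st inj_shift in \<open>auto intro: inj_on_subset\<close>)
    then show ?thesis by simp
  qed
  then have inv: "\<exists>h'\<in>stab n x. h = shift h'" if "h \<in> stab n x" for h n using that by blast
  show "shift ` asym_stab x = asym_stab x"
  proof
    show "shift ` asym_stab x \<subseteq> asym_stab x" unfolding asym_stab_def using st by blast
    show "asym_stab x \<subseteq> shift ` asym_stab x"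
    proof
      fix h assume "h \<in> asym_stab x"
      then obtain M where M: "\<forall>n\<ge>M. h \<in> stab n x" unfolding asym_stab_def by blast
      obtain h' where h': "h = shift h'" using surj_shift by (metis surjD)
      have "h' \<in> stab n x" if "n \<ge> M" for n
        using inv[of h n] M that h' injD[OF inj_shift] by metis
      then show "h \<in> shift ` asym_stab x" using h' unfolding asym_stab_def by blast
    qed
  qed
qed

lemma good_F_asym_stab:
  assumes "good x"
  shows "F ` asym_stab x \<subseteq> asym_stab (F x)"
proof (rule image_subsetI)
  fix h assume "h \<in> asym_stab x"
  then obtain M where M: "\<forall>n\<ge>M. h \<in> stab n x" unfolding asym_stab_def by blast
  have "F h \<in> stab n (F x)" if "n \<ge> M" for n
  proof -
    have "h \<in> stab (Suc n) x" using M that by simp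
    then show ?thesis using assms unfolding good_def by blast
  qed
  then show "F h \<in> asym_stab (F x)" unfolding asym_stab_def by blast
qed

text \<open>\<open>F\<close> maps the group at \<open>x\<close> into the group at
  \<open>F x\<close>, and its fibres are finite.\<close>

lemma good_infinite_asym_stab_F:
  assumes "good x" "infinite (asym_stab x)"
  shows "infinite (asym_stab (F x))"
proof
  assume fin: "finite (asym_stab (F x))"
  have "finite {h \<in> asym_stab x. F h = b}" for b
    by (rule finite_subset[OF _ card_fibre(1)[OF biperm_F, of b]]) auto
  then have "finite (\<Union>b\<in>asym_stab (F x). {h \<in> asym_stab x. F h = b})" using fin by blast
  moreover have "asym_stab x \<subseteq> (\<Union>b\<in>asym_stab (F x). {h \<in> asym_stab x. F h = b})"
    using good_F_asym_stab[OF assms(1)] by blast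
  ultimately show False using assms(2) finite_subset by blast
qed

lemma asym_stab_measurable: "{x. h \<in> asym_stab x} \<in> sets borel"
proof -
  have "{x. h \<in> asym_stab x} = (\<Union>M. \<Inter>n\<in>{M..}. {x. h \<in> stab n x})" by (auto simp: asym_stab_def)
  also have "\<dots> \<in> sets borel"
    by (intro sets.countable_UN sets.countable_INT'') (auto intro: ft.stab_measurable)
  finally show ?thesis .
qed

definition unbounded_stab :: "'a config set" where
  "unbounded_stab = {x. infinite (asym_stab x)}"

lemma countable_D_infinity: "countable (\<Union>n. D n)"
  by (rule countable_UN) (simp_all add: countable_finite finite_D)

lemma unbounded_stab_measurable: "unbounded_stab \<in> sets borel"
proof -
  let ?D = "\<Union>n. D n"
  let ?\<A> = "{A. finite A \<and> A \<subseteq> ?D}"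
  \<comment> \<open>A finite \<open>asym_stab x\<close> is contained in a finite subset of the
    countable union of the kernels, and there are only countably many such subsets.\<close>
  have "- unbounded_stab = (\<Union>A\<in>?\<A>. \<Inter>h\<in>?D. if h \<in> A then UNIV else - {x. h \<in> asym_stab x})" (is "_ = ?R")
  proof
    show "- unbounded_stab \<subseteq> ?R"
    proof
      fix x assume "x \<in> - unbounded_stab"
      then have "asym_stab x \<in> ?\<A>" using asym_stab_subset_D by (simp add: unbounded_stab_def)
      moreover have "x \<in> (\<Inter>h\<in>?D. if h \<in> asym_stab x then UNIV else - {x. h \<in> asym_stab x})" by auto
      ultimately show "x \<in> ?R" by blast
    qed
    show "?R \<subseteq> - unbounded_stab"
    proof
      fix x assume "x \<in> ?R"
      then obtain A where A: "finite A" "x \<in> (\<Inter>h\<in>?D. if h \<in> A then UNIV else - {x. h \<in> asym_stab x})" by blast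
      have "asym_stab x \<subseteq> A"
      proof
        fix h assume h: "h \<in> asym_stab x"
        then have "h \<in> ?D" using asym_stab_subset_D by blast
        with A(2) have "x \<in> (if h \<in> A then UNIV else - {x. h \<in> asym_stab x})" by blast
        with h show "h \<in> A" by (simp split: if_splits)
      qed
      then show "x \<in> - unbounded_stab" using A(1) finite_subset by (auto simp: unbounded_stab_def)
    qed
  qed
  also have "\<dots> \<in> sets borel"
  proof (rule sets.countable_UN'')
    show "countable ?\<A>" by (rule countable_Collect_finite_subset[OF countable_D_infinity])
    fix A
    show "(\<Inter>h\<in>?D. if h \<in> A then UNIV else - {x. h \<in> asym_stab x}) \<in> sets borel"
      by (rule sets.countable_INT''[OF _ countable_D_infinity])
        (simp_all add: borel_comp asym_stab_measurable)
  qed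
  finally show ?thesis using borel_comp[of "- unbounded_stab"] by simp
qed

lemma AE_unbounded_stab_shift: "AE x in \<mu>. shift x \<in> unbounded_stab \<longleftrightarrow> x \<in> unbounded_stab"
  using AE_good by eventually_elim (simp add: unbounded_stab_def good_asym_stab_shift(2))

text \<open>Only one inclusion holds at good points. As both sets have the same measure, their
  difference is null.\<close>

lemma AE_unbounded_stab_F: "AE x in \<mu>. F x \<in> unbounded_stab \<longleftrightarrow> x \<in> unbounded_stab"
proof -
  have FZ: "F -` unbounded_stab \<in> sets \<mu>" using measurable_sets[OF measurable_F unbounded_stab_measurable] by simp
  have sub: "AE x in \<mu>. x \<in> unbounded_stab \<longrightarrow> x \<in> F -` unbounded_stab"
    using AE_good by eventually_elim (simp add: unbounded_stab_def good_infinite_asym_stab_F)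
  have eq: "measure \<mu> (F -` unbounded_stab) = measure \<mu> unbounded_stab"
    using F_invariant unbounded_stab_measurable by (simp add: invariant_measure_def measure_def)
  have "measure \<mu> (F -` unbounded_stab - unbounded_stab) = measure \<mu> (F -` unbounded_stab) - measure \<mu> (F -` unbounded_stab \<inter> unbounded_stab)"
    using FZ unbounded_stab_measurable by (simp add: finite_measure_Diff')
  also have "measure \<mu> (F -` unbounded_stab \<inter> unbounded_stab) = measure \<mu> unbounded_stab"
    using FZ unbounded_stab_measurable sub by (intro finite_measure_eq_AE) auto
  finally have "measure \<mu> (F -` unbounded_stab - unbounded_stab) = 0" using eq by simp
  then have "AE x in \<mu>. x \<notin> F -` unbounded_stab - unbounded_stab"
    using prob_eq_0[of "F -` unbounded_stab - unbounded_stab"] FZ unbounded_stab_measurable by simp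
  with sub show ?thesis by eventually_elim blast
qed

lemma shift_int_measurable: "(shift_int m :: 'a config \<Rightarrow> 'a config) \<in> borel_measurable borel"
proof (rule borel_measurable_continuous_onI, subst continuous_config_iff, intro allI exI impI)
  fix x y :: "'a config" and M assume "agree (M + nat \<bar>m\<bar>) x y"
  then have "x (i + m) = y (i + m)" if "i \<in> {- int M..int M}" for i
    unfolding agree_def by (rule bspec) (use that in auto)
  then show "agree M (shift_int m x) (shift_int m y)" by (simp add: agree_def shift_int_def)
qed

lemma shift_funpow_invariant: "B \<in> sets borel \<Longrightarrow> emeasure \<mu> ((shift ^^ n) -` B) = emeasure \<mu> B"
  by (rule invariant_funpow[OF sets_mu measurable_shift shift_invariant])

lemma shift_int_invariant: "invariant_measure (shift_int m) \<mu>"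
  unfolding invariant_measure_def
proof
  fix B :: "'a config set" assume B: "B \<in> sets borel"
  show "emeasure \<mu> (shift_int m -` B) = emeasure \<mu> B"
  proof (cases "0 \<le> m")
    case True
    then have S: "shift_int m = (shift ^^ nat m :: 'a config \<Rightarrow> _)" using shift_int_of_nat[where 'a='a, of "nat m"] by simp
    show ?thesis unfolding S by (rule shift_funpow_invariant[OF B])
  next
    case False
    let ?n = "nat (- m)"
    have S: "(shift ^^ ?n :: 'a config \<Rightarrow> _) = shift_int (- m)" using False shift_int_of_nat[of ?n, where 'a='a] by simp
    have "shift_int m -` B \<in> sets borel" using measurable_sets[OF shift_int_measurable B] by simp
    from shift_funpow_invariant[OF this, of ?n]
    have "emeasure \<mu> (shift_int (- m) -` (shift_int m -` B)) = emeasure \<mu> (shift_int m -` B)"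
      unfolding S .
    moreover have "shift_int (- m) -` (shift_int m -` B) = B" by (auto simp: shift_int_minus)
    ultimately show ?thesis by simp
  qed
qed

lemma unbounded_stab_trivial:
  assumes "ergodic_action F \<mu>"
  shows "emeasure \<mu> unbounded_stab = 0 \<or> emeasure \<mu> unbounded_stab = 1"
proof -
  have "unbounded_stab \<in> inv_sets \<mu> ((F ^^ n) \<circ> shift_int m)" for n m
  proof -
    have Fn: "AE x in \<mu>. (F ^^ n) x \<in> unbounded_stab \<longleftrightarrow> x \<in> unbounded_stab"
    proof (induction n)
      case (Suc n)
      from AE_F[OF Suc] AE_unbounded_stab_F show ?case by eventually_elim (simp add: funpow_swap1)
    qed simp
    have Sn: "AE x in \<mu>. (shift ^^ j) x \<in> unbounded_stab \<longleftrightarrow> x \<in> unbounded_stab" for j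
    proof (induction j)
      case (Suc j)
      from AE_shift[OF Suc] AE_unbounded_stab_shift show ?case by eventually_elim (simp add: funpow_swap1)
    qed simp
    have Sm: "AE x in \<mu>. shift_int m x \<in> unbounded_stab \<longleftrightarrow> x \<in> unbounded_stab"
    proof (cases "0 \<le> m")
      case True
      then have S: "shift_int m = (shift ^^ nat m :: 'a config \<Rightarrow> _)" using shift_int_of_nat[where 'a='a, of "nat m"] by simp
      show ?thesis unfolding S by (rule Sn)
    next
      case False
      then have S: "shift_int (- m) = (shift ^^ nat (- m) :: 'a config \<Rightarrow> _)"
        using shift_int_of_nat[of "nat (- m)", where 'a='a] by simp
      have "AE x in \<mu>. shift_int (- m) x \<in> unbounded_stab \<longleftrightarrow> x \<in> unbounded_stab" unfolding S by (rule Sn)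
      \<comment> \<open>The statement for the positive exponent \<open>- m\<close> is evaluated at
        \<open>shift_int m x\<close>, where the two shifts cancel.\<close>
      from AE_invariant[OF shift_int_measurable shift_int_invariant this, of m] show ?thesis
        by eventually_elim (simp add: shift_int_minus)
    qed
    have "AE x in \<mu>. ((F ^^ n) \<circ> shift_int m) x \<in> unbounded_stab \<longleftrightarrow> x \<in> unbounded_stab"
      using AE_invariant[OF shift_int_measurable shift_int_invariant Fn, of m] Sm
      by eventually_elim simp
    moreover have "(F ^^ n) \<circ> shift_int m \<in> borel_measurable borel"
      by (rule measurable_comp[OF shift_int_measurable T_funpow_measurable[OF sets_mu measurable_F F_invariant]])
    ultimately show ?thesis
      using unbounded_stab_measurable inv_sets_iff[OF sets_mu measurable_F F_invariant] by blast
  qed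
  then show ?thesis using assms unbounded_stab_measurable unfolding ergodic_action_def by blast
qed

end


section \<open>Invariance under translations by the closed subgroup\<close>

lemma cylinder_in_borel: "cylinder M (x :: 'a::discrete_topology config) \<in> sets borel"
  by (rule borel_open[OF open_cylinder])

lemma measure_eq_if_cylinders:
  fixes M N :: "'a::{finite,discrete_topology} config measure"
  assumes M: "sets M = sets borel" and N: "sets N = sets borel" and fin: "finite_measure M"
    and eq: "\<And>m x. emeasure M (cylinder m x) = emeasure N (cylinder m x)"
  shows "M = N"
proof (rule measure_eqI_generator_eq[where E = "insert {} cylinders" and A = "from_nat_into cylinders" and \<Omega> = UNIV])
  have ne: "(cylinders :: 'a config set set) \<noteq> {}" by (auto simp: cylinders_def)
  have rng: "range (from_nat_into cylinders) = (cylinders :: 'a config set set)"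
    by (rule range_from_nat_into[OF ne countable_cylinders])
  have ss: "sigma_sets UNIV (insert {} cylinders) = sigma_sets UNIV (cylinders :: 'a config set set)"
    by (rule sigma_sets_eqI) (auto intro: sigma_sets.Empty sigma_sets.Basic)
  show "Int_stable (insert {} cylinders :: 'a config set set)"
  proof (rule Int_stableI)
    have cc: "cylinder m x \<inter> cylinder m' y \<in> insert {} cylinders" if "m \<le> m'" for m m' and x y :: "'a config"
    proof (cases "agree m x y")
      case True
      then have "cylinder m x \<inter> cylinder m' y = cylinder m' y"
        using agree_trans agree_mono[OF _ that] by blast
      then show ?thesis by (auto simp: cylinders_def)
    next
      case False
      then have "cylinder m x \<inter> cylinder m' y = {}"
        using agree_trans agree_mono[OF _ that] agree_sym by blast
      then show ?thesis by simp
    qed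
    fix a b :: "'a config set" assume "a \<in> insert {} cylinders" "b \<in> insert {} cylinders"
    then consider "a = {}" | "b = {}" | m x m' y where "a = cylinder m x" "b = cylinder m' y"
      unfolding cylinders_def by blast
    then show "a \<inter> b \<in> insert {} cylinders"
    proof cases
      case 3
      then show ?thesis using cc[of m m' x y] cc[of m' m y x] by (cases "m \<le> m'") (simp_all add: Int_commute)
    qed simp_all
  qed
  show "emeasure M X = emeasure N X" if "X \<in> insert {} cylinders" for X
    using that eq unfolding cylinders_def by auto
  show "sets M = sigma_sets UNIV (insert {} cylinders)" "sets N = sigma_sets UNIV (insert {} cylinders)"
    by (simp_all add: M N ss borel_config_eq_sigma)
  show "range (from_nat_into cylinders) \<subseteq> (insert {} cylinders :: 'a config set set)" using rng by blast
  have "x \<in> \<Union>(cylinders :: 'a config set set)" for x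
    unfolding cylinders_def by (rule UnionI[of "cylinder 0 x"]) auto
  then show "(\<Union>i. from_nat_into cylinders i) = (UNIV :: 'a config set)" unfolding rng by blast
  show "emeasure M (from_nat_into cylinders i) \<noteq> \<infinity>" for i
    using finite_measure.emeasure_finite[OF fin] by simp
qed simp

text \<open>Countably many null cylinders cover the complement of the support.\<close>

lemma AE_measure_support:
  fixes M :: "'a::{finite,discrete_topology} config measure"
  assumes M: "sets M = sets borel"
  shows "AE x in M. x \<in> measure_support M"
proof (rule AE_I')
  let ?\<C> = "{C \<in> cylinders. emeasure M C = 0}"
  show "\<Union>?\<C> \<in> null_sets M"
  proof (rule null_sets_UN'[where N = "\<lambda>x. x", simplified])
    show "countable ?\<C>" by (rule countable_subset[OF _ countable_cylinders]) auto
    show "C \<in> null_sets M" if "C \<in> ?\<C>" for C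
      using that cylinder_in_borel unfolding cylinders_def null_sets_def M by auto
  qed
  show "{x \<in> space M. x \<notin> measure_support M} \<subseteq> \<Union>?\<C>"
  proof
    fix x assume "x \<in> {x \<in> space M. x \<notin> measure_support M}"
    then obtain U where U: "open U" "x \<in> U" "emeasure M U = 0"
      unfolding measure_support_def using not_gr_zero by blast
    then obtain m where m: "cylinder m x \<subseteq> U" using open_config_iff[of U] by blast
    have "emeasure M (cylinder m x) \<le> emeasure M U"
      using U(1) by (intro emeasure_mono[OF m]) (simp add: M)
    then have "emeasure M (cylinder m x) = 0" using U(3) by simp
    moreover have "cylinder m x \<in> cylinders" by (auto simp: cylinders_def)
    ultimately show "x \<in> \<Union>?\<C>" by (intro UnionI[of "cylinder m x"]) auto
  qed
qed

context config_group
begin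

text \<open>The mass of the set of pairs with \<open>x \<otimes> y\<close> in a cylinder, under the
  product of the two measures, is computed in both orders of integration. Almost every point lies in
  \<open>\<Sigma>\<close>, so each inner integral is the mass of a translate of the cylinder;
  commutativity is what makes the second order work.\<close>

lemma is_haar_measure_unique:
  assumes \<mu>: "is_haar_measure G \<Sigma> \<mu>" and \<nu>: "is_haar_measure G \<Sigma> \<nu>"
  shows "\<mu> = \<nu>"
proof -
  have sets: "sets \<mu> = sets borel" "sets \<nu> = sets borel"
    using \<mu> \<nu> by (auto simp: is_haar_measure_def borel_prob_def)
  interpret m: prob_space \<mu> using \<mu> by (simp add: is_haar_measure_def borel_prob_def)
  interpret n: prob_space \<nu> using \<nu> by (simp add: is_haar_measure_def borel_prob_def)
  interpret p: pair_sigma_finite \<mu> \<nu> ..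
  have AE: "AE x in \<mu>. x \<in> \<Sigma>" "AE x in \<nu>. x \<in> \<Sigma>"
    using AE_measure_support[OF sets(1)] AE_measure_support[OF sets(2)] \<mu> \<nu>
    unfolding is_haar_measure_def by (auto elim!: eventually_mono)
  have inv: "emeasure \<mu> ((\<lambda>x. g \<otimes> x) -` B) = emeasure \<mu> B" "emeasure \<nu> ((\<lambda>x. g \<otimes> x) -` B) = emeasure \<nu> B"
    if "g \<in> \<Sigma>" "B \<in> sets borel" for g B
    using \<mu> \<nu> that unfolding is_haar_measure_def invariant_measure_def by blast+
  show ?thesis
  proof (rule measure_eq_if_cylinders[OF sets])
    fix M and z :: "'a config"
    let ?B = "cylinder M z"
    obtain m where m: "\<And>x y x' y'. agree m x x' \<Longrightarrow> agree m y y' \<Longrightarrow> agree M (x \<otimes> y) (x' \<otimes> y')"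
      using uniform_agree_binary[OF continuous_mult, of M] by auto
    define E where "E = {(x, y). x \<otimes> y \<in> ?B}"
    let ?R = "range (cylinder m :: 'a config \<Rightarrow> 'a config set)"
    \<comment> \<open>Uniform continuity makes \<open>E\<close> a finite union of rectangles of
      cylinders, hence measurable for the product of the two sigma-algebras.\<close>
    have "E = (\<Union>(C, C')\<in>{(C, C') \<in> ?R \<times> ?R. C \<times> C' \<subseteq> E}. C \<times> C')" (is "_ = ?U")
    proof
      show "?U \<subseteq> E" by blast
      show "E \<subseteq> ?U"
      proof
        fix p assume "p \<in> E"
        then obtain x y where p: "p = (x, y)" "agree M z (x \<otimes> y)" by (auto simp: E_def)
        have "cylinder m x \<times> cylinder m y \<subseteq> E"
          using m agree_trans[OF p(2)] unfolding E_def by blast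
        then have "(cylinder m x, cylinder m y) \<in> {(C, C') \<in> ?R \<times> ?R. C \<times> C' \<subseteq> E}" by blast
        then show "p \<in> ?U" unfolding p(1) by (rule UN_I) simp
      qed
    qed
    also have "\<dots> \<in> sets (\<mu> \<Otimes>\<^sub>M \<nu>)"
    proof (rule sets.finite_UN)
      show "finite {(C, C') \<in> ?R \<times> ?R. C \<times> C' \<subseteq> E}"
        by (rule finite_subset[OF _ finite_cartesian_product[OF finite_cylinders finite_cylinders]]) auto
      show "(case p of (C, C') \<Rightarrow> C \<times> C') \<in> sets (\<mu> \<Otimes>\<^sub>M \<nu>)"
        if "p \<in> {(C, C') \<in> ?R \<times> ?R. C \<times> C' \<subseteq> E}" for p
        using that cylinder_in_borel by (auto intro!: pair_measureI simp: sets)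
    qed
    finally have E: "E \<in> sets (\<mu> \<Otimes>\<^sub>M \<nu>)" .
    have B: "?B \<in> sets borel" by (rule cylinder_in_borel)
    have "emeasure (\<mu> \<Otimes>\<^sub>M \<nu>) E = (\<integral>\<^sup>+x. emeasure \<nu> (Pair x -` E) \<partial>\<mu>)"
      by (rule n.emeasure_pair_measure_alt[OF E])
    also have "\<dots> = (\<integral>\<^sup>+x. emeasure \<nu> ?B \<partial>\<mu>)"
    proof (rule nn_integral_cong_AE)
      show "AE x in \<mu>. emeasure \<nu> (Pair x -` E) = emeasure \<nu> ?B"
        using AE(1)
      proof eventually_elim
        case (elim x)
        have "Pair x -` E = (\<lambda>y. x \<otimes> y) -` ?B" by (auto simp: E_def)
        then show ?case using inv(2)[OF elim B] by simp
      qed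
    qed
    also have "\<dots> = emeasure \<nu> ?B" by (simp add: m.emeasure_space_1)
    finally have 1: "emeasure (\<mu> \<Otimes>\<^sub>M \<nu>) E = emeasure \<nu> ?B" .
    have "emeasure (\<mu> \<Otimes>\<^sub>M \<nu>) E = (\<integral>\<^sup>+y. emeasure \<mu> ((\<lambda>x. (x, y)) -` E) \<partial>\<nu>)"
      by (rule p.emeasure_pair_measure_alt2[OF E])
    also have "\<dots> = (\<integral>\<^sup>+y. emeasure \<mu> ?B \<partial>\<nu>)"
    proof (rule nn_integral_cong_AE)
      show "AE y in \<nu>. emeasure \<mu> ((\<lambda>x. (x, y)) -` E) = emeasure \<mu> ?B"
        using AE(2)
      proof eventually_elim
        case (elim y)
        have "(\<lambda>x. (x, y)) -` E = (\<lambda>x. y \<otimes> x) -` ?B" by (auto simp: E_def m_comm)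
        then show ?case using inv(1)[OF elim B] by simp
      qed
    qed
    also have "\<dots> = emeasure \<mu> ?B" by (simp add: n.emeasure_space_1)
    finally show "emeasure \<mu> ?B = emeasure \<nu> ?B" using 1 by simp
  qed (rule m.finite_measure_axioms)
qed

end

section \<open>From a dense subgroup to all translations\<close>

context rigid_system
begin

lemma asym_stab_translate:
  assumes "e \<in> D m"
  shows "asym_stab (e \<otimes> x) = asym_stab x"
proof -
  have eq: "stab n (e \<otimes> x) = stab n x" if "m \<le> n" for n
    using D_mono[OF that] assms by (intro ft.stab_translate) blast
  have "(\<exists>M. \<forall>n\<ge>M. h \<in> stab n (e \<otimes> x)) \<longleftrightarrow> (\<exists>M. \<forall>n\<ge>M. h \<in> stab n x)" for h
  proof
    assume "\<exists>M. \<forall>n\<ge>M. h \<in> stab n (e \<otimes> x)"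
    then obtain M where M: "\<forall>n\<ge>M. h \<in> stab n (e \<otimes> x)" ..
    have "h \<in> stab n x" if "max M m \<le> n" for n using M[rule_format, of n] eq[of n] that by simp
    then show "\<exists>M. \<forall>n\<ge>M. h \<in> stab n x" by blast
  next
    assume "\<exists>M. \<forall>n\<ge>M. h \<in> stab n x"
    then obtain M where M: "\<forall>n\<ge>M. h \<in> stab n x" ..
    have "h \<in> stab n (e \<otimes> x)" if "max M m \<le> n" for n using M[rule_format, of n] eq[of n] that by simp
    then show "\<exists>M. \<forall>n\<ge>M. h \<in> stab n (e \<otimes> x)" by blast
  qed
  then show ?thesis by (simp add: asym_stab_def)
qed

context
  assumes AE_unbounded_stab: "AE x in \<mu>. x \<in> unbounded_stab"
    and dense: "\<And>H. \<lbrakk>subgroup H G; H \<subseteq> (\<Union>n. D n) \<inter> \<Sigma>; shift ` H = H; infinite H\<rbrakk> \<Longrightarrow> \<Sigma> \<subseteq> closure H"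
begin

text \<open>Translation by \<open>g\<close> and by any \<open>h\<close> close to \<open>g\<close>
  agree on membership in the cylinder. Density provides such an \<open>h\<close> in
  \<open>asym_stab x\<close>, but it depends on \<open>x\<close>; hence the space is cut into
  countably many pieces on each of which a single \<open>h\<close> works.\<close>

lemma mu_translate_cylinder:
  assumes g: "g \<in> \<Sigma>"
  shows "emeasure \<mu> ((\<lambda>x. g \<otimes> x) -` cylinder M z) = emeasure \<mu> (cylinder M z)"
proof -
  let ?B = "cylinder M z"
  have B: "?B \<in> sets borel" by (rule cylinder_in_borel)
  have gB: "(\<lambda>x. g \<otimes> x) -` ?B \<in> sets borel" by (rule translate_vimage_sets[OF B])
  obtain m where m: "\<And>x y x' y'. agree m x x' \<Longrightarrow> agree m y y' \<Longrightarrow> agree M (x \<otimes> y) (x' \<otimes> y')"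
    using uniform_agree_binary[OF continuous_mult, of M] by auto
  have near: "h \<otimes> x \<in> ?B \<longleftrightarrow> g \<otimes> x \<in> ?B" if "agree m g h" for h x
    using m[OF that agree_refl[of m x]] agree_trans agree_sym by blast
  let ?E = "(\<Union>n. D n) \<inter> cylinder m g"
  have ae: "AE x in \<mu>. \<exists>h\<in>?E. h \<in> asym_stab x"
    using AE_good AE_unbounded_stab
  proof eventually_elim
    case (elim x)
    have "\<Sigma> \<subseteq> closure (asym_stab x)"
      using elim asym_stab_subset_D good_asym_stab_Sigma good_asym_stab_shift(1) subgroup_asym_stab
      by (intro dense) (auto simp: unbounded_stab_def)
    then have "g \<in> closure (asym_stab x)" using g by blast
    then have "cylinder m g \<inter> asym_stab x \<noteq> {}"
      using open_Int_closure_eq_empty[OF open_cylinder[of m g], of "asym_stab x"] agree_refl[of m g] by blast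
    then show ?case using asym_stab_subset_D by blast
  qed
  have ne: "?E \<noteq> {}"
  proof
    assume "?E = {}"
    with ae have "AE x in \<mu>. False" by simp
    then show False by simp
  qed
  have cE: "countable ?E" by (rule countable_subset[OF _ countable_D_infinity]) blast
  define f where "f = from_nat_into ?E"
  have rf: "range f = ?E" unfolding f_def by (rule range_from_nat_into[OF ne cE])
  have ex: "AE x in \<mu>. \<exists>j. f j \<in> asym_stab x"
    using ae unfolding rf[symmetric] by eventually_elim blast
  \<comment> \<open>Taking the first admissible index makes the pieces disjoint. Each piece is
    saturated under every kernel because \<open>asym_stab\<close> is constant on cosets.\<close>
  define C where "C j = {x. f j \<in> asym_stab x} - (\<Union>i<j. {x. f i \<in> asym_stab x})" for j
  have C: "C j \<in> sets borel" for j
    unfolding C_def by (intro sets.Diff sets.finite_UN asym_stab_measurable) simp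
  have disj: "disjoint_family (\<lambda>j. C j \<inter> A)" for A
    unfolding disjoint_family_on_def C_def by (auto simp: neq_iff) 
  have split: "emeasure \<mu> A = (\<Sum>j. emeasure \<mu> (C j \<inter> A))" if A: "A \<in> sets borel" for A
  proof -
    have "(\<Sum>j. emeasure \<mu> (C j \<inter> A)) = emeasure \<mu> (\<Union>j. C j \<inter> A)"
      using C A by (intro suminf_emeasure disj) auto
    also have "\<dots> = emeasure \<mu> A"
    proof (rule emeasure_eq_AE)
      show "AE x in \<mu>. x \<in> (\<Union>j. C j \<inter> A) \<longleftrightarrow> x \<in> A"
        using ex
      proof eventually_elim
        case (elim x)
        have "x \<in> C (LEAST j. f j \<in> asym_stab x)"
          unfolding C_def using LeastI_ex[OF elim] not_less_Least[of _ "\<lambda>j. f j \<in> asym_stab x"] by blast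
        then show ?case by blast
      qed
    qed (use C A in auto)
    finally show ?thesis ..
  qed
  have inv: "emeasure \<mu> (C j \<inter> (\<lambda>x. g \<otimes> x) -` ?B) = emeasure \<mu> (C j \<inter> ?B)" for j
  proof -
    have "f j \<in> ?E" using rf by blast
    then obtain n where n: "f j \<in> D n" and ag: "agree m g (f j)" by blast
    have "C j \<inter> (\<lambda>x. g \<otimes> x) -` ?B = C j \<inter> (\<lambda>x. f j \<otimes> x) -` ?B" using near[OF ag] by blast
    also have "emeasure \<mu> \<dots> = emeasure \<mu> (C j \<inter> ?B)"
    proof (rule ft.mu_invariant_on[OF n C _ _ B])
      show "f j \<otimes> x \<in> C j \<longleftrightarrow> x \<in> C j" for x by (simp add: C_def asym_stab_translate[OF n])
      show "AE x in \<mu>. x \<in> C j \<longrightarrow> f j \<in> stab n x"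
        using AE_good by eventually_elim (use good_asym_stab_iff[OF _ n] in \<open>auto simp: C_def\<close>)
    qed
    finally show ?thesis .
  qed
  show ?thesis unfolding split[OF B] split[OF gB] by (simp only: inv)
qed

lemma mu_translate:
  assumes g: "g \<in> \<Sigma>"
  shows "invariant_measure (\<lambda>x. g \<otimes> x) \<mu>"
proof -
  have "\<mu> = distr \<mu> borel (\<lambda>x. g \<otimes> x)"
  proof (rule measure_eq_if_cylinders)
    fix m and x :: "'a config"
    have "emeasure (distr \<mu> borel (\<lambda>x. g \<otimes> x)) (cylinder m x) = emeasure \<mu> ((\<lambda>x. g \<otimes> x) -` cylinder m x)"
      by (subst emeasure_distr) (simp_all add: cylinder_in_borel)
    then show "emeasure \<mu> (cylinder m x) = emeasure (distr \<mu> borel (\<lambda>x. g \<otimes> x)) (cylinder m x)"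
      by (simp only: mu_translate_cylinder[OF g])
  qed (simp_all add: finite_measure_axioms)
  then have "emeasure \<mu> B = emeasure \<mu> ((\<lambda>x. g \<otimes> x) -` B)" if "B \<in> sets borel" for B
    using emeasure_distr[of "\<lambda>x. g \<otimes> x" \<mu> borel B] that by simp
  then show ?thesis by (simp add: invariant_measure_def)
qed

end

end


section \<open>Entropy of the shift\<close>

context prob_space
begin

lemma fin_rv_compose_measurable:
  assumes X: "fin_rv X" and T: "T \<in> measurable M M"
  shows "fin_rv (\<lambda>\<omega>. X (T \<omega>))"
proof -
  have "finite (range (\<lambda>\<omega>. X (T \<omega>)))"
    by (rule finite_subset[of _ "range X"]) (use X in \<open>auto simp: fin_rv_def\<close>)
  then show ?thesis
    unfolding fin_rv_def using measurable_compose[OF T fin_rv_measurable[OF X]] by simp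
qed

lemma fin_rv_set_valued:
  assumes W: "finite W" "\<And>\<omega>. T \<omega> \<subseteq> W" and sets: "\<And>w. {\<omega> \<in> space M. w \<in> T \<omega>} \<in> sets M"
  shows "fin_rv T"
proof (rule fin_rvI)
  show "finite (range T)" by (rule finite_subset[of _ "Pow W"]) (use W in auto)
  fix A
  have "T -` A \<inter> space M = (\<Union>t\<in>A \<inter> Pow W. {\<omega> \<in> space M. T \<omega> = t})" using W(2) by auto
  also have "\<dots> \<in> sets M"
  proof (rule sets.finite_UN)
    fix t assume t: "t \<in> A \<inter> Pow W"
    have "{\<omega> \<in> space M. T \<omega> = t} =
      space M - (\<Union>w\<in>W. if w \<in> t then space M - {\<omega> \<in> space M. w \<in> T \<omega>} else {\<omega> \<in> space M. w \<in> T \<omega>})"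
      using W(2) t by (auto split: if_splits)
    also have "\<dots> \<in> sets M"
      using sets by (intro sets.compl_sets sets.finite_UN W(1)) (simp add: sets.compl_sets)
    finally show "{\<omega> \<in> space M. T \<omega> = t} \<in> sets M" .
  qed (use W(1) in simp)
  finally show "T -` A \<inter> space M \<in> sets M" .
qed

lemma expectation_comp_measure_preserving:
  fixes g :: "'b \<Rightarrow> real"
  assumes X: "fin_rv X" and T: "T \<in> measurable M M"
    and inv: "\<And>A. A \<in> sets M \<Longrightarrow> emeasure M (T -` A \<inter> space M) = emeasure M A"
  shows "expectation (\<lambda>\<omega>. g (X (T \<omega>))) = expectation (\<lambda>\<omega>. g (X \<omega>))"
proof -
  have d: "distr M M T = M"
    by (rule measure_eqI) (auto simp: emeasure_distr T inv)
  have "expectation (\<lambda>\<omega>. g (X (T \<omega>))) = integral\<^sup>L (distr M M T) (\<lambda>\<omega>. g (X \<omega>))"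
    by (rule integral_distr[OF T, symmetric], rule borel_measurable_integrable[OF integrable_fin_rv[OF X]])
  then show ?thesis by (simp add: d)
qed

text \<open>Subadditivity of conditional entropy given \<open>(C, D)\<close>, followed by dropping
  the foreign condition in each of the two terms.\<close>

lemma Ent_four:
  assumes A: "fin_rv A" and B: "fin_rv B" and C: "fin_rv C" and D: "fin_rv D"
  shows "Ent (\<lambda>\<omega>. ((A \<omega>, B \<omega>), (C \<omega>, D \<omega>))) - Ent (\<lambda>\<omega>. (C \<omega>, D \<omega>)) \<le>
    (Ent (\<lambda>\<omega>. (A \<omega>, C \<omega>)) - Ent C) + (Ent (\<lambda>\<omega>. (B \<omega>, D \<omega>)) - Ent D)"
proof -
  note P = fin_rv_Pair
  have "Ent (\<lambda>\<omega>. (A \<omega>, B \<omega>, (C \<omega>, D \<omega>))) + Ent (\<lambda>\<omega>. (C \<omega>, D \<omega>)) \<le>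
      Ent (\<lambda>\<omega>. (A \<omega>, (C \<omega>, D \<omega>))) + Ent (\<lambda>\<omega>. (B \<omega>, (C \<omega>, D \<omega>)))"
    by (rule Ent_submodular[OF A B P[OF C D]])
  moreover have "Ent (\<lambda>\<omega>. (A \<omega>, D \<omega>, C \<omega>)) + Ent C \<le> Ent (\<lambda>\<omega>. (A \<omega>, C \<omega>)) + Ent (\<lambda>\<omega>. (D \<omega>, C \<omega>))"
    by (rule Ent_submodular[OF A D C])
  moreover have "Ent (\<lambda>\<omega>. (B \<omega>, C \<omega>, D \<omega>)) + Ent D \<le> Ent (\<lambda>\<omega>. (B \<omega>, D \<omega>)) + Ent (\<lambda>\<omega>. (C \<omega>, D \<omega>))"
    by (rule Ent_submodular[OF B C D])
  moreover have "Ent (\<lambda>\<omega>. ((A \<omega>, B \<omega>), (C \<omega>, D \<omega>))) = Ent (\<lambda>\<omega>. (A \<omega>, B \<omega>, (C \<omega>, D \<omega>)))"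
    by (rule Ent_cong[OF P[OF A P[OF B P[OF C D]]]]) auto
  moreover have "Ent (\<lambda>\<omega>. (A \<omega>, (C \<omega>, D \<omega>))) = Ent (\<lambda>\<omega>. (A \<omega>, D \<omega>, C \<omega>))"
    by (rule Ent_cong[OF P[OF A P[OF D C]]]) auto
  moreover have "Ent (\<lambda>\<omega>. (D \<omega>, C \<omega>)) = Ent (\<lambda>\<omega>. (C \<omega>, D \<omega>))"
    by (rule Ent_cong[OF P[OF C D]]) auto
  ultimately show ?thesis by linarith
qed

text \<open>Indexed by points instead of values, so that every cell is nonempty; this is why
  partitions are compared with it after removing the empty set.\<close>

definition fibres :: "('a \<Rightarrow> 'b) \<Rightarrow> 'a set set" where
  "fibres X = range (\<lambda>\<omega>. X -` {X \<omega>})"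

lemma fibres_Pair: "{A \<inter> B | A B. A \<in> fibres X \<and> B \<in> fibres Y} - {{}} = fibres (\<lambda>\<omega>. (X \<omega>, Y \<omega>))"
proof
  show "{A \<inter> B | A B. A \<in> fibres X \<and> B \<in> fibres Y} - {{}} \<subseteq> fibres (\<lambda>\<omega>. (X \<omega>, Y \<omega>))"
  proof
    fix C assume "C \<in> {A \<inter> B | A B. A \<in> fibres X \<and> B \<in> fibres Y} - {{}}"
    then obtain a b \<omega> where "C = X -` {X a} \<inter> Y -` {Y b}" "\<omega> \<in> C" unfolding fibres_def by blast
    then have "C = (\<lambda>\<omega>. (X \<omega>, Y \<omega>)) -` {(X \<omega>, Y \<omega>)}" by auto
    then show "C \<in> fibres (\<lambda>\<omega>. (X \<omega>, Y \<omega>))" unfolding fibres_def by blast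
  qed
  show "fibres (\<lambda>\<omega>. (X \<omega>, Y \<omega>)) \<subseteq> {A \<inter> B | A B. A \<in> fibres X \<and> B \<in> fibres Y} - {{}}"
  proof
    fix C assume "C \<in> fibres (\<lambda>\<omega>. (X \<omega>, Y \<omega>))"
    then obtain \<omega> where C: "C = (\<lambda>\<omega>. (X \<omega>, Y \<omega>)) -` {(X \<omega>, Y \<omega>)}" unfolding fibres_def by blast
    then have "C = X -` {X \<omega>} \<inter> Y -` {Y \<omega>}" "\<omega> \<in> C" by auto
    then show "C \<in> {A \<inter> B | A B. A \<in> fibres X \<and> B \<in> fibres Y} - {{}}" unfolding fibres_def by blast
  qed
qed

lemma partition_entropy_eq_Ent:
  assumes X: "fin_rv X" and Q: "Q - {{}} = fibres X" and sp: "space M = UNIV"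
  shows "partition_entropy M Q = Ent X"
proof -
  have finQ: "finite Q"
  proof -
    have "fibres X = (\<lambda>a. X -` {a}) ` range X" unfolding fibres_def by auto
    then have "finite (fibres X)" using X by (simp add: fin_rv_def)
    then have "finite (insert {} (fibres X))" by simp
    then show ?thesis by (rule rev_finite_subset) (use Q in blast)
  qed
  have "(\<Sum>A\<in>Q. measure M A * ln (measure M A)) = (\<Sum>A\<in>fibres X. measure M A * ln (measure M A))"
    unfolding Q[symmetric] by (rule sum.mono_neutral_right) (use finQ in auto)
  also have "\<dots> = (\<Sum>a\<in>range X. pr X a * ln (pr X a))"
  proof (rule sum.reindex_cong[of "\<lambda>a. X -` {a}"])
    show "inj_on (\<lambda>a. X -` {a}) (range X)" by (rule inj_onI) blast
    show "fibres X = (\<lambda>a. X -` {a}) ` range X" unfolding fibres_def by auto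
  qed (simp add: pr_def sp)
  finally show ?thesis unfolding partition_entropy_def Ent_eq_sum[OF X] by (simp add: sum_negf)
qed

end

lemma linear_bound_nonpos:
  fixes x C :: real
  assumes "\<And>j::nat. real j * x \<le> C"
  shows "x \<le> 0"
proof (rule ccontr)
  assume "\<not> x \<le> 0"
  then obtain j where "C < real j * x" using ex_less_of_nat_mult[of x C] by auto
  with assms[of j] show False by simp
qed

lemma window_split:
  assumes "a \<le> b" "b \<le> c"
  shows "window a c x = window a c y \<longleftrightarrow> window a b x = window a b y \<and> window b c x = window b c y"
  unfolding window_eq_iff ivl_disj_un_two(3)[OF assms, symmetric] ball_Un ..

section \<open>Approximation of Borel sets by clopen sets\<close>

definition finitely_determined :: "'a config set \<Rightarrow> bool" where
  "finitely_determined A \<longleftrightarrow> (\<exists>M. \<forall>x y. agree M x y \<longrightarrow> x \<in> A \<longrightarrow> y \<in> A)"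

lemma finitely_determined_borel:
  fixes A :: "'a::discrete_topology config set"
  assumes "finitely_determined A"
  shows "A \<in> sets borel"
proof (rule borel_open)
  show "open A" unfolding open_config_iff
    using assms unfolding finitely_determined_def by blast
qed

lemma finitely_determined_compl: "finitely_determined A \<Longrightarrow> finitely_determined (- A)"
  unfolding finitely_determined_def using agree_sym by blast

lemma finitely_determined_Un:
  assumes "finitely_determined A" "finitely_determined B"
  shows "finitely_determined (A \<union> B)"
proof -
  obtain m n where m: "\<And>x y. agree m x y \<Longrightarrow> x \<in> A \<Longrightarrow> y \<in> A" and n: "\<And>x y. agree n x y \<Longrightarrow> x \<in> B \<Longrightarrow> y \<in> B"
    using assms unfolding finitely_determined_def by blast
  have "y \<in> A \<union> B" if "agree (max m n) x y" "x \<in> A \<union> B" for x y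
    using that m[of x y] n[of x y] agree_mono[OF that(1), of m] agree_mono[OF that(1), of n] by auto
  then show ?thesis unfolding finitely_determined_def by blast
qed

context rigid_system
begin

definition approximable :: "'a config set \<Rightarrow> bool" where
  "approximable B \<longleftrightarrow> B \<in> sets borel \<and>
     (\<forall>\<delta>>0. \<exists>A. finitely_determined A \<and> measure \<mu> (sym_diff B A) < \<delta>)"

lemma approximable_Un:
  assumes B: "approximable B" and C: "approximable C"
  shows "approximable (B \<union> C)"
  unfolding approximable_def
proof (intro conjI allI impI)
  have sB: "B \<in> sets borel" and sC: "C \<in> sets borel" using B C by (auto simp: approximable_def)
  then show "B \<union> C \<in> sets borel" by simp
  fix \<delta> :: real assume "0 < \<delta>"
  then have "0 < \<delta> / 2" by simp
  obtain A where A: "finitely_determined A" "measure \<mu> (sym_diff B A) < \<delta> / 2"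
    using B \<open>0 < \<delta> / 2\<close> unfolding approximable_def by blast
  obtain A' where A': "finitely_determined A'" "measure \<mu> (sym_diff C A') < \<delta> / 2"
    using C \<open>0 < \<delta> / 2\<close> unfolding approximable_def by blast
  have s: "sym_diff B A \<in> sets \<mu>" "sym_diff C A' \<in> sets \<mu>"
    using sB sC finitely_determined_borel[OF A(1)] finitely_determined_borel[OF A'(1)]
    by (simp_all add: sets.Un sets.Diff)
  have "measure \<mu> (sym_diff (B \<union> C) (A \<union> A')) \<le> measure \<mu> (sym_diff B A \<union> sym_diff C A')"
    by (rule finite_measure_mono) (use s in \<open>auto intro: sets.Un\<close>)
  also have "\<dots> \<le> measure \<mu> (sym_diff B A) + measure \<mu> (sym_diff C A')"
    by (rule measure_Un_le[OF s])
  finally have "measure \<mu> (sym_diff (B \<union> C) (A \<union> A')) < \<delta>" using A(2) A'(2) by simp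
  then show "\<exists>A. finitely_determined A \<and> measure \<mu> (sym_diff (B \<union> C) A) < \<delta>"
    using finitely_determined_Un[OF A(1) A'(1)] by blast
qed

lemma approximable_empty: "approximable {}"
  unfolding approximable_def
proof (intro conjI allI impI exI[of _ "{}"])
  show "finitely_determined {}" by (simp add: finitely_determined_def)
qed simp_all

text \<open>The approximable sets form a sigma-algebra containing the cylinders: a countable union
  is first cut to a finite one by continuity of the measure.\<close>

lemma borel_approximable:
  assumes "B \<in> sets borel"
  shows "approximable B"
  using assms unfolding borel_config_eq_sigma
proof (induction rule: sigma_sets.induct)
  case (Basic B)
  then obtain M x where B: "B = cylinder M x" by (auto simp: cylinders_def)
  then have "finitely_determined B"
    unfolding finitely_determined_def using agree_trans by blast
  then show ?case
    unfolding approximable_def using finitely_determined_borel by (intro conjI allI impI exI[of _ B]) auto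
next
  case Empty
  show ?case by (rule approximable_empty)
next
  case (Compl B)
  have "sym_diff (UNIV - B) (- A) = sym_diff B A" for A by blast
  then show ?case
    using Compl.IH finitely_determined_compl unfolding approximable_def
    by (metis (no_types, lifting) Compl_eq_Diff_UNIV borel_comp)
next
  case (Union B)
  have fin: "approximable (\<Union>i<n. B i)" for n
  proof (induction n)
    case (Suc n)
    then show ?case using approximable_Un[OF Suc Union.IH[of n]] by (simp add: lessThan_Suc Un_commute)
  qed (simp add: approximable_empty)
  have sB: "B i \<in> sets borel" for i using Union.IH[of i] by (simp add: approximable_def)
  let ?U = "\<Union>i. B i"
  have sU: "?U \<in> sets borel" using sB by blast
  show ?case
    unfolding approximable_def
  proof (intro conjI sU allI impI)
    fix \<delta> :: real assume "0 < \<delta>"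
    then have "0 < \<delta> / 2" by simp
    have "(\<lambda>n. measure \<mu> (\<Union>i<n. B i)) \<longlonglongrightarrow> measure \<mu> (\<Union>n. \<Union>i<n. B i)"
      
    proof (rule finite_Lim_measure_incseq)
      show "range (\<lambda>n. \<Union>i<n. B i) \<subseteq> sets \<mu>" using fin by (auto simp: approximable_def)
      show "incseq (\<lambda>n. \<Union>i<n. B i)" by (rule incseq_SucI) (auto simp: lessThan_Suc)
    qed
    moreover have "(\<Union>n. \<Union>i<n. B i) = ?U" by blast
    ultimately have "(\<lambda>n. measure \<mu> (\<Union>i<n. B i)) \<longlonglongrightarrow> measure \<mu> ?U" by simp
    then have "eventually (\<lambda>n. measure \<mu> ?U - \<delta> / 2 < measure \<mu> (\<Union>i<n. B i)) sequentially"
      by (rule order_tendstoD) (use \<open>0 < \<delta>\<close> in simp)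
    then obtain n where n: "measure \<mu> ?U - \<delta> / 2 < measure \<mu> (\<Union>i<n. B i)"
      by (auto simp: eventually_sequentially)
    let ?V = "\<Union>i<n. B i"
    have sV: "?V \<in> sets borel" using fin[of n] by (simp add: approximable_def)
    obtain A where A: "finitely_determined A" "measure \<mu> (sym_diff ?V A) < \<delta> / 2"
      using fin[of n] \<open>0 < \<delta> / 2\<close> unfolding approximable_def by blast
    have sA: "A \<in> sets borel" by (rule finitely_determined_borel[OF A(1)])
    have s: "?U - ?V \<in> sets \<mu>" "sym_diff ?V A \<in> sets \<mu>"
      using sU sV sA by (simp_all add: sets.Un sets.Diff)
    have "measure \<mu> (?U - ?V) = measure \<mu> ?U - measure \<mu> ?V"
      by (rule finite_measure_Diff) (use sU sV in auto)
    then have UV: "measure \<mu> (?U - ?V) < \<delta> / 2" using n by simp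
    have "measure \<mu> (sym_diff ?U A) \<le> measure \<mu> ((?U - ?V) \<union> sym_diff ?V A)"
      by (rule finite_measure_mono) (use s in \<open>auto intro: sets.Un\<close>)
    also have "\<dots> \<le> measure \<mu> (?U - ?V) + measure \<mu> (sym_diff ?V A)"
      by (rule measure_Un_le[OF s])
    finally have "measure \<mu> (sym_diff ?U A) < \<delta>" using UV A(2) by simp
    then show "\<exists>A. finitely_determined A \<and> measure \<mu> (sym_diff ?U A) < \<delta>" using A(1) by blast
  qed
qed

lemma fin_rv_window: "fin_rv (window a b)"
proof (rule fin_rvI[OF finite_range_window])
  fix A :: "'a config set"
  have "open (window a b -` A)"
    unfolding open_config_iff
  proof
    fix x assume x: "x \<in> window a b -` A"
    have w: "window a b y = window a b x" if "agree (nat \<bar>a\<bar> + nat \<bar>b\<bar>) x y" for y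
      unfolding window_eq_iff
    proof
      fix i assume i: "i \<in> {a..<b}"
      have "x i = y i" using that unfolding agree_def by (rule bspec) (use i in auto)
      then show "y i = x i" by simp
    qed
    then show "\<exists>M. cylinder M x \<subseteq> window a b -` A"
    proof (intro exI subsetI)
      fix y assume "y \<in> cylinder (nat \<bar>a\<bar> + nat \<bar>b\<bar>) x"
      then have "window a b y = window a b x" by (intro w) simp
      then show "y \<in> window a b -` A" using x by simp
    qed
  qed
  then show "window a b -` A \<inter> space \<mu> \<in> sets \<mu>" by (simp add: borel_open)
qed

lemma
  assumes "T \<in> borel_measurable borel" "invariant_measure T \<mu>" "fin_rv X"
  shows fin_rv_comp_invariant: "fin_rv (\<lambda>x. X (T x))"
    and Ent_comp_invariant: "Ent (\<lambda>x. X (T x)) = Ent X"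
    and expectation_comp_invariant: "expectation (\<lambda>x. g (X (T x)) :: real) = expectation (\<lambda>x. g (X x))"
proof -
  have T: "T \<in> measurable \<mu> \<mu>" using assms(1) by simp
  have inv: "emeasure \<mu> (T -` A \<inter> space \<mu>) = emeasure \<mu> A" if "A \<in> sets \<mu>" for A
    using assms(2) that by (simp add: invariant_measure_def)
  show "fin_rv (\<lambda>x. X (T x))" by (rule fin_rv_compose_measurable[OF assms(3) T])
  show "Ent (\<lambda>x. X (T x)) = Ent X" by (rule Ent_comp_measure_preserving[OF assms(3) T inv])
  show "expectation (\<lambda>x. g (X (T x))) = expectation (\<lambda>x. g (X x))"
    by (rule expectation_comp_measure_preserving[OF assms(3) T inv])
qed

lemma measurable_funpow_F: "F ^^ n \<in> borel_measurable borel"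
  by (rule T_funpow_measurable[OF sets_mu measurable_F F_invariant])

lemma funpow_F_invariant: "invariant_measure (F ^^ n) \<mu>"
  unfolding invariant_measure_def using invariant_funpow[OF sets_mu measurable_F F_invariant] by blast

lemmas fin_rv_F = fin_rv_comp_invariant[OF measurable_funpow_F funpow_F_invariant]
lemmas Ent_F = Ent_comp_invariant[OF measurable_funpow_F funpow_F_invariant]
lemmas expectation_F = expectation_comp_invariant[OF measurable_funpow_F funpow_F_invariant]

section \<open>Block entropies\<close>

definition block_entropy :: "nat \<Rightarrow> real" where
  "block_entropy n = Ent (window 0 (int n))"

lemma Ent_window:
  assumes "a \<le> b"
  shows "Ent (window a b) = block_entropy (nat (b - a))"
proof -
  have "block_entropy (nat (b - a)) = Ent (window 0 (b - a))" using assms by (simp add: block_entropy_def)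
  also have "\<dots> = Ent (\<lambda>x. window 0 (b - a) (shift_int a x))"
    by (rule Ent_comp_invariant[OF shift_int_measurable shift_int_invariant fin_rv_window, symmetric])
  also have "\<dots> = Ent (window a b)"
  proof (rule Ent_cong[OF fin_rv_window])
    fix x y :: "'a config"
    have "{a..<b} = (\<lambda>i. i + a) ` {0..<b - a}" by simp
    then show "window a b x = window a b y \<longleftrightarrow> window 0 (b - a) (shift_int a x) = window 0 (b - a) (shift_int a y)"
      unfolding window_eq_iff by (simp add: shift_int_def del: image_add_atLeastLessThan')
  qed
  finally show ?thesis by simp
qed

text \<open>Submodularity for the two end coordinates of a block of length \<open>j + 2\<close>,
  given the part between them.\<close>

lemma block_entropy_concave: "block_entropy (j + 2) - block_entropy (j + 1) \<le> block_entropy (j + 1) - block_entropy j"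
proof -
  let ?X = "window 0 1 :: 'a config \<Rightarrow> 'a config"
    and ?Y = "window (int j + 1) (int j + 2) :: 'a config \<Rightarrow> 'a config"
    and ?Z = "window 1 (int j + 1) :: 'a config \<Rightarrow> 'a config"
  have "Ent (\<lambda>x. (?X x, ?Y x, ?Z x)) + Ent ?Z \<le> Ent (\<lambda>x. (?X x, ?Z x)) + Ent (\<lambda>x. (?Y x, ?Z x))"
    by (rule Ent_submodular) (rule fin_rv_window)+
  moreover have "Ent (\<lambda>x. (?X x, ?Y x, ?Z x)) = Ent (window 0 (int j + 2))"
    by (rule Ent_cong[OF fin_rv_window])
      (auto simp: window_split[of 0 1 "int j + 2"] window_split[of 1 "int j + 1" "int j + 2"])
  moreover have "Ent (\<lambda>x. (?X x, ?Z x)) = Ent (window 0 (int j + 1))"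
    by (rule Ent_cong[OF fin_rv_window]) (auto simp: window_split[of 0 1 "int j + 1"])
  moreover have "Ent (\<lambda>x. (?Y x, ?Z x)) = Ent (window 1 (int j + 2))"
    by (rule Ent_cong[OF fin_rv_window]) (auto simp: window_split[of 1 "int j + 1" "int j + 2"])
  ultimately show ?thesis
    by (simp add: Ent_window nat_add_distrib)
qed

lemma block_entropy_mono: "block_entropy j \<le> block_entropy (Suc j)"
  unfolding block_entropy_def
  by (rule Ent_mono[OF fin_rv_window]) (simp add: window_eq_iff)

text \<open>The Kolmogorov-Sinai entropy of the shift, as the conditional entropy of a coordinate
  given its past. By concavity the increments decrease, so the limit is also their infimum.\<close>

definition shift_entropy :: real where
  "shift_entropy = lim (\<lambda>j. block_entropy (Suc j) - block_entropy j)"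

lemma
  shows shift_entropy_le: "shift_entropy \<le> block_entropy (Suc j) - block_entropy j"
    and shift_entropy_lim: "(\<lambda>j. block_entropy (Suc j) - block_entropy j) \<longlonglongrightarrow> shift_entropy"
    and shift_entropy_nonneg: "0 \<le> shift_entropy"
proof -
  let ?c = "\<lambda>j. block_entropy (Suc j) - block_entropy j"
  have dec: "decseq ?c"
    by (rule decseq_SucI) (use block_entropy_concave in simp)
  have "0 \<le> ?c i" for i using block_entropy_mono[of i] by simp
  then obtain L where L: "?c \<longlonglongrightarrow> L" "\<forall>i. L \<le> ?c i" using decseq_convergent[OF dec, of 0] by blast
  then have "shift_entropy = L" unfolding shift_entropy_def by (intro limI)
  then show "shift_entropy \<le> ?c j" "?c \<longlonglongrightarrow> shift_entropy" using L by blast+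
  show "0 \<le> shift_entropy" unfolding \<open>shift_entropy = L\<close> by (rule LIMSEQ_le_const[OF L(1)]) (use block_entropy_mono in simp)
qed

lemma block_entropy_growth: "real l * shift_entropy \<le> block_entropy (j + l) - block_entropy j"
proof (induction l)
  case (Suc l)
  then show ?case using shift_entropy_le[of "j + l"] by (simp add: algebra_simps)
qed simp

lemma block_entropy_sublinear:
  assumes "shift_entropy = 0" "0 < \<epsilon>"
  obtains J where "\<And>l. block_entropy (J + l) \<le> block_entropy J + real l * \<epsilon>"
proof -
  have "eventually (\<lambda>j. block_entropy (Suc j) - block_entropy j < \<epsilon>) sequentially"
    by (rule order_tendstoD(2)[OF shift_entropy_lim]) (use assms in simp)
  then obtain J where J: "\<And>j. j \<ge> J \<Longrightarrow> block_entropy (Suc j) - block_entropy j < \<epsilon>"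
    by (auto simp: eventually_sequentially)
  have "block_entropy (J + l) \<le> block_entropy J + real l * \<epsilon>" for l
  proof (induction l)
    case (Suc l)
    then show ?case using J[of "J + l"] by (simp add: algebra_simps)
  qed simp
  then show thesis by (rule that)
qed

abbreviation centred :: "nat \<Rightarrow> 'a config \<Rightarrow> 'a config" where
  "centred M \<equiv> window (- int M) (int M + 1)"

lemma Ent_centred: "Ent (centred M) = block_entropy (2 * M + 1)"
proof -
  have "nat (int M + 1 - (- int M)) = 2 * M + 1" by simp
  then show ?thesis by (subst Ent_window) simp_all
qed

text \<open>The conditional entropy of \<open>X\<close> given the central window.\<close>

definition defect :: "('a config \<Rightarrow> 'b) \<Rightarrow> nat \<Rightarrow> real" where
  "defect X M = Ent (\<lambda>x. (X x, centred M x)) - Ent (centred M)"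

lemma defect_determined:
  assumes "fin_rv X" "\<And>x y. X x = X y \<Longrightarrow> Y x = Y y"
  shows "defect Y M \<le> defect X M"
proof -
  have "Ent (\<lambda>x. (Y x, centred M x)) \<le> Ent (\<lambda>x. (X x, centred M x))"
  proof (rule Ent_mono[OF fin_rv_Pair[OF assms(1) fin_rv_window]])
    fix x y assume "(X x, centred M x) = (X y, centred M y)"
    then show "(Y x, centred M x) = (Y y, centred M y)" using assms(2)[of x y] by simp
  qed
  then show ?thesis by (simp add: defect_def)
qed

lemma defect_antimono:
  assumes X: "fin_rv X" and "M \<le> M'"
  shows "defect X M' \<le> defect X M"
proof -
  let ?w = "centred M" and ?w' = "centred M'"
  have ww: "?w x = ?w y" if "?w' x = ?w' y" for x y
    using that \<open>M \<le> M'\<close> by (simp add: window_eq_iff)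
  have "Ent (\<lambda>x. (X x, ?w' x, ?w x)) + Ent ?w \<le> Ent (\<lambda>x. (X x, ?w x)) + Ent (\<lambda>x. (?w' x, ?w x))"
    by (rule Ent_submodular[OF X fin_rv_window fin_rv_window])
  moreover have "Ent (\<lambda>x. (X x, ?w' x, ?w x)) = Ent (\<lambda>x. (X x, ?w' x))"
  proof (rule Ent_cong[OF fin_rv_Pair[OF X fin_rv_window]])
    fix x y
    show "(X x, ?w' x) = (X y, ?w' y) \<longleftrightarrow> (X x, ?w' x, ?w x) = (X y, ?w' y, ?w y)"
      using ww[of x y] by blast
  qed
  moreover have "Ent (\<lambda>x. (?w' x, ?w x)) = Ent ?w'"
  proof (rule Ent_cong[OF fin_rv_window])
    fix x y
    show "?w' x = ?w' y \<longleftrightarrow> (?w' x, ?w x) = (?w' y, ?w y)" using ww[of x y] by blast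
  qed
  ultimately show ?thesis by (simp add: defect_def)
qed

lemma defect_Pair:
  assumes X: "fin_rv X" and Y: "fin_rv Y"
  shows "defect (\<lambda>x. (X x, Y x)) M \<le> defect X M + defect Y M"
proof -
  have "Ent (\<lambda>x. (X x, Y x, centred M x)) + Ent (centred M) \<le>
      Ent (\<lambda>x. (X x, centred M x)) + Ent (\<lambda>x. (Y x, centred M x))"
    by (rule Ent_submodular[OF X Y fin_rv_window])
  moreover have "Ent (\<lambda>x. ((X x, Y x), centred M x)) = Ent (\<lambda>x. (X x, Y x, centred M x))"
    by (rule Ent_cong[OF fin_rv_Pair[OF X fin_rv_Pair[OF Y fin_rv_window]]]) auto
  ultimately show ?thesis by (simp add: defect_def)
qed

text \<open>A finitely determined approximation of \<open>B\<close> is known from a large window, so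
  only the indicator of the small set where the two differ costs entropy.\<close>

lemma defect_indicator:
  assumes B: "B \<in> sets borel" and "0 < \<epsilon>"
  shows "\<exists>M. defect (\<lambda>x. x \<in> B) M \<le> \<epsilon>"
proof -
  obtain \<delta> where \<delta>: "0 < \<delta>" "\<And>A. A \<in> sets \<mu> \<Longrightarrow> measure \<mu> A < \<delta> \<Longrightarrow> Ent (\<lambda>x. x \<in> A) < \<epsilon>"
    using Ent_indicator_small[OF \<open>0 < \<epsilon>\<close>] by metis
  obtain A where A: "finitely_determined A" "measure \<mu> (sym_diff B A) < \<delta>"
    using borel_approximable[OF B] \<delta>(1) unfolding approximable_def by blast
  obtain M where M: "\<And>x y. agree M x y \<Longrightarrow> x \<in> A \<Longrightarrow> y \<in> A"
    using A(1) unfolding finitely_determined_def by blast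
  let ?\<Delta> = "sym_diff B A"
  have s: "?\<Delta> \<in> sets \<mu>" using B finitely_determined_borel[OF A(1)] by (simp add: sets.Un sets.Diff)
  have fin: "fin_rv (\<lambda>x. x \<in> ?\<Delta>)" by (rule fin_rv_bool[OF s])
  have "Ent (\<lambda>x. (x \<in> B, centred M x)) \<le> Ent (\<lambda>x. (x \<in> ?\<Delta>, centred M x))"
  proof (rule Ent_mono[OF fin_rv_Pair[OF fin fin_rv_window]])
    fix x y assume e: "(x \<in> ?\<Delta>, centred M x) = (y \<in> ?\<Delta>, centred M y)"
    then have "agree M x y" by (simp add: agree_iff_window)
    then have "x \<in> A \<longleftrightarrow> y \<in> A" using M agree_sym by blast
    then show "(x \<in> B, centred M x) = (y \<in> B, centred M y)" using e by auto
  qed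
  also have "\<dots> \<le> Ent (\<lambda>x. x \<in> ?\<Delta>) + Ent (centred M)"
    by (rule Ent_Pair_le_add[OF fin fin_rv_window])
  finally have "defect (\<lambda>x. x \<in> B) M \<le> \<epsilon>" using \<delta>(2)[OF s A(2)] by (simp add: defect_def)
  then show ?thesis ..
qed

lemma defect_fin_rv:
  assumes X: "fin_rv X" and "0 < \<epsilon>"
  shows "\<exists>M. defect X M \<le> \<epsilon>"
proof -
  \<comment> \<open>Remembers the value of \<open>X\<close> only if it lies in \<open>V\<close>;
    enlarging \<open>V\<close> by one value costs one further indicator.\<close>
  let ?Y = "\<lambda>V x. if X x \<in> V then Some (X x) else None"
  have finY: "fin_rv (?Y V)" for V by (rule fin_rv_comp[OF X])
  have "\<forall>\<epsilon>>0. \<exists>M. defect (?Y V) M \<le> \<epsilon>" if "finite V" for V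
    using that
  proof (induction V)
    case empty
    have "fin_rv (\<lambda>_. None :: 'b option)" using finY[of "{}"] by simp
    have "Ent (\<lambda>x. (None :: 'b option, centred 0 x)) = Ent (centred 0)"
      by (rule Ent_cong[OF fin_rv_window]) simp
    then have "defect (\<lambda>_. None :: 'b option) 0 = 0" by (simp add: defect_def)
    then show ?case by (auto intro!: exI[of _ 0])
  next
    case (insert v V)
    show ?case
    proof (intro allI impI)
      fix \<epsilon> :: real assume "0 < \<epsilon>"
      then have e2: "0 < \<epsilon> / 2" by simp
      obtain M where M: "defect (?Y V) M \<le> \<epsilon> / 2" using insert.IH e2 by blast
      let ?B = "X -` {v}"
      have B: "?B \<in> sets borel" using fin_rv_sets[OF X, of "{v}"] by simp
      obtain M' where M': "defect (\<lambda>x. x \<in> ?B) M' \<le> \<epsilon> / 2" using defect_indicator[OF B e2] by blast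
      have finB: "fin_rv (\<lambda>x. x \<in> ?B)" by (rule fin_rv_bool) (use B in simp)
      let ?m = "max M M'"
      have "defect (?Y (insert v V)) ?m \<le> defect (\<lambda>x. (?Y V x, x \<in> ?B)) ?m"
        by (rule defect_determined[OF fin_rv_Pair[OF finY finB]]) (auto split: if_splits)
      also have "\<dots> \<le> defect (?Y V) ?m + defect (\<lambda>x. x \<in> ?B) ?m"
        by (rule defect_Pair[OF finY finB])
      also have "\<dots> \<le> \<epsilon> / 2 + \<epsilon> / 2"
        using defect_antimono[OF finY, of M ?m V] defect_antimono[OF finB, of M' ?m] M M' by simp
      finally have "defect (?Y (insert v V)) ?m \<le> \<epsilon>" by simp
      then show "\<exists>M. defect (?Y (insert v V)) M \<le> \<epsilon>" ..
    qed
  qed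
  from this[of "range X"] obtain M where M: "defect (?Y (range X)) M \<le> \<epsilon>"
    using X \<open>0 < \<epsilon>\<close> unfolding fin_rv_def by blast
  have "defect X M \<le> defect (?Y (range X)) M"
    by (rule defect_determined[OF finY]) simp
  with M show ?thesis by (intro exI[of _ M]) linarith
qed

end


section \<open>Entropy of the cellular automaton\<close>

context rigid_system
begin

lemma prob_UNIV [simp]: "prob UNIV = 1"
  using prob_space by simp

text \<open>The central windows along \<open>n\<close> steps of the orbit are determined by one
  window of the starting point, of length linear in \<open>n\<close>, and block entropies are
  sublinear here. Passing from the partition to central windows loses an arbitrarily small amount
  per step.\<close>

lemma entropy_wrt_partition_eq_0:
  assumes shift_entropy0: "shift_entropy = 0" and P: "finite_partition \<mu> P"
  shows "entropy_wrt_partition \<mu> F P = 0"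
proof -
  have finP: "finite P" and sP: "\<And>A. A \<in> P \<Longrightarrow> A \<in> sets \<mu>" and UP: "\<Union>P = UNIV" and dP: "disjoint P"
    using P by (auto simp: finite_partition_def)
  define X where "X x = (THE A. A \<in> P \<and> x \<in> A)" for x
  have X_eq: "X x = A" if "A \<in> P" "x \<in> A" for x A
    unfolding X_def
  proof (rule the_equality)
    show "B = A" if B: "B \<in> P \<and> x \<in> B" for B
    proof (rule ccontr)
      assume "B \<noteq> A"
      then have "B \<inter> A = {}" using disjointD[OF dP] B \<open>A \<in> P\<close> by blast
      then show False using B \<open>x \<in> A\<close> by blast
    qed
  qed (use that in blast)
  have X_P: "X x \<in> P" "x \<in> X x" for x
  proof -
    have "x \<in> \<Union>P" by (simp add: UP)
    then obtain A where A: "A \<in> P" "x \<in> A" by (rule UnionE)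
    show "X x \<in> P" "x \<in> X x" unfolding X_eq[OF A] by (rule A)+
  qed
  have vX: "X -` {A} = A" if "A \<in> P" for A
  proof (intro equalityI subsetI)
    show "x \<in> A" if "x \<in> X -` {A}" for x using X_P(2)[of x] that by simp
    show "x \<in> X -` {A}" if "x \<in> A" for x using X_eq[OF \<open>A \<in> P\<close> that] by simp
  qed
  have finX: "fin_rv X"
  proof (rule fin_rvI)
    show "finite (range X)" by (rule finite_subset[OF _ finP]) (use X_P in auto)
    fix S
    have "X -` S \<inter> space \<mu> = (\<Union>A\<in>P \<inter> S. A)"
    proof (intro equalityI subsetI)
      show "x \<in> (\<Union>A\<in>P \<inter> S. A)" if "x \<in> X -` S \<inter> space \<mu>" for x
        using that X_P[of x] by (intro UN_I[of "X x"]) simp_all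
      show "x \<in> X -` S \<inter> space \<mu>" if x: "x \<in> (\<Union>A\<in>P \<inter> S. A)" for x
      proof -
        obtain A where "A \<in> P" "A \<in> S" "x \<in> A" using x by blast
        then show ?thesis using X_eq by simp
      qed
    qed
    also have "\<dots> \<in> sets \<mu>" by (rule sets.finite_UN) (use finP sP in auto)
    finally show "X -` S \<inter> space \<mu> \<in> sets \<mu>" .
  qed
  define Xs where "Xs n x = map (\<lambda>i. X ((F ^^ i) x)) [0..<n]" for n x
  have finXs: "fin_rv (Xs n)" for n
  proof (induction n)
    case 0
    show ?case by (rule fin_rv_determined[OF finX]) (simp add: Xs_def)
  next
    case (Suc n)
    show ?case
      by (rule fin_rv_determined[OF fin_rv_Pair[OF Suc fin_rv_F[OF finX, of n]]]) (simp add: Xs_def)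
  qed
  have join: "iterated_join \<mu> F P n - {{}} = fibres (Xs n)" for n
  proof (induction n)
    case 0
    have "Xs 0 -` {Xs 0 x} = UNIV" for x by (auto simp: Xs_def)
    then show ?case by (auto simp: fibres_def)
  next
    case (Suc n)
    let ?V = "partition_vimage \<mu> (F ^^ n) P" and ?J = "iterated_join \<mu> F P n"
    have v: "(\<lambda>x. X ((F ^^ n) x)) -` {A} = (F ^^ n) -` A" if "A \<in> P" for A
      using vX[OF that] by blast
    have V: "?V - {{}} = fibres (\<lambda>x. X ((F ^^ n) x))"
    proof
      show "?V - {{}} \<subseteq> fibres (\<lambda>x. X ((F ^^ n) x))"
      proof
        fix B assume "B \<in> ?V - {{}}"
        then obtain A x where A: "A \<in> P" "B = (F ^^ n) -` A" "x \<in> B" by (auto simp: partition_vimage_def)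
        then have "X ((F ^^ n) x) = A" using X_eq by simp
        then have "B = (\<lambda>x. X ((F ^^ n) x)) -` {X ((F ^^ n) x)}" using v[OF A(1)] A(2) by simp
        then show "B \<in> fibres (\<lambda>x. X ((F ^^ n) x))" unfolding fibres_def by (rule range_eqI[of _ _ x])
      qed
      show "fibres (\<lambda>x. X ((F ^^ n) x)) \<subseteq> ?V - {{}}"
      proof
        fix B assume "B \<in> fibres (\<lambda>x. X ((F ^^ n) x))"
        then obtain x where B: "B = (\<lambda>x. X ((F ^^ n) x)) -` {X ((F ^^ n) x)}" unfolding fibres_def by blast
        then have "B = (F ^^ n) -` X ((F ^^ n) x)" using v[OF X_P(1)] by simp
        moreover have "x \<in> B" using B by simp
        ultimately show "B \<in> ?V - {{}}" unfolding partition_vimage_def using X_P(1) by auto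
      qed
    qed
    have "iterated_join \<mu> F P (Suc n) - {{}} = {A \<inter> B | A B. A \<in> ?J \<and> B \<in> ?V} - {{}}"
      by (simp add: partition_join_def)
    also have "\<dots> = {A \<inter> B | A B. A \<in> ?J - {{}} \<and> B \<in> ?V - {{}}} - {{}}" by blast
    also have "\<dots> = fibres (\<lambda>x. (Xs n x, X ((F ^^ n) x)))" unfolding Suc V by (rule fibres_Pair)
    also have "\<dots> = fibres (Xs (Suc n))"
    proof -
      have "(\<lambda>x. (Xs n x, X ((F ^^ n) x))) -` {(Xs n y, X ((F ^^ n) y))} = Xs (Suc n) -` {Xs (Suc n) y}" for y
        by (auto simp: Xs_def)
      then show ?thesis unfolding fibres_def by simp
    qed
    finally show ?case .
  qed
  have pe: "partition_entropy \<mu> (iterated_join \<mu> F P n) = Ent (Xs n)" for n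
    by (rule partition_entropy_eq_Ent[OF finXs join space_mu])
  \<comment> \<open>Bounds how far one step of \<open>F\<close> looks in either direction.\<close>
  define R where "R = nat \<bar>r\<bar> + nat \<bar>s\<bar>"
  have bound: "Ent (Xs n) \<le> block_entropy (2 * M + 1 + 2 * n * R) + real n * \<epsilon>" if M: "defect X M \<le> \<epsilon>" for n M \<epsilon>
  proof -
    define Vs where "Vs n x = map (\<lambda>i. centred M ((F ^^ i) x)) [0..<n]" for n x
    have finVs: "fin_rv (Vs n)" for n
    proof (induction n)
      case 0
      show ?case by (rule fin_rv_determined[OF finX]) (simp add: Vs_def)
    next
      case (Suc n)
      show ?case
        by (rule fin_rv_determined[OF fin_rv_Pair[OF Suc
              fin_rv_F[OF fin_rv_window[of "- int M" "int M + 1"], of n]]])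
          (simp add: Vs_def)
    qed
    \<comment> \<open>The losses add up by \<open>Ent_four\<close>; by invariance of
      \<open>\<mu>\<close> under \<open>F\<close> each step contributes the same defect.\<close>
    have rel: "Ent (\<lambda>x. (Xs n x, Vs n x)) - Ent (Vs n) \<le> real n * \<epsilon>" for n
    proof (induction n)
      case 0
      have "Ent (\<lambda>x. (Xs 0 x, Vs 0 x)) = Ent (Vs 0)"
        by (rule Ent_cong[OF finVs]) (simp add: Xs_def Vs_def)
      then show ?case by simp
    next
      case (Suc n)
      let ?x = "\<lambda>x. X ((F ^^ n) x)" and ?v = "\<lambda>x. centred M ((F ^^ n) x)"
      have fx: "fin_rv ?x" and fv: "fin_rv ?v" by (rule fin_rv_F[OF finX], rule fin_rv_F[OF fin_rv_window])
      have "Ent (\<lambda>x. (Xs (Suc n) x, Vs (Suc n) x)) = Ent (\<lambda>x. ((Xs n x, ?x x), (Vs n x, ?v x)))"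
        by (rule Ent_cong[OF fin_rv_Pair[OF fin_rv_Pair[OF finXs fx] fin_rv_Pair[OF finVs fv]]])
          (simp add: Xs_def Vs_def)
      moreover have "Ent (Vs (Suc n)) = Ent (\<lambda>x. (Vs n x, ?v x))"
        by (rule Ent_cong[OF fin_rv_Pair[OF finVs fv]]) (simp add: Vs_def)
      moreover have "Ent (\<lambda>x. (?x x, ?v x)) - Ent ?v = defect X M"
        using Ent_F[OF fin_rv_Pair[OF finX fin_rv_window[of "- int M" "int M + 1"]], of n]
          Ent_F[OF fin_rv_window[of "- int M" "int M + 1"], of n]
        by (simp add: defect_def)
      ultimately show ?case
        using Ent_four[OF finXs fx finVs fv, of n n] Suc M by (simp add: algebra_simps)
    qed
    have "Ent (Xs n) \<le> Ent (\<lambda>x. (Xs n x, Vs n x))"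
      by (rule Ent_mono[OF fin_rv_Pair[OF finXs finVs]]) simp
    moreover have "Ent (Vs n) \<le> block_entropy (2 * M + 1 + 2 * n * R)"
    proof -
      let ?a = "- int M - int (n * R)" and ?b = "int M + 1 + int (n * R)"
      have "Ent (Vs n) \<le> Ent (window ?a ?b)"
      proof (rule Ent_mono[OF fin_rv_window])
        fix x y :: "'a config" assume w: "window ?a ?b x = window ?a ?b y"
        have "centred M ((F ^^ i) x) = centred M ((F ^^ i) y)" if "i < n" for i
          unfolding window_eq_iff
        proof
          fix j assume j: "j \<in> {- int M..<int M + 1}"
          have le: "\<bar>int i * t\<bar> \<le> int (n * R)" if "\<bar>t\<bar> \<le> int R" for t
            using that \<open>i < n\<close> by (simp add: abs_mult mult_mono)
          have rs: "\<bar>int i * r\<bar> \<le> int (n * R)" "\<bar>int i * s\<bar> \<le> int (n * R)"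
            by (rule le, simp add: R_def)+
          show "(F ^^ i) x j = (F ^^ i) y j"
          proof (rule biperm_local[OF biperm_funpow[OF biperm_F]])
            fix l assume l: "j + int i * r \<le> l" "l \<le> j + int i * s"
            have "- int M \<le> j" "j < int M + 1" using j by simp_all
            then have "?a \<le> l" "l < ?b" using l rs by linarith+
            then have "l \<in> {?a..<?b}" unfolding atLeastLessThan_iff ..
            with w show "x l = y l" unfolding window_eq_iff by (rule bspec)
          qed
        qed
        then show "Vs n x = Vs n y" by (simp add: Vs_def)
      qed
      also have "\<dots> = block_entropy (nat (?b - ?a))" by (rule Ent_window) simp
      also have "?b - ?a = int (2 * M + 1 + 2 * n * R)" by (simp add: algebra_simps)
      also have "nat \<dots> = 2 * M + 1 + 2 * n * R" by (rule nat_int)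
      finally show ?thesis .
    qed
    ultimately show ?thesis using rel[of n] by linarith
  qed
  have "(\<lambda>n. Ent (Xs n) / real n) \<longlonglongrightarrow> 0"
  proof (rule LIMSEQ_I)
    fix e :: real assume "0 < e"
    \<comment> \<open>Each step costs \<open>\<epsilon>\<close> for the defect and
      \<open>\<epsilon>\<close> for each of the \<open>2 * R\<close> coordinates by which the window
      grows: together \<open>e / 2\<close>. The other half of \<open>e\<close> absorbs the constant
      \<open>C\<close>.\<close>
    define \<epsilon> where "\<epsilon> = e / (2 * (1 + 2 * real R))"
    have R0: "0 < 1 + 2 * real R" by (rule add_pos_nonneg) simp_all
    have "e / (2 * c) * c = e / 2" if "0 < c" for c using that by simp
    from this[OF R0] have \<epsilon>: "0 < \<epsilon>" "\<epsilon> * (1 + 2 * real R) = e / 2"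
      using \<open>0 < e\<close> R0 by (simp_all only: \<epsilon>_def, intro divide_pos_pos mult_pos_pos) simp_all
    obtain M where M: "defect X M \<le> \<epsilon>" using defect_fin_rv[OF finX \<epsilon>(1)] by blast
    obtain J where J: "\<forall>l. block_entropy (J + l) \<le> block_entropy J + real l * \<epsilon>"
      by (rule block_entropy_sublinear[OF shift_entropy0 \<epsilon>(1)]) blast
    define C where "C = block_entropy J + (2 * real M + 1) * \<epsilon>"
    have mono: "incseq block_entropy" by (rule incseq_SucI) (rule block_entropy_mono)
    have up: "Ent (Xs n) \<le> C + real n * (e / 2)" for n
    proof -
      let ?l = "2 * M + 1 + 2 * n * R"
      have "block_entropy ?l \<le> block_entropy (J + ?l)" by (rule incseqD[OF mono]) simp
      also have "\<dots> \<le> block_entropy J + real ?l * \<epsilon>" by (rule J[rule_format])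
      finally have "Ent (Xs n) \<le> block_entropy J + real ?l * \<epsilon> + real n * \<epsilon>" using bound[OF M, of n] by simp
      also have "\<dots> = C + real n * (\<epsilon> * (1 + 2 * real R))" by (simp add: C_def algebra_simps)
      finally show ?thesis unfolding \<epsilon>(2) .
    qed
    obtain N where N: "2 * C / e < real N" using reals_Archimedean2 by blast
    show "\<exists>no. \<forall>n\<ge>no. norm (Ent (Xs n) / real n - 0) < e"
    proof (intro exI allI impI)
      fix n assume n: "Suc N \<le> n"
      then have "0 < real n" "real N < real n" by simp_all
      then have "2 * C / e < real n" using N by linarith
      then have "C < real n * (e / 2)" using \<open>0 < e\<close> by (simp add: field_simps)
      moreover have "real n * (e / 2) + real n * (e / 2) = e * real n" by simp
      ultimately have "Ent (Xs n) < e * real n" using up[of n] by linarith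
      then show "norm (Ent (Xs n) / real n - 0) < e"
        using \<open>0 < real n\<close> Ent_nonneg[of "Xs n"] by (simp add: pos_divide_less_eq)
    qed
  qed
  then show ?thesis unfolding entropy_wrt_partition_def pe by (rule limI)
qed

lemma shift_entropy_pos:
  assumes "ks_entropy \<mu> F > 0"
  shows "0 < shift_entropy"
proof (rule ccontr)
  assume "\<not> 0 < shift_entropy"
  then have "shift_entropy = 0" using shift_entropy_nonneg by simp
  then have "ks_entropy \<mu> F \<le> 0"
    unfolding ks_entropy_def by (intro SUP_least) (simp add: entropy_wrt_partition_eq_0)
  with assms show False by simp
qed

section \<open>Growth of the supports of the conditional measures\<close>

lemma fin_rv_stab: "fin_rv (stab n)"
  by (rule fin_rv_set_valued[OF finite_D ft.stab_subset]) (simp add: ft.stab_measurable)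

lemma fin_rv_supp: "fin_rv (supp n)"
  by (rule fin_rv_set_valued[OF finite_D ft.supp_subset]) (simp add: ft.supp_measurable)

lemma one_stab: "\<one> \<in> stab n x"
  by (rule subgroup.one_closed[OF ft.subgroup_stab])

lemma card_stab_ge_1: "1 \<le> card (stab n x)"
  using one_stab[of n x] ft.finite_stab[of n x] by (auto simp: Suc_le_eq card_gt_0_iff)

text \<open>
  The set \<open>T x\<close> of the words of the translates of \<open>x\<close> charged by its conditional measure is a function
  of \<open>F\<^sup>n x\<close>, so a large window of \<open>F\<^sup>n x\<close> almost determines it. Once \<open>T x\<close> is known, the word of \<open>x\<close>
  contributes at most \<open>ln |T x|\<close>, while together with the window it determines a window of \<open>x\<close> that is
  longer by \<open>n (s - r)\<close>.
\<close>

lemma supp_entropy_bound: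
  "real n * real_of_int (s - r) * shift_entropy \<le> expectation (\<lambda>x. ln (card (supp n x)))"
proof -
  define a b where "a = int n * r" and "b = int n * s"
  have bp: "biperm a b (F ^^ n)" unfolding a_def b_def by (rule biperm_funpow[OF biperm_F])
  have ab: "a \<le> b" by (rule biperm_le[OF bp])
  let ?W = "window a b :: 'a config \<Rightarrow> 'a config"
  define T where "T x = (\<lambda>d. ?W (d \<otimes> x)) ` supp n x" for x
  have finT: "finite (T x)" for x unfolding T_def using ft.finite_supp by simp
  have fT: "fin_rv T"
  proof (rule fin_rv_set_valued[OF finite_range_window[of a b]])
    show "T x \<subseteq> range (window a b)" for x by (auto simp: T_def)
    fix w :: "'a config"
    have "{x \<in> space \<mu>. w \<in> T x} = (\<Union>d\<in>D n. {x. d \<in> supp n x} \<inter> (\<lambda>x. d \<otimes> x) -` (?W -` {w}))"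
      using ft.supp_subset by (auto simp: T_def)
    also have "\<dots> \<in> sets \<mu>"
    proof (rule sets.finite_UN[OF finite_D])
      fix d
      have "?W -` {w} \<in> sets borel" using fin_rv_sets[OF fin_rv_window[of a b], of "{w}"] by simp
      then have "(\<lambda>x. d \<otimes> x) -` (?W -` {w}) \<in> sets borel" by (rule translate_vimage_sets)
      then show "{x. d \<in> supp n x} \<inter> (\<lambda>x. d \<otimes> x) -` (?W -` {w}) \<in> sets \<mu>"
        using ft.supp_measurable by (simp add: sets.Int)
    qed
    finally show "{x \<in> space \<mu>. w \<in> T x} \<in> sets \<mu>" .
  qed
  have T_translate: "T (e \<otimes> x) = T x" if e: "e \<in> D n" for e x
  proof
    show "T (e \<otimes> x) \<subseteq> T x"
    proof
      fix w assume "w \<in> T (e \<otimes> x)"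
      then obtain d where d: "d \<in> supp n (e \<otimes> x)" "w = ?W (d \<otimes> (e \<otimes> x))" by (auto simp: T_def)
      then have "d \<otimes> e \<in> supp n x" using e ft.mult_D by (auto simp: ft.supp_def m_assoc)
      moreover have "w = ?W ((d \<otimes> e) \<otimes> x)" using d(2) by (simp add: m_assoc)
      ultimately show "w \<in> T x" unfolding T_def by blast
    qed
    show "T x \<subseteq> T (e \<otimes> x)"
    proof
      fix w assume "w \<in> T x"
      then obtain d where d: "d \<in> supp n x" "w = ?W (d \<otimes> x)" by (auto simp: T_def)
      have eq: "(d \<otimes> inv e) \<otimes> (e \<otimes> x) = d \<otimes> x" by (simp add: m_assoc)
      have "d \<otimes> inv e \<in> D n" using d(1) e ft.supp_subset by (blast intro: ft.mult_D ft.inv_D)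
      then have "d \<otimes> inv e \<in> supp n (e \<otimes> x)" using d(1) unfolding ft.supp_def mem_Collect_eq eq by blast
      then show "w \<in> T (e \<otimes> x)" unfolding T_def d(2) eq[symmetric] by blast
    qed
  qed
  let ?g = "fibre_section a b (F ^^ n) \<one>"
  \<comment> \<open>\<open>T\<close> is constant on the cosets of \<open>D n\<close>, that is, on
    the fibres of \<open>F ^^ n\<close>; evaluating it on a section gives a Borel function of the
    image.\<close>
  define T' where "T' y = T (?g y)" for y
  have gm: "?g \<in> measurable \<mu> \<mu>"
    using borel_measurable_continuous_onI[OF continuous_fibre_section[OF bp]] by simp
  have fT': "fin_rv T'" unfolding T'_def by (rule fin_rv_compose_measurable[OF fT gm])
  have TT': "T x = T' ((F ^^ n) x)" for x
  proof -
    let ?e = "?g ((F ^^ n) x) \<otimes> inv x"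
    have "(F ^^ n) ?e = \<one>"
      by (simp add: funpow_F_mult funpow_F_inv image_fibre_section[OF bp])
    then have "?e \<in> D n" by (simp add: D_def)
    from T_translate[OF this, of x] show ?thesis by (simp add: T'_def m_assoc)
  qed
  have mem: "AE x in \<mu>. ?W x \<in> T x"
    using ft.AE_rho_pos[of n]
  proof eventually_elim
    case (elim x)
    then have "\<one> \<in> supp n x" using ft.one_D by (simp add: ft.supp_def)
    then show ?case unfolding T_def by (intro image_eqI[of _ _ \<one>]) simp_all
  qed
  have "expectation (\<lambda>x. ln (card (T x))) \<le> expectation (\<lambda>x. ln (card (supp n x)))"
  proof (rule integral_mono_AE)
    show "integrable \<mu> (\<lambda>x. ln (real (card (T x))))" "integrable \<mu> (\<lambda>x. ln (real (card (supp n x))))"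
      by (rule integrable_fin_rv[OF fT], rule integrable_fin_rv[OF fin_rv_supp])
    show "AE x in \<mu>. ln (real (card (T x))) \<le> ln (real (card (supp n x)))"
      using mem
    proof eventually_elim
      case (elim x)
      have "0 < card (T x)" using elim finT[of x] by (auto simp: card_gt_0_iff)
      moreover have "card (T x) \<le> card (supp n x)" unfolding T_def by (rule card_image_le[OF ft.finite_supp])
      ultimately show ?case by (subst ln_le_cancel_iff) linarith+
    qed
  qed
  moreover have "real n * real_of_int (s - r) * shift_entropy \<le> expectation (\<lambda>x. ln (card (T x))) + \<epsilon>" if e0: "0 < \<epsilon>" for \<epsilon>
  proof -
    obtain M where M: "defect T' M \<le> \<epsilon>" using defect_fin_rv[OF fT' e0] by blast
    let ?v = "\<lambda>x. centred M ((F ^^ n) x)"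
    have fv: "fin_rv ?v" by (rule fin_rv_F[OF fin_rv_window])
    define N where "N = nat (b - a)"
    have N: "real N = real n * real_of_int (s - r)"
      using ab by (simp add: N_def a_def b_def right_diff_distrib)
    let ?L = "window (- int M + a) (int M + 1 + b) :: 'a config \<Rightarrow> 'a config"
    have "block_entropy (2 * M + 1 + N) = Ent ?L"
    proof -
      have "(int M + 1 + b) - (- int M + a) = int (2 * M + 1 + N)" using ab by (simp add: N_def)
      then have "nat ((int M + 1 + b) - (- int M + a)) = 2 * M + 1 + N" by (simp only: nat_int)
      then show ?thesis using ab by (subst Ent_window) simp_all
    qed
    also have "\<dots> \<le> Ent (\<lambda>x. (?W x, ?v x, T x))"
    proof (rule Ent_mono[OF fin_rv_Pair[OF fin_rv_window fin_rv_Pair[OF fv fT]]])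
      fix x y assume e: "(?W x, ?v x, T x) = (?W y, ?v y, T y)"
      show "?L x = ?L y"
        unfolding window_eq_iff
      proof
        fix i assume i: "i \<in> {- int M + a..<int M + 1 + b}"
        show "x i = y i"
        proof (rule biperm_window[OF bp, of x y M "M + 1"])
          show "x j = y j" if "a \<le> j" "j < b" for j using e that by (simp add: window_eq_iff)
          show "(F ^^ n) x j = (F ^^ n) y j" if "- int M \<le> j" "j < int (M + 1)" for j
            using e that by (simp add: window_eq_iff)
        qed (use i in simp_all)
      qed
    qed
    finally have 1: "block_entropy (2 * M + 1 + N) \<le> Ent (\<lambda>x. (?W x, ?v x, T x))" .
    \<comment> \<open>Given \<open>T\<close>, the word and the image window are separated: the first
      costs at most the mean of \<open>ln (card (T x))\<close>, the second together with
      \<open>T\<close> at most a block entropy and \<open>\<epsilon>\<close>.\<close>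
    have 2: "Ent (\<lambda>x. (?W x, ?v x, T x)) + Ent T \<le> Ent (\<lambda>x. (?W x, T x)) + Ent (\<lambda>x. (?v x, T x))"
      by (rule Ent_submodular[OF fin_rv_window fv fT])
    have 3: "Ent (\<lambda>x. (?W x, T x)) \<le> Ent T + expectation (\<lambda>x. ln (card (T x)))"
      by (rule Ent_Pair_le_card[OF fin_rv_window fT finT mem])
    have "Ent (\<lambda>x. (?v x, T x)) = Ent (\<lambda>x. (T' ((F ^^ n) x), ?v x))"
      unfolding TT' by (rule Ent_cong[OF fin_rv_Pair[OF fin_rv_F[OF fT'] fv]]) auto
    also have "\<dots> = Ent (\<lambda>x. (T' x, centred M x))"
      by (rule Ent_F[OF fin_rv_Pair[OF fT' fin_rv_window]])
    also have "\<dots> \<le> block_entropy (2 * M + 1) + \<epsilon>" using M by (simp add: defect_def Ent_centred)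
    finally have "Ent (\<lambda>x. (?v x, T x)) \<le> block_entropy (2 * M + 1) + \<epsilon>" .
    with 1 2 3 block_entropy_growth[of N "2 * M + 1"] show ?thesis unfolding N by linarith
  qed
  ultimately have "real n * real_of_int (s - r) * shift_entropy \<le> expectation (\<lambda>x. ln (card (supp n x))) + \<epsilon>"
    if "0 < \<epsilon>" for \<epsilon>
    using that by (meson add_right_mono order_trans)
  then show ?thesis by (rule field_le_epsilon)
qed

section \<open>Growth of the stabilisers and of their limit\<close>

definition stab_entropy :: "nat \<Rightarrow> real" where
  "stab_entropy n = expectation (\<lambda>x. ln (card (stab n x)))"

definition stab_ker_entropy :: "nat \<Rightarrow> nat \<Rightarrow> real" where
  "stab_ker_entropy m n = expectation (\<lambda>x. ln (card (stab n x \<inter> D m)))"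

lemma fin_rv_stab_D: "fin_rv (\<lambda>x. stab n x \<inter> D m)"
  by (rule fin_rv_comp[OF fin_rv_stab])

text \<open>Up to the factor \<open>CARD('a)\<close> the stabiliser is as large as the support; in
  the logarithm this is a constant, harmless against linear growth.\<close>

lemma stab_entropy_lower: "real n * real_of_int (s - r) * shift_entropy - ln (CARD('a)) \<le> stab_entropy n"
proof -
  have "expectation (\<lambda>x. ln (card (supp n x))) \<le> expectation (\<lambda>x. ln (CARD('a)) + ln (card (stab n x)))"
  proof (rule integral_mono_AE)
    show "integrable \<mu> (\<lambda>x. ln (real (card (supp n x))))"
      "integrable \<mu> (\<lambda>x. ln (real CARD('a)) + ln (real (card (stab n x))))"
      by (rule integrable_fin_rv[OF fin_rv_supp], rule integrable_fin_rv[OF fin_rv_stab])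
    show "AE x in \<mu>. ln (real (card (supp n x))) \<le> ln (real CARD('a)) + ln (real (card (stab n x)))"
      using AE_card_supp_le[of n] ft.AE_rho_pos[of n]
    proof eventually_elim
      case (elim x)
      have "stab n x \<subseteq> supp n x" by (rule ft.stab_subset_supp[OF elim(2)])
      then have "card (stab n x) \<le> card (supp n x)" by (rule card_mono[OF ft.finite_supp])
      then have p: "0 < card (supp n x)" "0 < card (stab n x)" using card_stab_ge_1[of n x] by linarith+
      have "ln (real (card (supp n x))) \<le> ln (real (CARD('a) * card (stab n x)))"
        using elim(1) p by (subst ln_le_cancel_iff) (simp_all del: of_nat_mult)
      also have "\<dots> = ln (real CARD('a)) + ln (real (card (stab n x)))"
        using p by (simp add: ln_mult)
      finally show ?case .
    qed
  qed
  also have "\<dots> = ln (CARD('a)) + stab_entropy n"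
    unfolding stab_entropy_def using integrable_fin_rv[OF fin_rv_stab, of "\<lambda>S. ln (card S)" n]
    by (subst Bochner_Integration.integral_add) (simp_all add: prob_space)
  finally show ?thesis using supp_entropy_bound[of n] by linarith
qed

lemma AE_funpow_F_stab: "AE x in \<mu>. (F ^^ m) ` stab (n + m) x \<subseteq> stab n ((F ^^ m) x)"
proof (induction m)
  case (Suc m)
  from AE_F_stab[of "n + m"] AE_F[OF Suc] show ?case
  proof eventually_elim
    case (elim x)
    have "(F ^^ Suc m) ` stab (n + Suc m) x = (F ^^ m) ` (F ` stab (Suc (n + m)) x)"
      by (simp add: image_image funpow_swap1)
    also have "\<dots> \<subseteq> (F ^^ m) ` stab (n + m) (F x)" using elim(1) by (rule image_mono)
    also have "\<dots> \<subseteq> stab n ((F ^^ m) (F x))" by (rule elim(2))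
    finally show ?case by (simp add: funpow_swap1)
  qed
qed simp

text \<open>Counting for the homomorphism \<open>F ^^ m\<close> on \<open>stab (n + m) x\<close>:
  its kernel there is the part in \<open>D m\<close>, and its image lies in
  \<open>stab n ((F ^^ m) x)\<close>, whose logarithmic size has the same mean as at
  \<open>x\<close> by invariance of \<open>\<mu>\<close>.\<close>

lemma stab_entropy_step: "stab_entropy (n + m) \<le> stab_ker_entropy m (n + m) + stab_entropy n"
proof -
  let ?S = "\<lambda>x. stab (n + m) x"
  have "stab_entropy (n + m) \<le> expectation (\<lambda>x. ln (card (?S x \<inter> D m)) + ln (card (stab n ((F ^^ m) x))))"
    unfolding stab_entropy_def
  proof (rule integral_mono_AE)
    have "integrable \<mu> (\<lambda>x. ln (card (stab n ((F ^^ m) x))))"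
      by (rule integrable_fin_rv[OF fin_rv_F[OF fin_rv_stab]])
    then show "integrable \<mu> (\<lambda>x. ln (card (?S x \<inter> D m)) + ln (card (stab n ((F ^^ m) x))))"
      by (intro Bochner_Integration.integrable_add integrable_fin_rv[OF fin_rv_stab_D])
    show "AE x in \<mu>. ln (card (?S x)) \<le> ln (card (?S x \<inter> D m)) + ln (card (stab n ((F ^^ m) x)))"
      using AE_funpow_F_stab[of m n]
    proof eventually_elim
      case (elim x)
      let ?H = "?S x" and ?I = "stab n ((F ^^ m) x)"
      have H: "subgroup ?H G" by (rule ft.subgroup_stab)
      have finH: "finite ?H" by (rule ft.finite_stab)
      have "card {h \<in> ?H. (F ^^ m) h = c} \<le> card (?H \<inter> D m)" for c
      proof (cases "{h \<in> ?H. (F ^^ m) h = c} = {}")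
        case False
        then obtain h0 where h0: "h0 \<in> ?H" "(F ^^ m) h0 = c" by blast
        show ?thesis
        proof (rule card_inj_on_le[of "\<lambda>h. inv h0 \<otimes> h"])
          show "inj_on (\<lambda>h. inv h0 \<otimes> h) {h \<in> ?H. (F ^^ m) h = c}" by (rule inj_onI) simp
          show "(\<lambda>h. inv h0 \<otimes> h) ` {h \<in> ?H. (F ^^ m) h = c} \<subseteq> ?H \<inter> D m"
          proof (rule image_subsetI)
            fix h assume h: "h \<in> {h \<in> ?H. (F ^^ m) h = c}"
            have "inv h0 \<otimes> h \<in> ?H"
              using h h0 subgroup.m_closed[OF H] subgroup.m_inv_closed[OF H] by blast
            moreover have "(F ^^ m) (inv h0 \<otimes> h) = \<one>" using h h0 by (simp add: funpow_F_mult funpow_F_inv)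
            ultimately show "inv h0 \<otimes> h \<in> ?H \<inter> D m" by (simp add: D_def)
          qed
          show "finite (?H \<inter> D m)" using finH by simp
        qed
      next
        case True
        then show ?thesis by (simp only: card.empty)
      qed
      then have fib: "card {h \<in> ?H. (F ^^ m) h = c} \<le> card (?H \<inter> D m)" for c .
      have "?H = (\<Union>c\<in>?I. {h \<in> ?H. (F ^^ m) h = c})" using elim by blast
      then have "card ?H = card (\<Union>c\<in>?I. {h \<in> ?H. (F ^^ m) h = c})" by (rule arg_cong)
      also have "\<dots> \<le> (\<Sum>c\<in>?I. card {h \<in> ?H. (F ^^ m) h = c})" by (rule card_UN_le[OF ft.finite_stab])
      also have "\<dots> \<le> (\<Sum>c\<in>?I. card (?H \<inter> D m))" by (rule sum_mono) (rule fib)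
      finally have le: "card ?H \<le> card (?H \<inter> D m) * card ?I" by (simp add: mult.commute)
      have "\<one> \<in> ?H \<inter> D m" using one_stab by (simp add: D_def funpow_F_one)
      then have p: "0 < card (?H \<inter> D m)" using finH by (auto simp: card_gt_0_iff)
      have p': "0 < card ?I" "0 < card ?H" using card_stab_ge_1 by (simp_all add: Suc_le_eq)
      have "ln (real (card ?H)) \<le> ln (real (card (?H \<inter> D m) * card ?I))"
        using le p p' by (subst ln_le_cancel_iff) (simp_all del: of_nat_mult)
      then show ?case using p p' by (simp add: ln_mult)
    qed
  qed (rule integrable_fin_rv[OF fin_rv_stab])
  also have "\<dots> = stab_ker_entropy m (n + m) + expectation (\<lambda>x. ln (card (stab n ((F ^^ m) x))))"
    unfolding stab_ker_entropy_def
    by (rule Bochner_Integration.integral_add)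
      (rule integrable_fin_rv[OF fin_rv_stab_D], rule integrable_fin_rv[OF fin_rv_F[OF fin_rv_stab]])
  also have "expectation (\<lambda>x. ln (card (stab n ((F ^^ m) x)))) = stab_entropy n"
    unfolding stab_entropy_def by (rule expectation_F[OF fin_rv_stab])
  finally show ?thesis .
qed

lemma stab_ker_entropy_antimono:
  assumes "m \<le> n" "n \<le> n'"
  shows "stab_ker_entropy m n' \<le> stab_ker_entropy m n"
  unfolding stab_ker_entropy_def
proof (rule integral_mono_AE)
  show "AE x in \<mu>. ln (card (stab n' x \<inter> D m)) \<le> ln (card (stab n x \<inter> D m))"
    using AE_good
  proof eventually_elim
    case (elim x)
    have "stab n' x \<inter> D m \<subseteq> stab n x \<inter> D m"
      using good_stab_antimono[OF elim \<open>n \<le> n'\<close>] D_mono[OF \<open>m \<le> n\<close>] by blast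
    then have "card (stab n' x \<inter> D m) \<le> card (stab n x \<inter> D m)"
      using ft.finite_stab by (intro card_mono) simp_all
    moreover have "\<one> \<in> stab n' x \<inter> D m" using one_stab by (simp add: D_def funpow_F_one)
    then have "0 < card (stab n' x \<inter> D m)" using ft.finite_stab by (auto simp: card_gt_0_iff)
    ultimately show ?case by (subst ln_le_cancel_iff) linarith+
  qed
qed (rule integrable_fin_rv[OF fin_rv_stab_D])+

text \<open>Going from \<open>n\<close> to \<open>n + j * m\<close> takes \<open>j\<close> steps,
  each adding at most \<open>stab_ker_entropy m n\<close> because this quantity does not increase
  with \<open>n\<close>. The total must nevertheless grow at the linear rate of
  \<open>stab_entropy_lower\<close>. Dividing by \<open>j\<close> leaves the claim, in which the
  additive constants have disappeared.\<close>

lemma stab_ker_entropy_lower: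
  assumes "m \<le> n"
  shows "real m * real_of_int (s - r) * shift_entropy \<le> stab_ker_entropy m n"
proof -
  let ?c = "real_of_int (s - r) * shift_entropy"
  have up: "stab_entropy (n + j * m) \<le> stab_entropy n + real j * stab_ker_entropy m n" for j
  proof (induction j)
    case (Suc j)
    have "stab_entropy (n + Suc j * m) \<le> stab_ker_entropy m (n + j * m + m) + stab_entropy (n + j * m)"
      using stab_entropy_step[of "n + j * m" m] by (simp add: algebra_simps)
    also have "stab_ker_entropy m (n + j * m + m) \<le> stab_ker_entropy m n" by (rule stab_ker_entropy_antimono[OF assms]) simp
    finally show ?case using Suc by (simp add: algebra_simps)
  qed simp
  have "real j * (real m * ?c - stab_ker_entropy m n) \<le> stab_entropy n + ln (CARD('a))" for j
  proof -
    have "real (n + j * m) * ?c - ln (CARD('a)) \<le> stab_entropy n + real j * stab_ker_entropy m n"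
      using stab_entropy_lower[of "n + j * m"] up[of j] by (simp add: mult.assoc)
    moreover have "real j * real m * ?c \<le> real (n + j * m) * ?c"
      using shift_entropy_nonneg r_less_s by (intro mult_right_mono) simp_all
    ultimately show ?thesis by (simp add: algebra_simps)
  qed
  then have "real m * ?c - stab_ker_entropy m n \<le> 0" by (rule linear_bound_nonpos)
  then show ?thesis by (simp add: mult.assoc)
qed

lemma card_D_real: "ln (card (D m)) = real m * real_of_int (s - r) * ln (CARD('a))"
proof -
  have "0 \<le> int m * s - int m * r" using r_less_s by (simp add: mult_left_mono)
  then have "real (nat (int m * s - int m * r)) = real m * real_of_int (s - r)"
    by (simp add: right_diff_distrib)
  then show ?thesis by (simp add: card_D ln_realpow)
qed

lemma fin_rv_asym_stab_D: "fin_rv (\<lambda>x. asym_stab x \<inter> D m)"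
proof (rule fin_rv_set_valued[OF finite_D[of m]])
  show "{x \<in> space \<mu>. w \<in> asym_stab x \<inter> D m} \<in> sets \<mu>" for w
    using asym_stab_measurable[of w] by (cases "w \<in> D m") simp_all
qed blast

text \<open>At good points \<open>stab n x \<inter> D m\<close> eventually equals
  \<open>asym_stab x \<inter> D m\<close>, as it decreases inside a finite set; dominated
  convergence carries the bound to the limit.\<close>

lemma asym_stab_D_entropy: "real m * real_of_int (s - r) * shift_entropy \<le> expectation (\<lambda>x. ln (card (asym_stab x \<inter> D m)))"
proof (rule LIMSEQ_le_const)
  show "(\<lambda>n. stab_ker_entropy m n) \<longlonglongrightarrow> expectation (\<lambda>x. ln (card (asym_stab x \<inter> D m)))"
    unfolding stab_ker_entropy_def
  proof (rule integral_dominated_convergence[where w = "\<lambda>_. ln (card (D m))"])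
    show "(\<lambda>x. ln (real (card (asym_stab x \<inter> D m)))) \<in> borel_measurable \<mu>"
      by (rule borel_measurable_integrable[OF integrable_fin_rv[OF fin_rv_asym_stab_D]])
    show "(\<lambda>x. ln (real (card (stab n x \<inter> D m)))) \<in> borel_measurable \<mu>" for n
      by (rule borel_measurable_integrable[OF integrable_fin_rv[OF fin_rv_stab_D]])
    show "AE x in \<mu>. norm (ln (real (card (stab n x \<inter> D m)))) \<le> ln (real (card (D m)))" for n
    proof (rule AE_I2)
      fix x
      have "\<one> \<in> stab n x \<inter> D m" using one_stab by (simp add: D_def funpow_F_one)
      then have p: "0 < card (stab n x \<inter> D m)" using ft.finite_stab by (auto simp: card_gt_0_iff)
      moreover have "card (stab n x \<inter> D m) \<le> card (D m)" by (rule card_mono[OF finite_D]) simp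
      ultimately have "ln (real (card (stab n x \<inter> D m))) \<le> ln (real (card (D m)))"
        by (subst ln_le_cancel_iff) linarith+
      moreover have "0 \<le> ln (real (card (stab n x \<inter> D m)))" using p by (intro ln_ge_zero) simp
      ultimately show "norm (ln (real (card (stab n x \<inter> D m)))) \<le> ln (real (card (D m)))" by simp
    qed
    show "AE x in \<mu>. (\<lambda>n. ln (real (card (stab n x \<inter> D m)))) \<longlonglongrightarrow> ln (real (card (asym_stab x \<inter> D m)))"
      using AE_good
    proof eventually_elim
      case (elim x)
      have "eventually (\<lambda>n. \<forall>h\<in>D m. h \<in> stab n x \<longleftrightarrow> h \<in> asym_stab x) sequentially"
      proof (rule eventually_ball_finite[OF finite_D], rule ballI)
        fix h assume h: "h \<in> D m"
        show "eventually (\<lambda>n. h \<in> stab n x \<longleftrightarrow> h \<in> asym_stab x) sequentially"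
        proof (cases "h \<in> asym_stab x")
          case True
          then have "\<forall>n\<ge>m. h \<in> stab n x" using good_asym_stab_iff[OF elim h] by blast
          then show ?thesis using True unfolding eventually_sequentially by blast
        next
          case False
          then obtain n0 where n0: "m \<le> n0" "h \<notin> stab n0 x" using good_asym_stab_iff[OF elim h] by blast
          have "h \<notin> stab n x" if "n0 \<le> n" for n
            using good_stab_antimono[OF elim that] n0(2) D_mono[OF n0(1)] h by blast
          then show ?thesis using False unfolding eventually_sequentially by blast
        qed
      qed
      then have "eventually (\<lambda>n. ln (real (card (stab n x \<inter> D m))) = ln (real (card (asym_stab x \<inter> D m)))) sequentially"
      proof eventually_elim
        case (elim n)
        then have "stab n x \<inter> D m = asym_stab x \<inter> D m" by blast
        then show ?case by simp
      qed
      then show ?case by (rule tendsto_eventually)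
    qed
  qed simp
  show "\<exists>N. \<forall>n\<ge>N. real m * real_of_int (s - r) * shift_entropy \<le> stab_ker_entropy m n" using stab_ker_entropy_lower by blast
qed

text \<open>If almost all the groups were finite, their sizes would be at most some \<open>t\<close>
  outside a set of small measure, and on that set \<open>card (D m)\<close> is a bound whose
  logarithm is linear in \<open>m\<close>. The mean logarithm would then grow with at most half the
  required slope.\<close>

lemma measure_unbounded_stab_pos:
  assumes shift_entropy: "0 < shift_entropy"
  shows "emeasure \<mu> unbounded_stab \<noteq> 0"
proof
  assume null: "emeasure \<mu> unbounded_stab = 0"
  let ?K = "\<lambda>m x. card (asym_stab x \<inter> D m)"
  \<comment> \<open>Restricted to points outside \<open>unbounded_stab\<close>: there the sizes are
    bounded in \<open>m\<close>, so these sets decrease to the empty set.\<close>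
  define A where "A t = {x. x \<notin> unbounded_stab \<and> (\<exists>m. t < ?K m x)}" for t :: nat
  have K: "{x. t < ?K m x} \<in> sets borel" for t m
    using fin_rv_sets[OF fin_rv_asym_stab_D[of m], of "{S. t < card S}"] by (simp add: vimage_def)
  have As: "A t \<in> sets borel" for t
  proof -
    have "A t = - unbounded_stab \<inter> (\<Union>m. {x. t < ?K m x})" by (auto simp: A_def)
    also have "\<dots> \<in> sets borel" by (intro sets.Int borel_comp unbounded_stab_measurable sets.countable_UN) (use K in auto)
    finally show ?thesis .
  qed
  have "(\<lambda>t. measure \<mu> (A t)) \<longlonglongrightarrow> measure \<mu> (\<Inter>t. A t)"
  proof (rule finite_Lim_measure_decseq)
    show "decseq A" by (rule decseq_SucI) (auto simp: A_def dest: Suc_lessD)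
  qed (use As in auto)
  moreover have "(\<Inter>t. A t) = {}"
  proof (rule equals0I)
    fix x assume x: "x \<in> (\<Inter>t. A t)"
    then have fin: "finite (asym_stab x)" by (auto simp: A_def unbounded_stab_def)
    from x obtain m where "card (asym_stab x) < ?K m x" by (auto simp: A_def)
    moreover have "?K m x \<le> card (asym_stab x)" by (rule card_mono[OF fin]) simp
    ultimately show False by simp
  qed
  ultimately have lim: "(\<lambda>t. measure \<mu> (A t)) \<longlonglongrightarrow> 0" by simp
  let ?a = "ln (real CARD('a))"
  have a0: "0 \<le> ?a" by (rule ln_ge_zero) (simp add: Suc_le_eq)
  have "(\<lambda>t. measure \<mu> (A t) * ?a) \<longlonglongrightarrow> 0 * ?a" by (rule tendsto_mult_right[OF lim])
  \<comment> \<open>The threshold does not involve \<open>m\<close>, because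
    \<open>ln (card (D m))\<close> and the lower bound contain the same factor
    \<open>m * (s - r)\<close>. Below, \<open>1 \<le> t\<close> keeps \<open>ln t\<close>
    nonnegative.\<close>
  then have "eventually (\<lambda>t. measure \<mu> (A t) * ?a < shift_entropy / 2) sequentially"
    by (rule order_tendstoD(2)) (use shift_entropy in simp)
  then obtain t where t: "measure \<mu> (A t) * ?a < shift_entropy / 2" "1 \<le> t"
    unfolding eventually_sequentially by (metis max.cobounded1 max.cobounded2)
  let ?c = "real_of_int (s - r)"
  have c: "1 \<le> ?c" using r_less_s by simp
  have "real m * (?c * (shift_entropy / 2)) \<le> ln (real t)" for m
  proof -
    have "expectation (\<lambda>x. ln (?K m x)) \<le> expectation (\<lambda>x. ln (real t) + ln (card (D m)) * indicator (A t) x)"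
    proof (rule integral_mono_AE)
      show "integrable \<mu> (\<lambda>x. ln (real (?K m x)))" by (rule integrable_fin_rv[OF fin_rv_asym_stab_D])
      show "integrable \<mu> (\<lambda>x. ln (real t) + ln (real (card (D m))) * indicator (A t) x)"
        using As by (simp add: emeasure_eq_measure)
      have "AE x in \<mu>. x \<notin> unbounded_stab" using null unbounded_stab_measurable prob_eq_0[of unbounded_stab] by (simp add: measure_def)
      then show "AE x in \<mu>. ln (real (?K m x)) \<le> ln (real t) + ln (real (card (D m))) * indicator (A t) x"
      proof eventually_elim
        case (elim x)
        have "\<one> \<in> asym_stab x \<inter> D m"
          using subgroup.one_closed[OF subgroup_asym_stab] by (simp add: D_def funpow_F_one)
        then have p: "0 < ?K m x" using finite_D by (auto simp: card_gt_0_iff)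
        have le: "?K m x \<le> card (D m)" by (rule card_mono[OF finite_D]) simp
        show ?case
        proof (cases "t < ?K m x")
          case True
          then have "x \<in> A t" using elim by (auto simp: A_def)
          moreover have "ln (real (?K m x)) \<le> ln (real (card (D m)))"
            using p le by (subst ln_le_cancel_iff) linarith+
          moreover have "0 \<le> ln (real t)" using t(2) by (intro ln_ge_zero) simp
          ultimately show ?thesis by simp
        next
          case False
          then have "ln (real (?K m x)) \<le> ln (real t)" using p by (subst ln_le_cancel_iff) linarith+
          moreover have "0 \<le> ln (real (card (D m)))" using p le by (intro ln_ge_zero) simp
          then have "0 \<le> ln (real (card (D m))) * indicator (A t) x" by simp
          ultimately show ?thesis by linarith
        qed
      qed
    qed
    also have "\<dots> = ln (real t) + ln (card (D m)) * measure \<mu> (A t)"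
      using As by (subst Bochner_Integration.integral_add) (simp_all add: emeasure_eq_measure prob_space)
    also have "ln (card (D m)) * measure \<mu> (A t) = real m * ?c * (measure \<mu> (A t) * ?a)"
      by (simp add: card_D_real)
    also have "\<dots> \<le> real m * ?c * (shift_entropy / 2)"
      using t(1) c by (intro mult_left_mono) simp_all
    finally have "real m * ?c * shift_entropy \<le> ln (real t) + real m * ?c * (shift_entropy / 2)"
      using asym_stab_D_entropy[of m] by linarith
    then show ?thesis by (simp add: algebra_simps)
  qed
  then have "?c * (shift_entropy / 2) \<le> 0" by (rule linear_bound_nonpos)
  moreover have "0 < ?c * (shift_entropy / 2)" using c shift_entropy by simp
  ultimately show False by simp
qed

lemma AE_unbounded_stab_if_entropy_pos:
  assumes "ergodic_action F \<mu>" "ks_entropy \<mu> F > 0"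
  shows "AE x in \<mu>. x \<in> unbounded_stab"
proof -
  have "emeasure \<mu> unbounded_stab = 1" using unbounded_stab_trivial[OF assms(1)] measure_unbounded_stab_pos[OF shift_entropy_pos[OF assms(2)]] by blast
  then have "prob unbounded_stab = 1" by (simp add: measure_def)
  then show ?thesis using prob_eq_1[of unbounded_stab] unbounded_stab_measurable by simp
qed

end


section \<open>Measure rigidity\<close>

theorem theorem3p3:
  fixes G :: "('a::{finite,discrete_topology} config) monoid"
    and F :: "'a config \<Rightarrow> 'a config"
    and \<Sigma> :: "'a config set"
    and k :: nat
    and \<mu> :: "'a config measure"
  assumes "abelian_group_shift G"
    and "algebraic_ca G F" and "bipermutative F" and "\<not> trivial_ca F"
    and "subgroup \<Sigma> G" and "closed \<Sigma>" and "ca_shift_invariant F \<Sigma>"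
    and "\<And>p. p \<in> prime_factors (CARD('a)) \<Longrightarrow> p dvd k"
    and "borel_prob \<mu>"
    and "invariant_measure F \<mu>" and "invariant_measure shift \<mu>"
    and "measure_support \<mu> \<subseteq> \<Sigma>"
    and "ergodic_action F \<mu>"
    and "inv_sets \<mu> shift =
           inv_sets \<mu> (shift ^^ (k * smallest_common_period (kernel G G F)))"
    and "ks_entropy \<mu> F > 0"
    and "\<And>H. \<lbrakk>subgroup H G; H \<subseteq> D_infinity G F \<Sigma>; shift_invariant H; infinite H\<rbrakk>
           \<Longrightarrow> \<Sigma> \<subseteq> closure H"
  shows "\<mu> = haar_measure G \<Sigma>"
proof -
  interpret config_group G by unfold_locales (rule assms(1))
  have F: "cellular_automaton F" "F \<in> hom G G" using assms(2) by (simp_all add: algebraic_ca_def)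
  obtain r s where rs: "r < s" "biperm r s F" using biperm_if_bipermutative[OF assms(3,4)] .
  have sets: "sets \<mu> = sets borel" using assms(9) by (simp add: borel_prob_def)
  have ker: "kernel G G F = {x. F x = \<one>\<^bsub>G\<^esub>}" by (simp add: kernel_def)
  interpret rigid_system G F \<Sigma> \<mu> k r s
  proof (intro rigid_system.intro rigid_system_axioms.intro config_group_axioms)
    show "F (x \<otimes>\<^bsub>G\<^esub> y) = F x \<otimes>\<^bsub>G\<^esub> F y" for x y using F(2) by (simp add: hom_def)
    show "continuous_on UNIV F" using F(1) by (simp add: cellular_automaton_def)
    have "F \<circ> shift = shift \<circ> F" using F(1) by (simp add: cellular_automaton_def)
    from fun_cong[OF this] show "F (shift x) = shift (F x)" for x by simp
    show "AE x in \<mu>. x \<in> \<Sigma>"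
      using AE_measure_support[OF sets] by eventually_elim (use assms(12) in blast)
    show "inv_sets \<mu> shift = inv_sets \<mu> (shift ^^ (k * smallest_common_period {x. F x = \<one>\<^bsub>G\<^esub>}))"
      using assms(14) unfolding ker .
  qed (fact rs assms)+
  have D: "D_infinity G F \<Sigma> = (\<Union>n. D n) \<inter> \<Sigma>"
    by (auto simp: D_infinity_def kernel_def D_def)
  have AE: "AE x in \<mu>. x \<in> unbounded_stab" by (rule AE_unbounded_stab_if_entropy_pos[OF assms(13,15)])
  have "invariant_measure (\<lambda>x. g \<otimes>\<^bsub>G\<^esub> x) \<mu>" if "g \<in> \<Sigma>" for g
  proof (rule mu_translate[OF AE _ that])
    fix H assume "subgroup H G" "H \<subseteq> (\<Union>n. D n) \<inter> \<Sigma>" "shift ` H = H" "infinite H"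
    then show "\<Sigma> \<subseteq> closure H" by (intro assms(16)) (simp_all add: D shift_invariant_def)
  qed
  then have haar: "is_haar_measure G \<Sigma> \<mu>"
    using assms(9,12) by (simp add: is_haar_measure_def)
  \<comment> \<open>\<open>haar_measure\<close> is a definite description: \<open>\<mu>\<close>
    itself witnesses existence, and \<open>is_haar_measure_unique\<close> gives uniqueness.\<close>
  have "haar_measure G \<Sigma> = \<mu>"
    unfolding haar_measure_def
  proof (rule the_equality)
    show "\<nu> = \<mu>" if "is_haar_measure G \<Sigma> \<nu>" for \<nu>
      by (rule is_haar_measure_unique[OF that haar])
  qed (rule haar)
  then show ?thesis ..
qed

end
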